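(* Let $(X,\mu)$ be a positive measure space with $\mu(X)=\infty$. Let $\{\mathscr H(x)\}_{x\in X}$ and $\{\mathscr K(x)\}_{x\in X}$ be measurable families of Hilbert spaces with dimensions $\le N$ for some finite $N$, let $\mathscr H=\int_X^\oplus\mathscr H(x)\,d\mu(x)$ and $\mathscr K=\int_X^\oplus\mathscr K(x)\,d\mu(x)$ be the corresponding direct integrals, and let $\mathscr H_p,\mathscr K_p$ be the associated $L^p$-type spaces of vector fields. Let $S\in\mathcal B(\mathscr H,\mathscr K)\cap\mathcal B(\mathscr H_p,\mathscr K_p)$ for some $p\ne2$. If $p<2$ then $S$ is left $\mathcal F_\mu$-decay preserving, and if $p>2$ then $S$ is right $\mathcal F_\mu$-decay preserving.
   Context: For $p\ge1$, $\mathscr K_p$ is the Banach space of ($\mu$-equivalence classes of) measurable vector fields $v$ with $\int_X\|v(x)\|_{\mathscr K(x)}^p\,d\mu(x)<\infty$, so $\mathscr K_2=\mathscr K$; $\mathscr H_p$ is defined similarly. $S\in\mathcal B(\mathscr H,\mathscr K)\cap\mathcal B(\mathscr H_p,\mathscr K_p)$ means that $S\in\mathcal B(\mathscr H,\mathscr K)$ and that $S$ induces a bounded operator $\mathscr H_p\to\mathscr K_p$. $\mathcal F_\mu$ is the filter of subsets of $X$ whose complement has finite (exterior) measure. $B_\mu(X)$ is the $C^*$-algebra of $\varphi\in L^\infty(X)$ with $\lim_{\mathcal F_\mu}\varphi=0$, i.e. such that for each $\varepsilon>0$ the set where $|\varphi(x)|\ge\varepsilon$ has finite measure. $\varphi(Q)$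 denotes multiplication by $\varphi$ on $\mathscr H$ or $\mathscr K$; these direct integrals are regarded as Hilbert modules with multiplier algebra $\{\varphi(Q):\varphi\in B_\mu(X)\}$. $S\in\mathcal B(\mathscr H,\mathscr K)$ is left $\mathcal F_\mu$-decay preserving if for every $\varphi\in B_\mu(X)$ the operator $S\varphi(Q)$ belongs to the norm-closed linear span of the operators $\psi(Q)T$ with $\psi\in B_\mu(X)$, $T\in\mathcal B(\mathscr H,\mathscr K)$. $S$ is right $\mathcal F_\mu$-decay preserving if for every $\varphi\in B_\mu(X)$ the operator $\varphi(Q)S$ belongs to the norm-closed linear span of the operators $T\psi(Q)$ with $\psi\in B_\mu(X)$, $T\in\mathcal B(\mathscr H,\mathscr K)$. *)

theory Defs
  imports "HOL-Analysis.Analysis" "HOL-Algebra.Module" "HOL-Algebra.Algebraic_Closure_Type"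
begin

section \<open>Complex normed spaces and Hilbert spaces with explicit carriers\<close>

text \<open>
  The fibres of a measurable family are unrelated Hilbert spaces, so each of them is a record
  with its own carrier and operations.  Vector spaces are modules over the complex
  field; the ring components \<open>mult\<close> and \<open>one\<close> of the module record play no role.
\<close>

abbreviation complex_field :: "complex ring" where
  "complex_field \<equiv> ring_of_type_algebra"

record 'a cnormed = "(complex, 'a) module" +
  vnorm :: "'a \<Rightarrow> real"

record 'a chilbert = "'a cnormed" +
  ip :: "'a \<Rightarrow> 'a \<Rightarrow> complex"

definition lin_span :: "('a, 'm) cnormed_scheme \<Rightarrow> 'a set \<Rightarrow> 'a set" where
  "lin_span V G = \<Inter>{U. submodule U complex_field V \<and> G \<subseteq> U}"

definition closed_span :: "('a, 'm) cnormed_scheme \<Rightarrow> 'a set \<Rightarrow> 'a set" where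
  "closed_span V G =
     {x \<in> carrier V. \<forall>\<epsilon>>0. \<exists>y\<in>lin_span V G. vnorm V (x \<ominus>\<^bsub>V\<^esub> y) < \<epsilon>}"

definition dim_at_most :: "('a, 'm) cnormed_scheme \<Rightarrow> nat \<Rightarrow> bool" where
  "dim_at_most V N \<longleftrightarrow>
     (\<exists>B. finite B \<and> card B \<le> N \<and> B \<subseteq> carrier V \<and> lin_span V B = carrier V \<and>
          (\<forall>b\<in>B. b \<notin> lin_span V (B - {b})))"

locale hilbert_space = module complex_field H for H :: "'a chilbert" (structure) +
  assumes ip_add: "\<lbrakk>x \<in> carrier H; y \<in> carrier H; z \<in> carrier H\<rbrakk>
      \<Longrightarrow> ip H (x \<oplus> y) z = ip H x z + ip H y z"
    and ip_smult: "\<lbrakk>x \<in> carrier H; z \<in> carrier H\<rbrakk> \<Longrightarrow> ip H (c \<odot> x) z = c * ip H x z"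
    and ip_cnj: "\<lbrakk>x \<in> carrier H; y \<in> carrier H\<rbrakk> \<Longrightarrow> ip H y x = cnj (ip H x y)"
    and ip_nonneg: "x \<in> carrier H \<Longrightarrow> 0 \<le> Re (ip H x x)"
    and ip_definite: "\<lbrakk>x \<in> carrier H; ip H x x = 0\<rbrakk> \<Longrightarrow> x = \<zero>"
    and vnorm_eq: "x \<in> carrier H \<Longrightarrow> vnorm H x = sqrt (Re (ip H x x))"
    and complete: "\<lbrakk>\<And>n. s n \<in> carrier H;
        \<And>\<epsilon>. \<epsilon> > 0 \<Longrightarrow> \<exists>n0. \<forall>m\<ge>n0. \<forall>n\<ge>n0. vnorm H (s m \<ominus> s n) < \<epsilon>\<rbrakk>
      \<Longrightarrow> \<exists>l\<in>carrier H. (\<lambda>n. vnorm H (s n \<ominus> l)) \<longlonglongrightarrow> 0"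

text \<open>The space of bounded linear operators, with the operator norm.\<close>

definition bounded_ops ::
  "('a, 'm) cnormed_scheme \<Rightarrow> ('b, 'n) cnormed_scheme \<Rightarrow> ('a \<Rightarrow> 'b) cnormed" where
  "bounded_ops V W =
     \<lparr>carrier = {T \<in> carrier V \<rightarrow>\<^sub>E carrier W.
         (\<forall>u\<in>carrier V. \<forall>v\<in>carrier V. T (u \<oplus>\<^bsub>V\<^esub> v) = T u \<oplus>\<^bsub>W\<^esub> T v) \<and>
         (\<forall>c. \<forall>u\<in>carrier V. T (c \<odot>\<^bsub>V\<^esub> u) = c \<odot>\<^bsub>W\<^esub> T u) \<and>
         (\<exists>C. \<forall>u\<in>carrier V. vnorm W (T u) \<le> C * vnorm V u)},
      monoid.mult = undefined, one = undefined,
      ring.zero = (\<lambda>u\<in>carrier V. \<zero>\<^bsub>W\<^esub>),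
      add = (\<lambda>S T. \<lambda>u\<in>carrier V. S u \<oplus>\<^bsub>W\<^esub> T u),
      smult = (\<lambda>c T. \<lambda>u\<in>carrier V. c \<odot>\<^bsub>W\<^esub> T u),
      vnorm = (\<lambda>T. Sup {vnorm W (T u) |u. u \<in> carrier V \<and> vnorm V u \<le> 1})\<rparr>"


section \<open>Measurable families of Hilbert spaces\<close>

text \<open>The vector space of all vector fields, i.e. the product of the fibres.\<close>

definition vector_fields :: "'x measure \<Rightarrow> ('x \<Rightarrow> 'a chilbert) \<Rightarrow> (complex, 'x \<Rightarrow> 'a) module" where
  "vector_fields M H =
     \<lparr>carrier = (\<Pi>\<^sub>E x\<in>space M. carrier (H x)),
      monoid.mult = undefined, one = undefined,
      ring.zero = (\<lambda>x\<in>space M. \<zero>\<^bsub>H x\<^esub>),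
      add = (\<lambda>u v. \<lambda>x\<in>space M. u x \<oplus>\<^bsub>H x\<^esub> v x),
      smult = (\<lambda>c u. \<lambda>x\<in>space M. c \<odot>\<^bsub>H x\<^esub> u x)\<rparr>"

text \<open>
  Dixmier's definition: \<open>\<Gamma>\<close> is the set of vector fields that are declared to be measurable.
  The sequence \<open>e\<close> is a fundamental sequence, total in every fibre.
\<close>

locale measurable_family =
  fixes M :: "'x measure" and H :: "'x \<Rightarrow> 'a chilbert" and \<Gamma> :: "('x \<Rightarrow> 'a) set"
  assumes fibre: "x \<in> space M \<Longrightarrow> hilbert_space (H x)"
    and fields_subspace: "submodule \<Gamma> complex_field (vector_fields M H)"
    and vnorm_measurable: "u \<in> \<Gamma> \<Longrightarrow> (\<lambda>x. vnorm (H x) (u x)) \<in> borel_measurable M"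
    and fields_saturated: "\<lbrakk>w \<in> carrier (vector_fields M H);
        \<And>u. u \<in> \<Gamma> \<Longrightarrow> (\<lambda>x. ip (H x) (u x) (w x)) \<in> borel_measurable M\<rbrakk> \<Longrightarrow> w \<in> \<Gamma>"
    and fundamental_sequence: "\<exists>e :: nat \<Rightarrow> 'x \<Rightarrow> 'a. range e \<subseteq> \<Gamma> \<and>
        (\<forall>x\<in>space M. closed_span (H x) (range (\<lambda>n. e n x)) = carrier (H x))"


section \<open>Spaces of vector fields and the direct integral\<close>

text \<open>
  The elements of these spaces are equivalence classes, modulo equality almost everywhere, of
  measurable vector fields.  Operations on classes are defined through arbitrary representatives.
\<close>

definition field_class :: "'x measure \<Rightarrow> ('x \<Rightarrow> 'a) set \<Rightarrow> ('x \<Rightarrow> 'a) \<Rightarrow> ('x \<Rightarrow> 'a) set" where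
  "field_class M \<Gamma> u = {w \<in> \<Gamma>. AE x in M. w x = u x}"

definition Lp_fields ::
  "'x measure \<Rightarrow> ('x \<Rightarrow> 'a chilbert) \<Rightarrow> ('x \<Rightarrow> 'a) set \<Rightarrow> real \<Rightarrow> ('x \<Rightarrow> 'a) set cnormed" where
  "Lp_fields M H \<Gamma> p =
     \<lparr>carrier = field_class M \<Gamma> ` {u \<in> \<Gamma>. integrable M (\<lambda>x. vnorm (H x) (u x) powr p)},
      monoid.mult = undefined, one = undefined,
      ring.zero = field_class M \<Gamma> (\<lambda>x\<in>space M. \<zero>\<^bsub>H x\<^esub>),
      add = (\<lambda>A B. {w \<in> \<Gamma>. \<exists>u\<in>A. \<exists>v\<in>B. AE x in M. w x = u x \<oplus>\<^bsub>H x\<^esub> v x}),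
      smult = (\<lambda>c A. {w \<in> \<Gamma>. \<exists>u\<in>A. AE x in M. w x = c \<odot>\<^bsub>H x\<^esub> u x}),
      vnorm = (\<lambda>A. let u = (SOME u. u \<in> A)
                    in (\<integral>x. vnorm (H x) (u x) powr p \<partial>M) powr (1 / p))\<rparr>"

abbreviation direct_integral ::
  "'x measure \<Rightarrow> ('x \<Rightarrow> 'a chilbert) \<Rightarrow> ('x \<Rightarrow> 'a) set \<Rightarrow> ('x \<Rightarrow> 'a) set cnormed" where
  "direct_integral M H \<Gamma> \<equiv> Lp_fields M H \<Gamma> 2"

text \<open>\<open>S\<close> induces the bounded operator \<open>T\<close> if both agree on the (dense) common part of their domains.\<close>

definition induces_bounded_Lp ::
  "'x measure \<Rightarrow> ('x \<Rightarrow> 'a chilbert) \<Rightarrow> ('x \<Rightarrow> 'a) set \<Rightarrow> ('x \<Rightarrow> 'b chilbert) \<Rightarrow> ('x \<Rightarrow> 'b) set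
    \<Rightarrow> real \<Rightarrow> (('x \<Rightarrow> 'a) set \<Rightarrow> ('x \<Rightarrow> 'b) set) \<Rightarrow> bool" where
  "induces_bounded_Lp M H \<Gamma> K \<Delta> p S \<longleftrightarrow>
     (\<exists>T \<in> carrier (bounded_ops (Lp_fields M H \<Gamma> p) (Lp_fields M K \<Delta> p)).
        \<forall>A \<in> carrier (direct_integral M H \<Gamma>) \<inter> carrier (Lp_fields M H \<Gamma> p). T A = S A)"


section \<open>Multiplication operators and decay preservation\<close>

definition B_mu :: "'x measure \<Rightarrow> ('x \<Rightarrow> complex) set" where
  "B_mu M = {\<phi> \<in> borel_measurable M. (\<exists>C. AE x in M. cmod (\<phi> x) \<le> C) \<and>
     (\<forall>\<epsilon>>0. emeasure M {x \<in> space M. \<epsilon> \<le> cmod (\<phi> x)} < \<infinity>)}"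

text \<open>The multiplication operator \<open>\<phi>(Q)\<close> on the direct integral.\<close>

definition mult_op ::
  "'x measure \<Rightarrow> ('x \<Rightarrow> 'a chilbert) \<Rightarrow> ('x \<Rightarrow> 'a) set \<Rightarrow> ('x \<Rightarrow> complex)
    \<Rightarrow> ('x \<Rightarrow> 'a) set \<Rightarrow> ('x \<Rightarrow> 'a) set" where
  "mult_op M H \<Gamma> \<phi> = (\<lambda>A\<in>carrier (direct_integral M H \<Gamma>).
     {w \<in> \<Gamma>. \<exists>u\<in>A. AE x in M. w x = \<phi> x \<odot>\<^bsub>H x\<^esub> u x})"

definition left_decay_preserving ::
  "'x measure \<Rightarrow> ('x \<Rightarrow> 'a chilbert) \<Rightarrow> ('x \<Rightarrow> 'a) set \<Rightarrow> ('x \<Rightarrow> 'b chilbert) \<Rightarrow> ('x \<Rightarrow> 'b) set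
    \<Rightarrow> (('x \<Rightarrow> 'a) set \<Rightarrow> ('x \<Rightarrow> 'b) set) \<Rightarrow> bool" where
  "left_decay_preserving M H \<Gamma> K \<Delta> S \<longleftrightarrow>
     (let \<H> = direct_integral M H \<Gamma>; \<K> = direct_integral M K \<Delta> in
      \<forall>\<phi> \<in> B_mu M. compose (carrier \<H>) S (mult_op M H \<Gamma> \<phi>) \<in>
        closed_span (bounded_ops \<H> \<K>)
          {compose (carrier \<H>) (mult_op M K \<Delta> \<psi>) T |\<psi> T.
             \<psi> \<in> B_mu M \<and> T \<in> carrier (bounded_ops \<H> \<K>)})"

definition right_decay_preserving ::
  "'x measure \<Rightarrow> ('x \<Rightarrow> 'a chilbert) \<Rightarrow> ('x \<Rightarrow> 'a) set \<Rightarrow> ('x \<Rightarrow> 'b chilbert) \<Rightarrow> ('x \<Rightarrow> 'b) set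
    \<Rightarrow> (('x \<Rightarrow> 'a) set \<Rightarrow> ('x \<Rightarrow> 'b) set) \<Rightarrow> bool" where
  "right_decay_preserving M H \<Gamma> K \<Delta> S \<longleftrightarrow>
     (let \<H> = direct_integral M H \<Gamma>; \<K> = direct_integral M K \<Delta> in
      \<forall>\<phi> \<in> B_mu M. compose (carrier \<H>) (mult_op M K \<Delta> \<phi>) S \<in>
        closed_span (bounded_ops \<H> \<K>)
          {compose (carrier \<H>) T (mult_op M H \<Gamma> \<psi>) |T \<psi>.
             \<psi> \<in> B_mu M \<and> T \<in> carrier (bounded_ops \<H> \<K>)})"

end

theory Submission
  imports Defs
begin

text \<open>
  Let \<open>p < 2\<close>, let \<open>F\<close> have finite measure and write \<open>A = S 1\<^sub>F(Q)\<close>, which maps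
  \<open>L\<^sup>2\<close> boundedly into \<open>L\<^sup>2 \<inter> L\<^sup>p\<close>. Averaging over signs and comparing the second and
  fourth moments (Khintchine) bounds the square function \<open>h = \<Sum>\<^sub>i \<parallel>A u\<^sub>i(x)\<parallel>\<^sup>2\<close> of a finite
  family in \<open>L\<^bsup>p/2\<^esup>\<close> by \<open>\<Sum>\<^sub>i \<parallel>u\<^sub>i\<parallel>\<^sup>2\<close>. Hence \<open>\<integral> h\<^bsup>p/2\<^esup> - \<lambda> \<Sum>\<^sub>i \<parallel>u\<^sub>i\<parallel>\<^sup>2\<close> is bounded above for some \<open>\<lambda>\<close>.
  For an increasing almost maximizing sequence of families, appending a further vector \<open>\<surd>t v\<close>
  and letting \<open>t \<rightarrow> 0\<close> shows that \<open>A v\<close> has small norm, uniformly in the unit vector \<open>v\<close>, where all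
  the functions \<open>h\<close> are below a small \<open>\<delta>\<close>; the remaining set \<open>G\<close> has finite measure. This replaces
  Maurey's factorization theorem, and \<open>S \<phi>(Q)\<close> is approximated in norm by \<open>1\<^sub>G(Q) S \<phi>(Q)\<close>.

  For \<open>p > 2\<close> the same argument is applied to \<open>A = 1\<^sub>F(Q) S\<close> and to the functional
  \<open>\<Sum>\<^sub>i \<parallel>A u\<^sub>i\<parallel>\<^sup>2 - \<lambda> \<integral> min h (h\<^sup>\<theta>)\<close> with \<open>h = \<Sum>\<^sub>i \<parallel>u\<^sub>i(x)\<parallel>\<^sup>2\<close>. Splitting a field at height \<open>1\<close>
  and using boundedness on both \<open>L\<^sup>2\<close> and \<open>L\<^sup>p\<close>, one may take \<open>\<theta> = min (p/2) 2\<close>, so that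
  the fourth moment suffices here too and no adjoints are needed.
\<close>

section \<open>Signed sums\<close>

lemma complex_field_sel [simp]:
  "carrier complex_field = UNIV"
  "a \<oplus>\<^bsub>complex_field\<^esub> b = a + b"
  "a \<otimes>\<^bsub>complex_field\<^esub> b = a * b"
  "\<one>\<^bsub>complex_field\<^esub> = 1"
  "\<zero>\<^bsub>complex_field\<^esub> = 0"
  by (simp_all add: ring_of_type_algebra_def)

text \<open>All 2^n sums with signs, listed with repetitions so that a finite average replaces a
  probability space. Subtraction is written as scaling by -1 because \<open>\<ominus>\<close> in a
  bare record is a definite description and does not compute.\<close>

fun signed_sums :: "(complex, 'v, 'm) module_scheme \<Rightarrow> 'v list \<Rightarrow> 'v list" where
  "signed_sums V [] = [\<zero>\<^bsub>V\<^esub>]"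
| "signed_sums V (v # vs) =
     map (\<lambda>y. y \<oplus>\<^bsub>V\<^esub> v) (signed_sums V vs) @
     map (\<lambda>y. y \<oplus>\<^bsub>V\<^esub> ((-1) \<odot>\<^bsub>V\<^esub> v)) (signed_sums V vs)"

text \<open>The expectation of \<open>f\<close> at a Rademacher sum, that is, a sum with independent
  uniformly distributed signs.\<close>

definition sign_mean :: "(complex, 'v, 'm) module_scheme \<Rightarrow> ('v \<Rightarrow> real) \<Rightarrow> 'v list \<Rightarrow> real" where
  "sign_mean V f vs = sum_list (map f (signed_sums V vs)) / 2 ^ length vs"

lemma length_signed_sums: "length (signed_sums V vs) = 2 ^ length vs"
  by (induction vs) auto

lemma sign_mean_Nil [simp]: "sign_mean V f [] = f \<zero>\<^bsub>V\<^esub>"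
  by (simp add: sign_mean_def)

lemma sign_mean_add: "sign_mean V (\<lambda>y. f y + g y) vs = sign_mean V f vs + sign_mean V g vs"
  by (simp add: sign_mean_def sum_list_addf add_divide_distrib)

lemma sign_mean_cmult: "sign_mean V (\<lambda>y. c * f y) vs = c * sign_mean V f vs"
  by (simp add: sign_mean_def sum_list_const_mult)

lemma sign_mean_const [simp]: "sign_mean V (\<lambda>y. c) vs = c"
  by (simp add: sign_mean_def sum_list_triv length_signed_sums)

text \<open>Conditioning on the signs of \<open>vs\<close>: only the sign of \<open>v\<close> is
  averaged inside. The moment inductions run on this form.\<close>

lemma sign_mean_Cons:
  "sign_mean V f (v # vs) =
     sign_mean V (\<lambda>y. (f (y \<oplus>\<^bsub>V\<^esub> v) + f (y \<oplus>\<^bsub>V\<^esub> ((-1) \<odot>\<^bsub>V\<^esub> v))) / 2) vs"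
proof -
  have "sign_mean V f (v # vs) =
     (sum_list (map (\<lambda>y. f (y \<oplus>\<^bsub>V\<^esub> v)) (signed_sums V vs)) +
      sum_list (map (\<lambda>y. f (y \<oplus>\<^bsub>V\<^esub> ((-1) \<odot>\<^bsub>V\<^esub> v))) (signed_sums V vs))) / (2 * 2 ^ length vs)"
    by (simp add: sign_mean_def o_def)
  also have "\<dots> = sign_mean V (\<lambda>y. (1/2) * (f (y \<oplus>\<^bsub>V\<^esub> v) + f (y \<oplus>\<^bsub>V\<^esub> ((-1) \<odot>\<^bsub>V\<^esub> v)))) vs"
    unfolding sign_mean_cmult sign_mean_add by (simp add: sign_mean_def add_divide_distrib)
  finally show ?thesis by simp
qed

lemma sign_mean_mono:
  "(\<And>y. y \<in> set (signed_sums V vs) \<Longrightarrow> f y \<le> g y) \<Longrightarrow> sign_mean V f vs \<le> sign_mean V g vs"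
  by (simp add: sign_mean_def divide_right_mono sum_list_mono)

lemma sign_mean_cong:
  "(\<And>y. y \<in> set (signed_sums V vs) \<Longrightarrow> f y = g y) \<Longrightarrow> sign_mean V f vs = sign_mean V g vs"
  by (metis sign_mean_mono order_antisym order_refl)

lemma signed_sums_closed:
  assumes "\<zero>\<^bsub>V\<^esub> \<in> U" "\<And>a b. a \<in> U \<Longrightarrow> b \<in> U \<Longrightarrow> a \<oplus>\<^bsub>V\<^esub> b \<in> U"
    "\<And>c a. a \<in> U \<Longrightarrow> c \<odot>\<^bsub>V\<^esub> a \<in> U" "set vs \<subseteq> U"
  shows "set (signed_sums V vs) \<subseteq> U"
  using assms(4) by (induction vs) (auto intro: assms(1-3))

section \<open>Moments of signed sums\<close>

context hilbert_space
begin

section \<open>Inner product identities and the Cauchy-Schwarz inequality\<close>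

lemma smult_complex_closed [simp]: "x \<in> carrier H \<Longrightarrow> c \<odot> x \<in> carrier H"
  by (rule smult_closed) auto

lemma vnorm_sq: "x \<in> carrier H \<Longrightarrow> (vnorm H x)\<^sup>2 = Re (ip H x x)"
  by (simp add: vnorm_eq ip_nonneg)

lemma vnorm_nonneg: "x \<in> carrier H \<Longrightarrow> 0 \<le> vnorm H x"
  by (simp add: vnorm_eq ip_nonneg)

lemma ip_smult_right: "\<lbrakk>x \<in> carrier H; y \<in> carrier H\<rbrakk> \<Longrightarrow> ip H x (c \<odot> y) = cnj c * ip H x y"
  using ip_cnj[of "c \<odot> y" x] ip_cnj[of y x] by (simp add: ip_smult)

lemma ip_add_right:
  "\<lbrakk>x \<in> carrier H; y \<in> carrier H; z \<in> carrier H\<rbrakk> \<Longrightarrow> ip H z (x \<oplus> y) = ip H z x + ip H z y"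
  using ip_cnj[of "x \<oplus> y" z] ip_cnj[of x z] ip_cnj[of y z] by (simp add: ip_add)

lemma ip_self_of_real: "x \<in> carrier H \<Longrightarrow> ip H x x = of_real (Re (ip H x x))"
  using ip_cnj[of x x] by (simp add: complex_eq_iff)

lemma vnorm_smult: "x \<in> carrier H \<Longrightarrow> vnorm H (c \<odot> x) = cmod c * vnorm H x"
proof -
  assume x: "x \<in> carrier H"
  have "ip H (c \<odot> x) (c \<odot> x) = c * cnj c * ip H x x"
    using x by (simp add: ip_smult ip_smult_right)
  also have "\<dots> = of_real ((cmod c)\<^sup>2 * Re (ip H x x))"
    unfolding complex_norm_square[symmetric] of_real_mult ip_self_of_real[OF x, symmetric] ..
  finally have "(vnorm H (c \<odot> x))\<^sup>2 = (cmod c * vnorm H x)\<^sup>2"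
    using x by (simp add: vnorm_sq power_mult_distrib)
  then show ?thesis
    using x by (simp add: vnorm_nonneg)
qed

lemma vnorm_zero [simp]: "vnorm H \<zero> = 0"
proof -
  have "vnorm H (0 \<odot> \<zero>) = cmod 0 * vnorm H \<zero>" by (rule vnorm_smult) simp
  then show ?thesis by simp
qed

lemma vnorm_add_sq:
  assumes "x \<in> carrier H" "y \<in> carrier H"
  shows "(vnorm H (x \<oplus> y))\<^sup>2 = (vnorm H x)\<^sup>2 + (vnorm H y)\<^sup>2 + 2 * Re (ip H x y)"
proof -
  have "Re (ip H y x) = Re (ip H x y)" using assms by (simp add: ip_cnj[of x y])
  then show ?thesis using assms by (simp add: vnorm_sq ip_add ip_add_right)
qed

lemma vnorm_diff_sq:
  assumes "x \<in> carrier H" "y \<in> carrier H"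
  shows "(vnorm H (x \<oplus> (-1) \<odot> y))\<^sup>2 = (vnorm H x)\<^sup>2 + (vnorm H y)\<^sup>2 - 2 * Re (ip H x y)"
  using assms by (simp add: vnorm_add_sq vnorm_smult ip_smult_right)

text \<open>The parallelogram law with the norm of the difference dropped.\<close>

lemma vnorm_add_sq_le:
  assumes "x \<in> carrier H" "y \<in> carrier H"
  shows "(vnorm H (x \<oplus> y))\<^sup>2 \<le> 2 * (vnorm H x)\<^sup>2 + 2 * (vnorm H y)\<^sup>2"
  using vnorm_add_sq[OF assms] vnorm_diff_sq[OF assms]
    zero_le_power2[of "vnorm H (x \<oplus> (-1) \<odot> y)"] by linarith

text \<open>Cauchy-Schwarz for the real part, which is the part that survives in expansions with
  real signs.\<close>

lemma Re_ip_sq_le: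
  assumes "x \<in> carrier H" "y \<in> carrier H"
  shows "(Re (ip H x y))\<^sup>2 \<le> (vnorm H x)\<^sup>2 * (vnorm H y)\<^sup>2"
proof (cases "vnorm H y = 0")
  case True
  then have "y = \<zero>"
    using assms(2) ip_definite[of y] ip_self_of_real[of y] vnorm_sq[of y] by simp
  then have "ip H x y = 0"
    using assms ip_smult_right[of x y 0] smult_l_null[of y] by simp
  then show ?thesis by simp
next
  case False
  define r where "r = Re (ip H x y)"
  define b where "b = (vnorm H y)\<^sup>2"
  have b: "b > 0" using False by (simp add: b_def)
  have sq: "(vnorm H (x \<oplus> of_real t \<odot> y))\<^sup>2 = (vnorm H x)\<^sup>2 + t\<^sup>2 * b + 2 * t * r" for t
    using assms by (simp add: vnorm_add_sq vnorm_smult ip_smult_right power_mult_distrib b_def r_def)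
  \<comment> \<open>The value \<open>- r / b\<close> minimizes the quadratic polynomial in
    \<open>t\<close> given by \<open>sq\<close>.\<close>
  have "0 \<le> (vnorm H (x \<oplus> of_real (- r / b) \<odot> y))\<^sup>2" by simp
  also have "\<dots> = (vnorm H x)\<^sup>2 + (- r / b)\<^sup>2 * b + 2 * (- r / b) * r"
    by (rule sq)
  also have "\<dots> = (vnorm H x)\<^sup>2 - r\<^sup>2 / b"
    using b by (simp add: power2_eq_square)
  finally have "r\<^sup>2 / b \<le> (vnorm H x)\<^sup>2" by simp
  then show ?thesis using b by (simp add: divide_le_eq b_def r_def)
qed

section \<open>Second and fourth moments of Rademacher sums\<close>

lemma signed_sums_carrier:
  "set as \<subseteq> carrier H \<Longrightarrow> set (signed_sums H as) \<subseteq> carrier H"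
  by (rule signed_sums_closed) auto

text \<open>The cross terms of opposite signs cancel, so the signed vectors behave as if they were
  orthogonal.\<close>

lemma sign_mean_second_moment:
  assumes "set as \<subseteq> carrier H"
  shows "sign_mean H (\<lambda>y. (vnorm H y)\<^sup>2) as = (\<Sum>a\<leftarrow>as. (vnorm H a)\<^sup>2)"
  using assms
proof (induction as)
  case (Cons a as)
  then have "sign_mean H (\<lambda>y. (vnorm H y)\<^sup>2) (a # as) =
      sign_mean H (\<lambda>y. (vnorm H y)\<^sup>2 + (vnorm H a)\<^sup>2) as"
    unfolding sign_mean_Cons
  proof (intro sign_mean_cong)
    fix y assume "y \<in> set (signed_sums H as)"
    then have y: "y \<in> carrier H" using signed_sums_carrier[of as] Cons by auto
    have a: "a \<in> carrier H" using Cons by simp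
    show "((vnorm H (y \<oplus> a))\<^sup>2 + (vnorm H (y \<oplus> (-1) \<odot> a))\<^sup>2) / 2 = (vnorm H y)\<^sup>2 + (vnorm H a)\<^sup>2"
      unfolding vnorm_add_sq[OF y a] vnorm_diff_sq[OF y a] by simp
  qed
  then show ?case using Cons by (simp add: sign_mean_add)
qed simp

text \<open>Averaging over the sign of the new vector \<open>a\<close> leaves
  \<open>4 * (Re (ip H y a))\<^sup>2\<close> as the only mixed term, and Cauchy-Schwarz bounds it by
  the second moment. The constant 3 is reproduced because 3 s^2 + 6 b s + b^2 is at most 3 (b +
  s)^2.\<close>

lemma sign_mean_fourth_moment:
  assumes "set as \<subseteq> carrier H"
  shows "sign_mean H (\<lambda>y. ((vnorm H y)\<^sup>2)\<^sup>2) as \<le> 3 * (\<Sum>a\<leftarrow>as. (vnorm H a)\<^sup>2)\<^sup>2"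
  using assms
proof (induction as)
  case (Cons a as)
  define s where "s = (\<Sum>a\<leftarrow>as. (vnorm H a)\<^sup>2)"
  define b where "b = (vnorm H a)\<^sup>2"
  have a: "a \<in> carrier H" and as: "set as \<subseteq> carrier H" using Cons by auto
  have "sign_mean H (\<lambda>y. ((vnorm H y)\<^sup>2)\<^sup>2) (a # as) \<le>
      sign_mean H (\<lambda>y. ((vnorm H y)\<^sup>2)\<^sup>2 + (6 * b) * (vnorm H y)\<^sup>2 + b\<^sup>2) as"
    unfolding sign_mean_Cons
  proof (rule sign_mean_mono)
    fix y assume "y \<in> set (signed_sums H as)"
    then have y: "y \<in> carrier H" using signed_sums_carrier[OF as] by auto
    have "(((vnorm H (y \<oplus> a))\<^sup>2)\<^sup>2 + ((vnorm H (y \<oplus> (-1) \<odot> a))\<^sup>2)\<^sup>2) / 2 =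
        ((vnorm H y)\<^sup>2 + b)\<^sup>2 + 4 * (Re (ip H y a))\<^sup>2"
      unfolding vnorm_add_sq[OF y a] vnorm_diff_sq[OF y a] b_def
      by (simp add: power2_eq_square algebra_simps)
    also have "\<dots> \<le> ((vnorm H y)\<^sup>2 + b)\<^sup>2 + 4 * ((vnorm H y)\<^sup>2 * b)"
      using Re_ip_sq_le[OF y a] by (simp add: b_def)
    also have "\<dots> = ((vnorm H y)\<^sup>2)\<^sup>2 + (6 * b) * (vnorm H y)\<^sup>2 + b\<^sup>2"
      by (simp add: power2_eq_square algebra_simps)
    finally show "(((vnorm H (y \<oplus> a))\<^sup>2)\<^sup>2 + ((vnorm H (y \<oplus> (-1) \<odot> a))\<^sup>2)\<^sup>2) / 2
      \<le> ((vnorm H y)\<^sup>2)\<^sup>2 + (6 * b) * (vnorm H y)\<^sup>2 + b\<^sup>2" .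
  qed
  also have "\<dots> = sign_mean H (\<lambda>y. ((vnorm H y)\<^sup>2)\<^sup>2) as + 6 * b * s + b\<^sup>2"
    unfolding sign_mean_add sign_mean_cmult
    by (simp add: sign_mean_second_moment[OF as] s_def)
  also have "\<dots> \<le> 3 * s\<^sup>2 + 6 * b * s + b\<^sup>2"
    using Cons.IH[OF as] by (simp add: s_def)
  also have "\<dots> \<le> 3 * (b + s)\<^sup>2"
    by (simp add: power2_eq_square algebra_simps)
  finally show ?case by (simp add: s_def b_def)
qed simp

end

text \<open>A quadratic minorant of the power, normalized to have maximum 1, attained at z = 3. If z
  has mean 1 and second moment at most 3, its mean is still at least 2/3 - 3/9 = 1/3.\<close>

lemma le_powr_of_le_one:
  fixes z \<theta> :: real
  assumes "0 \<le> z" "0 < \<theta>" "\<theta> \<le> 1"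
  shows "2 / 3 * z - z\<^sup>2 / 9 \<le> z powr \<theta>"
proof (cases "z \<le> 1")
  case True
  have "z \<le> z powr \<theta>"
  proof (cases "z = 0")
    case False
    then show ?thesis using powr_mono'[of \<theta> 1 z] assms True by simp
  qed simp
  moreover have "2 / 3 * z - z\<^sup>2 / 9 \<le> z" using assms by (simp add: field_simps)
  ultimately show ?thesis by linarith
next
  case False
  then have "1 \<le> z powr \<theta>" using assms by (simp add: ge_one_powr_ge_zero)
  moreover have "0 \<le> (z - 3)\<^sup>2" by simp
  then have "2 / 3 * z - z\<^sup>2 / 9 \<le> 1" by (simp add: power2_eq_square algebra_simps)
  ultimately show ?thesis by linarith
qed

text \<open>The power lies below the larger of z and z^2. The quadratic majorant makes it accessible
  to the second and fourth moments of a norm.\<close>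

lemma powr_le_of_ge_one:
  fixes z \<theta> :: real
  assumes "0 \<le> z" "1 \<le> \<theta>" "\<theta> \<le> 2"
  shows "z powr \<theta> \<le> z + z\<^sup>2"
proof (cases "z \<le> 1")
  case True
  have "z powr \<theta> \<le> z"
  proof (cases "z = 0")
    case False
    then show ?thesis using powr_mono'[of 1 \<theta> z] assms True by simp
  qed simp
  then show ?thesis by (simp add: add_increasing2)
next
  case False
  then have "z powr \<theta> \<le> z powr 2" using assms by (intro powr_mono) auto
  also have "\<dots> = z\<^sup>2" using False by simp
  finally show ?thesis using assms(1) by linarith
qed

text \<open>The bounds of the fourth moment by the square of the second give Khintchine's inequality.\<close>

lemma (in hilbert_space) khintchine_lower:
  assumes as: "set as \<subseteq> carrier H" and "0 < \<theta>" "\<theta> \<le> 1"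
  shows "(\<Sum>a\<leftarrow>as. (vnorm H a)\<^sup>2) powr \<theta> \<le> 3 * sign_mean H (\<lambda>y. (vnorm H y)\<^sup>2 powr \<theta>) as"
proof -
  define s where "s = (\<Sum>a\<leftarrow>as. (vnorm H a)\<^sup>2)"
  have "s \<ge> 0" unfolding s_def by (rule sum_list_nonneg) auto
  show ?thesis
  proof (cases "s = 0")
    case True
    have "0 \<le> sign_mean H (\<lambda>y. (vnorm H y)\<^sup>2 powr \<theta>) as"
      using sign_mean_mono[of H as "\<lambda>_. 0" "\<lambda>y. (vnorm H y)\<^sup>2 powr \<theta>"] by simp
    then show ?thesis using True by (simp add: s_def)
  next
    case False
    then have s: "s > 0" using \<open>s \<ge> 0\<close> by simp
    \<comment> \<open>Here 1/3 is the quadratic minorant evaluated at moments 1 and 3 of the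
      normalized variable |y|^2 / s. The fourth moment enters with a negative sign, so its upper
      bound is the one that serves.\<close>
    have "s powr \<theta> * (1/3) = s powr \<theta> * (2 / 3 / s * s - 1 / 9 / s\<^sup>2 * (3 * s\<^sup>2))"
      using s by simp
    also have "\<dots> \<le> s powr \<theta> * (2 / 3 / s * sign_mean H (\<lambda>y. (vnorm H y)\<^sup>2) as
        + (- (1 / 9 / s\<^sup>2)) * sign_mean H (\<lambda>y. ((vnorm H y)\<^sup>2)\<^sup>2) as)"
      using s sign_mean_fourth_moment[OF as] sign_mean_second_moment[OF as]
      by (intro mult_left_mono) (auto simp: s_def divide_right_mono divide_le_cancel field_simps)
    also have "\<dots> = sign_mean H (\<lambda>y. s powr \<theta> * (2 / 3 / s * (vnorm H y)\<^sup>2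
        + (- (1 / 9 / s\<^sup>2)) * ((vnorm H y)\<^sup>2)\<^sup>2)) as"
      by (simp only: sign_mean_cmult sign_mean_add)
    also have "\<dots> \<le> sign_mean H (\<lambda>y. (vnorm H y)\<^sup>2 powr \<theta>) as"
    proof (rule sign_mean_mono)
      fix y
      have "2 / 3 / s * (vnorm H y)\<^sup>2 + (- (1 / 9 / s\<^sup>2)) * ((vnorm H y)\<^sup>2)\<^sup>2 \<le> ((vnorm H y)\<^sup>2 / s) powr \<theta>"
        using le_powr_of_le_one[of "(vnorm H y)\<^sup>2 / s" \<theta>] s assms by (simp add: power_divide)
      then have "s powr \<theta> * (2 / 3 / s * (vnorm H y)\<^sup>2 + (- (1 / 9 / s\<^sup>2)) * ((vnorm H y)\<^sup>2)\<^sup>2)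
          \<le> s powr \<theta> * ((vnorm H y)\<^sup>2 / s) powr \<theta>"
        by (intro mult_left_mono) auto
      also have "\<dots> = (vnorm H y)\<^sup>2 powr \<theta>"
        using s by (simp add: powr_divide)
      finally show "s powr \<theta> * (2 / 3 / s * (vnorm H y)\<^sup>2 + (- (1 / 9 / s\<^sup>2)) * ((vnorm H y)\<^sup>2)\<^sup>2)
          \<le> (vnorm H y)\<^sup>2 powr \<theta>" .
    qed
    finally show ?thesis by (simp add: s_def)
  qed
qed

text \<open>After division by the second moment, the majorant z + z^2 has mean at most 1 + 3, whence
  the constant 4.\<close>

lemma (in hilbert_space) khintchine_upper:
  assumes as: "set as \<subseteq> carrier H" and "1 \<le> \<theta>" "\<theta> \<le> 2"
  shows "sign_mean H (\<lambda>y. (vnorm H y)\<^sup>2 powr \<theta>) as \<le> 4 * (\<Sum>a\<leftarrow>as. (vnorm H a)\<^sup>2) powr \<theta>"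
proof -
  define s where "s = (\<Sum>a\<leftarrow>as. (vnorm H a)\<^sup>2)"
  have "s \<ge> 0" unfolding s_def by (rule sum_list_nonneg) auto
  show ?thesis
  proof (cases "s = 0")
    case True
    have "sign_mean H (\<lambda>y. (vnorm H y)\<^sup>2 powr \<theta>) as \<le>
        sign_mean H (\<lambda>y. (vnorm H y)\<^sup>2 + ((vnorm H y)\<^sup>2)\<^sup>2) as"
      by (rule sign_mean_mono) (rule powr_le_of_ge_one, use assms in auto)
    also have "\<dots> \<le> 0"
      using True sign_mean_fourth_moment[OF as] sign_mean_second_moment[OF as]
      by (simp add: sign_mean_add s_def)
    finally show ?thesis using True by (simp add: s_def)
  next
    case False
    then have s: "s > 0" using \<open>s \<ge> 0\<close> by simp
    have "sign_mean H (\<lambda>y. (vnorm H y)\<^sup>2 powr \<theta>) as \<le>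
       sign_mean H (\<lambda>y. s powr \<theta> * (1 / s * (vnorm H y)\<^sup>2 + 1 / s\<^sup>2 * ((vnorm H y)\<^sup>2)\<^sup>2)) as"
    proof (rule sign_mean_mono)
      fix y
      have "(vnorm H y)\<^sup>2 powr \<theta> = s powr \<theta> * ((vnorm H y)\<^sup>2 / s) powr \<theta>"
        using s by (simp add: powr_divide)
      also have "\<dots> \<le> s powr \<theta> * ((vnorm H y)\<^sup>2 / s + ((vnorm H y)\<^sup>2 / s)\<^sup>2)"
        using s assms by (intro mult_left_mono powr_le_of_ge_one) auto
      finally show "(vnorm H y)\<^sup>2 powr \<theta> \<le>
          s powr \<theta> * (1 / s * (vnorm H y)\<^sup>2 + 1 / s\<^sup>2 * ((vnorm H y)\<^sup>2)\<^sup>2)"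
        by (simp add: power_divide)
    qed
    also have "\<dots> = s powr \<theta> * (1 / s * sign_mean H (\<lambda>y. (vnorm H y)\<^sup>2) as
        + 1 / s\<^sup>2 * sign_mean H (\<lambda>y. ((vnorm H y)\<^sup>2)\<^sup>2) as)"
      by (simp only: sign_mean_cmult sign_mean_add)
    also have "\<dots> \<le> s powr \<theta> * (1 / s * s + 1 / s\<^sup>2 * (3 * s\<^sup>2))"
      using s sign_mean_fourth_moment[OF as] sign_mean_second_moment[OF as]
      by (intro mult_left_mono add_mono) (auto simp: s_def)
    also have "\<dots> = 4 * s powr \<theta>" using s by simp
    finally show ?thesis by (simp add: s_def)
  qed
qed

section \<open>Real inequalities\<close>

text \<open>The left end point may be 0, where the power need not be differentiable; the mean value
  theorem asks only for continuity there.\<close>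

lemma powr_diff_mean_value:
  fixes a c \<theta> :: real
  assumes "0 \<le> a" "0 < c" "0 < \<theta>"
  obtains z where "a < z" "z < a + c" "(a + c) powr \<theta> - a powr \<theta> = \<theta> * z powr (\<theta> - 1) * c"
proof -
  have "continuous_on {a..a + c} (\<lambda>z. z powr \<theta>)"
    using assms by (intro continuous_on_powr' continuous_intros) auto
  moreover have D: "((\<lambda>z. z powr \<theta>) has_real_derivative \<theta> * z powr (\<theta> - 1)) (at z)" if "a < z" for z
    using that assms by (auto intro!: derivative_eq_intros simp: powr_diff)
  then have "(\<lambda>z. z powr \<theta>) differentiable (at z)" if "a < z" for z
    using that real_differentiable_def by blast
  ultimately obtain l z where z: "a < z" "z < a + c" and l: "((\<lambda>z. z powr \<theta>) has_real_derivative l) (at z)"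
    "(a + c) powr \<theta> - a powr \<theta> = (a + c - a) * l"
    using MVT[of a "a + c" "\<lambda>z. z powr \<theta>"] assms(2) by auto
  have "l = \<theta> * z powr (\<theta> - 1)" using DERIV_unique[OF l(1) D[OF z(1)]] .
  then show ?thesis using that z l(2) by simp
qed

text \<open>The slope of a concave power decreases, so the slope at \<open>d\<close> is a lower
  bound. It blows up as \<open>d\<close> tends to 0 when \<theta> < 1, which makes small
  perturbations profitable where the square functions are small.\<close>

lemma powr_diff_ge:
  fixes a c \<theta> d :: real
  assumes "0 \<le> a" "0 \<le> c" "a + c \<le> d" "0 < \<theta>" "\<theta> \<le> 1"
  shows "\<theta> * d powr (\<theta> - 1) * c \<le> (a + c) powr \<theta> - a powr \<theta>"
proof (cases "c = 0")
  case False
  then obtain z where z: "a < z" "z < a + c" "(a + c) powr \<theta> - a powr \<theta> = \<theta> * z powr (\<theta> - 1) * c"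
    using powr_diff_mean_value[of a c \<theta>] assms by (metis less_eq_real_def)
  have "d powr (\<theta> - 1) \<le> z powr (\<theta> - 1)"
    using z assms by (intro powr_mono2') auto
  then show ?thesis using z assms by (simp add: mult_right_mono)
qed simp

text \<open>The slope of a convex power increases, so the slope at \<open>d\<close> is an upper
  bound. It vanishes as \<open>d\<close> tends to 0 when \<theta> > 1.\<close>

lemma powr_diff_le:
  fixes a c \<theta> d :: real
  assumes "0 \<le> a" "0 \<le> c" "a + c \<le> d" "1 \<le> \<theta>"
  shows "(a + c) powr \<theta> - a powr \<theta> \<le> \<theta> * d powr (\<theta> - 1) * c"
proof (cases "c = 0")
  case False
  then obtain z where z: "a < z" "z < a + c" "(a + c) powr \<theta> - a powr \<theta> = \<theta> * z powr (\<theta> - 1) * c"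
    using powr_diff_mean_value[of a c \<theta>] assms by (metis less_eq_real_def zero_less_one less_le_trans)
  have "z powr (\<theta> - 1) \<le> d powr (\<theta> - 1)"
    using z assms by (intro powr_mono2) auto
  then show ?thesis using z assms by (simp add: mult_right_mono)
qed simp

lemma powr_le_self:
  fixes z \<theta> :: real
  assumes "0 \<le> z" "z \<le> 1" "1 \<le> \<theta>"
  shows "z powr \<theta> \<le> z"
  using powr_mono'[of 1 \<theta> z] assms by (cases "z = 0") auto

text \<open>For c \<le> \<delta> both arguments stay below 2 \<delta> \<le> 1, where the minimum is
  the power. For c > \<delta> > a the trivial bound a + c \<le> 2 c is used; this second term
  disappears when the perturbation is scaled down.\<close>

lemma min_powr_diff_le:
  fixes a c \<theta> \<delta> :: real
  assumes "0 \<le> a" "0 \<le> c" "a < \<delta>" "2 * \<delta> \<le> 1" "1 \<le> \<theta>"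
  shows "min (a + c) ((a + c) powr \<theta>) - min a (a powr \<theta>) \<le>
    \<theta> * (2 * \<delta>) powr (\<theta> - 1) * c + (if \<delta> < c then 2 * c else 0)"
proof (cases "\<delta> < c")
  case True
  have "min (a + c) ((a + c) powr \<theta>) - min a (a powr \<theta>) \<le> 2 * c"
    using assms True by (smt (verit) powr_ge_zero)
  moreover have "0 \<le> \<theta> * (2 * \<delta>) powr (\<theta> - 1) * c" using assms by simp
  ultimately show ?thesis using True by simp
next
  case False
  have "min (a + c) ((a + c) powr \<theta>) - min a (a powr \<theta>) = (a + c) powr \<theta> - a powr \<theta>"
    using powr_le_self[of "a + c" \<theta>] powr_le_self[of a \<theta>] assms False by simp
  then show ?thesis using powr_diff_le[of a c "2 * \<delta>" \<theta>] assms False by simp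
qed

lemma powr_small:
  fixes r e :: real
  assumes "0 < r" "0 < e"
  obtains \<delta> where "0 < \<delta>" "2 * \<delta> \<le> 1" "(2 * \<delta>) powr r \<le> e"
proof -
  define d where "d = min 1 (e powr (1 / r))"
  have "0 < d" using assms by (simp add: d_def)
  moreover have "d powr r \<le> (e powr (1 / r)) powr r"
    using \<open>0 < d\<close> assms by (intro powr_mono2) (auto simp: d_def)
  then have "d powr r \<le> e" using assms by (simp add: powr_powr)
  ultimately show ?thesis using that[of "d / 2"] by (simp add: d_def)
qed

lemma le_of_le_add_inverse:
  fixes a b :: real
  assumes "\<And>n. a \<le> b + 1 / Suc n"
  shows "a \<le> b"
proof (rule field_le_epsilon)
  fix e :: real assume "0 < e"
  then obtain n where "1 / real (Suc n) < e"
    using reals_Archimedean by (metis inverse_eq_divide)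
  then show "a \<le> b + e" using assms[of n] by linarith
qed

section \<open>Integrals of truncations\<close>

text \<open>The truncation keeps \<open>f\<close> exactly where the perturbation
  \<open>f x / Suc n\<close> is at most \<delta>, the range in which the slope bounds apply.\<close>

lemma integrable_truncation:
  fixes f :: "'x \<Rightarrow> real"
  assumes f: "integrable M f" and G [measurable]: "G \<in> sets M"
  shows "integrable M (\<lambda>x. indicator G x * (if f x / Suc n \<le> \<delta> then f x else 0))"
proof (rule Bochner_Integration.integrable_bound[OF f])
  have [measurable]: "f \<in> borel_measurable M" using f by simp
  show "(\<lambda>x. indicator G x * (if f x / Suc n \<le> \<delta> then f x else 0)) \<in> borel_measurable M"
    by measurable
  show "AE x in M. norm (indicator G x * (if f x / Suc n \<le> \<delta> then f x else 0)) \<le> norm (f x)"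
    by (intro AE_I2) (auto simp: indicator_def)
qed

text \<open>At each point the condition holds from some \<open>n\<close> on, and |f|
  dominates.\<close>

lemma integral_truncation_tendsto:
  fixes f :: "'x \<Rightarrow> real"
  assumes f: "integrable M f" and G: "G \<in> sets M" and "0 < \<delta>"
  shows "(\<lambda>n. \<integral>x. indicator G x * (if f x / Suc n \<le> \<delta> then f x else 0) \<partial>M)
    \<longlonglongrightarrow> (\<integral>x. indicator G x * f x \<partial>M)"
proof (rule integral_dominated_convergence[where w = "\<lambda>x. \<bar>f x\<bar>"])
  have [measurable]: "f \<in> borel_measurable M" using f by simp
  note [measurable] = G
  show "(\<lambda>x. indicator G x * f x) \<in> borel_measurable M" by measurable
  show "(\<lambda>x. indicator G x * (if f x / Suc n \<le> \<delta> then f x else 0)) \<in> borel_measurable M" for n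
    by (intro borel_measurable_integrable integrable_truncation f G)
  show "AE x in M. (\<lambda>n. indicator G x * (if f x / Suc n \<le> \<delta> then f x else 0)) \<longlonglongrightarrow> indicator G x * f x"
  proof (rule AE_I2)
    fix x
    have "(\<lambda>n. f x / real (Suc n)) \<longlonglongrightarrow> 0"
      using LIMSEQ_Suc[OF lim_const_over_n[of "f x"]] by simp
    then have "\<forall>\<^sub>F n in sequentially. f x / real (Suc n) < \<delta>"
      using \<open>0 < \<delta>\<close> by (rule order_tendstoD(2))
    then have "\<forall>\<^sub>F n in sequentially.
        indicator G x * f x = indicator G x * (if f x / Suc n \<le> \<delta> then f x else 0)"
      by eventually_elim simp
    then show "(\<lambda>n. indicator G x * (if f x / Suc n \<le> \<delta> then f x else 0)) \<longlonglongrightarrow> indicator G x * f x"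
      by (rule Lim_transform_eventually[rotated]) simp
  qed
  show "integrable M (\<lambda>x. \<bar>f x\<bar>)" using f by simp
  show "AE x in M. norm (indicator G x * (if f x / Suc n \<le> \<delta> then f x else 0)) \<le> \<bar>f x\<bar>" for n
    by (intro AE_I2) (auto simp: indicator_def)
qed

lemma integrable_sum_list:
  fixes f :: "'a \<Rightarrow> 'x \<Rightarrow> real"
  shows "(\<And>a. a \<in> set as \<Longrightarrow> integrable M (f a)) \<Longrightarrow> integrable M (\<lambda>x. \<Sum>a\<leftarrow>as. f a x)"
  by (induction as) auto

lemma integral_sum_list:
  fixes f :: "'a \<Rightarrow> 'x \<Rightarrow> real"
  shows "(\<And>a. a \<in> set as \<Longrightarrow> integrable M (f a)) \<Longrightarrow>
    (\<integral>x. (\<Sum>a\<leftarrow>as. f a x) \<partial>M) = (\<Sum>a\<leftarrow>as. \<integral>x. f a x \<partial>M)"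
  by (induction as) (auto simp: integrable_sum_list)

lemma borel_measurable_sum_list:
  fixes f :: "'a \<Rightarrow> 'x \<Rightarrow> real"
  shows "(\<And>a. a \<in> set as \<Longrightarrow> f a \<in> borel_measurable M) \<Longrightarrow>
    (\<lambda>x. \<Sum>a\<leftarrow>as. f a x) \<in> borel_measurable M"
  by (induction as) auto

lemma integrable_sign_mean:
  assumes "\<And>a. a \<in> set (signed_sums V as) \<Longrightarrow> integrable M (f a)"
  shows "integrable M (\<lambda>x. sign_mean V (\<lambda>a. f a x) as)"
  unfolding sign_mean_def using assms by (intro integrable_divide integrable_sum_list) auto

lemma integral_sign_mean:
  assumes "\<And>a. a \<in> set (signed_sums V as) \<Longrightarrow> integrable M (f a)"
  shows "(\<integral>x. sign_mean V (\<lambda>a. f a x) as \<partial>M) = sign_mean V (\<lambda>a. \<integral>x. f a x \<partial>M) as"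
  unfolding sign_mean_def using assms by (simp add: integral_sum_list)

text \<open>Markov's inequality bounds each set by B / c, and continuity from below carries the
  bound to the increasing union.\<close>

lemma emeasure_UN_incseq_le:
  fixes h :: "nat \<Rightarrow> 'x \<Rightarrow> real"
  assumes h: "\<And>n. integrable M (h n)" and nonneg: "\<And>n x. 0 \<le> h n x"
    and mono: "\<And>n x. h n x \<le> h (Suc n) x"
    and bound: "\<And>n. (\<integral>x. h n x \<partial>M) \<le> B" and "0 < c"
  shows "emeasure M (\<Union>n. {x \<in> space M. c \<le> h n x}) < \<infinity>"
proof -
  have [measurable]: "h n \<in> borel_measurable M" for n using h[of n] by simp
  have "incseq (\<lambda>n. {x \<in> space M. c \<le> h n x})"
  proof (intro incseq_SucI subsetI)
    fix n x assume "x \<in> {x \<in> space M. c \<le> h n x}"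
    then show "x \<in> {x \<in> space M. c \<le> h (Suc n) x}" using mono[of n x] by simp
  qed
  then have "emeasure M (\<Union>n. {x \<in> space M. c \<le> h n x}) = (SUP n. emeasure M {x \<in> space M. c \<le> h n x})"
    by (intro SUP_emeasure_incseq[symmetric]) auto
  also have "\<dots> \<le> ennreal (B / c)"
  proof (rule SUP_least)
    fix n
    have "emeasure M {x \<in> space M. c \<le> h n x} \<le> ennreal (1 / c * (\<integral>x. h n x \<partial>M))"
      using integral_Markov_inequality[OF h[of n], of c] nonneg \<open>0 < c\<close> by simp
    also have "\<dots> \<le> ennreal (B / c)"
      using bound[of n] \<open>0 < c\<close> by (intro ennreal_leI) (simp add: divide_right_mono)
    finally show "emeasure M {x \<in> space M. c \<le> h n x} \<le> ennreal (B / c)" .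
  qed
  finally show ?thesis using le_less_trans[OF _ ennreal_less_top] by simp
qed

section \<open>Almost maximal lists\<close>

text \<open>The supremum is taken over extensions of \<open>us\<close> only, and a value within
  \<eta> of it is chosen; one more vector gives another extension, hence gains at most \<eta>. The
  value at \<open>us\<close> is not lowered, so the inequality against \<Psi> [] survives
  iteration.\<close>

lemma almost_maximal_extension:
  fixes \<Psi> :: "'v list \<Rightarrow> real"
  assumes bound: "\<And>us. set us \<subseteq> U \<Longrightarrow> \<Psi> us \<le> B" and us: "set us \<subseteq> U" and "0 < \<eta>"
  obtains ys where "set ys \<subseteq> U" "\<Psi> us \<le> \<Psi> (us @ ys)"
    "\<And>v. v \<in> U \<Longrightarrow> \<Psi> (us @ ys @ [v]) \<le> \<Psi> (us @ ys) + \<eta>"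
proof -
  define E where "E = {\<Psi> (us @ ys) |ys. set ys \<subseteq> U}"
  have bdd: "bdd_above E"
    using bound us by (intro bdd_aboveI[of _ B]) (auto simp: E_def)
  have "\<Psi> us \<in> E" unfolding E_def by (intro CollectI exI[of _ "[]"]) simp
  then have "E \<noteq> {}" by blast
  \<comment> \<open>If \<open>us\<close> is itself almost maximal it is kept; otherwise every almost
    maximal value exceeds the one at \<open>us\<close>.\<close>
  have "\<exists>y\<in>E. Sup E - \<eta> < y \<and> \<Psi> us \<le> y"
  proof (cases "Sup E - \<eta> < \<Psi> us")
    case True
    then show ?thesis using \<open>\<Psi> us \<in> E\<close> by blast
  next
    case False
    obtain y where "y \<in> E" "Sup E - \<eta> < y"
      using less_cSupD[OF \<open>E \<noteq> {}\<close>, of "Sup E - \<eta>"] \<open>0 < \<eta>\<close> by auto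
    then show ?thesis using False by (intro bexI[of _ y]) auto
  qed
  then obtain ys where ys: "set ys \<subseteq> U" "Sup E - \<eta> < \<Psi> (us @ ys)" "\<Psi> us \<le> \<Psi> (us @ ys)"
    by (auto simp: E_def)
  have "\<Psi> (us @ ys @ [v]) \<le> \<Psi> (us @ ys) + \<eta>" if "v \<in> U" for v
  proof -
    have "\<Psi> (us @ ys @ [v]) \<in> E"
      unfolding E_def using ys(1) that by (intro CollectI exI[of _ "ys @ [v]"]) auto
    then have "\<Psi> (us @ ys @ [v]) \<le> Sup E" using bdd by (rule cSup_upper)
    then show ?thesis using ys(2) by linarith
  qed
  then show ?thesis using that ys by blast
qed

text \<open>The supremum need not be attained, so the slack is sent to 0 along a sequence. Each list
  prolongs its predecessor, which makes the square functions increase pointwise.\<close>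

lemma almost_maximal_sequence:
  fixes \<Psi> :: "'v list \<Rightarrow> real"
  assumes bound: "\<And>us. set us \<subseteq> U \<Longrightarrow> \<Psi> us \<le> B"
  obtains us where "\<And>n. set (us n) \<subseteq> U" "\<And>n. \<Psi> [] \<le> \<Psi> (us n)" "\<And>n. \<exists>ys. us (Suc n) = us n @ ys"
    "\<And>n v. v \<in> U \<Longrightarrow> \<Psi> (us n @ [v]) \<le> \<Psi> (us n) + 1 / Suc n"
proof -
  define P where "P n us \<longleftrightarrow> set us \<subseteq> U \<and> \<Psi> [] \<le> \<Psi> us \<and>
     (\<forall>v\<in>U. \<Psi> (us @ [v]) \<le> \<Psi> us + 1 / Suc n)" for n us
  have "\<exists>f. \<forall>n. P n (f n) \<and> (\<exists>ys. f (Suc n) = f n @ ys)"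
  proof (rule dependent_nat_choice)
    obtain ys where "set ys \<subseteq> U" "\<Psi> [] \<le> \<Psi> ([] @ ys)"
      "\<And>v. v \<in> U \<Longrightarrow> \<Psi> ([] @ ys @ [v]) \<le> \<Psi> ([] @ ys) + 1 / Suc 0"
      by (rule almost_maximal_extension[of U \<Psi> B "[]" "1 / Suc 0"]) (use bound in auto)
    then show "\<exists>us. P 0 us" by (auto simp: P_def)
  next
    fix us n assume "P n us"
    obtain ys where "set ys \<subseteq> U" "\<Psi> us \<le> \<Psi> (us @ ys)"
      "\<And>v. v \<in> U \<Longrightarrow> \<Psi> (us @ ys @ [v]) \<le> \<Psi> (us @ ys) + 1 / Suc (Suc n)"
      by (rule almost_maximal_extension[of U \<Psi> B us "1 / Suc (Suc n)"])
        (use bound \<open>P n us\<close> in \<open>auto simp: P_def\<close>)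
    with \<open>P n us\<close> show "\<exists>us'. P (Suc n) us' \<and> (\<exists>ys. us' = us @ ys)"
      unfolding P_def by (intro exI[of _ "us @ ys"]) auto
  qed
  then obtain f where "\<And>n. P n (f n)" "\<And>n. \<exists>ys. f (Suc n) = f n @ ys" by auto
  then show ?thesis using that[of f] unfolding P_def by blast
qed

section \<open>Factorization through sets of finite measure\<close>

text \<open>
  An element \<open>a\<close> of \<open>V\<close> stands for a class of square integrable vector fields, and
  \<open>pn a x\<close> for the norm of its value at \<open>x\<close>.
\<close>

locale field_norms =
  fixes M :: "'x measure" and V :: "(complex, 'v, 'm) module_scheme" and pn :: "'v \<Rightarrow> 'x \<Rightarrow> real"
  assumes zero_in: "\<zero>\<^bsub>V\<^esub> \<in> carrier V"
    and add_in: "\<lbrakk>a \<in> carrier V; b \<in> carrier V\<rbrakk> \<Longrightarrow> a \<oplus>\<^bsub>V\<^esub> b \<in> carrier V"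
    and smult_in: "a \<in> carrier V \<Longrightarrow> c \<odot>\<^bsub>V\<^esub> a \<in> carrier V"
    and pn_sq_integrable: "a \<in> carrier V \<Longrightarrow> integrable M (\<lambda>x. (pn a x)\<^sup>2)"
    and pn_smult: "a \<in> carrier V \<Longrightarrow> AE x in M. (pn (c \<odot>\<^bsub>V\<^esub> a) x)\<^sup>2 = (cmod c)\<^sup>2 * (pn a x)\<^sup>2"
    and pn_sign_mean: "set as \<subseteq> carrier V \<Longrightarrow>
      AE x in M. sign_mean V (\<lambda>a. (pn a x)\<^sup>2) as = (\<Sum>a\<leftarrow>as. (pn a x)\<^sup>2)"
    and pn_lower: "\<lbrakk>set as \<subseteq> carrier V; 0 < \<theta>; \<theta> \<le> 1\<rbrakk> \<Longrightarrow>
      AE x in M. (\<Sum>a\<leftarrow>as. (pn a x)\<^sup>2) powr \<theta> \<le> 3 * sign_mean V (\<lambda>a. (pn a x)\<^sup>2 powr \<theta>) as"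
    and pn_upper: "\<lbrakk>set as \<subseteq> carrier V; 1 \<le> \<theta>; \<theta> \<le> 2\<rbrakk> \<Longrightarrow>
      AE x in M. sign_mean V (\<lambda>a. (pn a x)\<^sup>2 powr \<theta>) as \<le> 4 * (\<Sum>a\<leftarrow>as. (pn a x)\<^sup>2) powr \<theta>"
begin

definition energy :: "'v \<Rightarrow> real" where
  "energy a = (\<integral>x. (pn a x)\<^sup>2 \<partial>M)"

lemma energy_nonneg: "0 \<le> energy a"
  by (simp add: energy_def)

lemma pn_sq_measurable [measurable]: "a \<in> carrier V \<Longrightarrow> (\<lambda>x. (pn a x)\<^sup>2) \<in> borel_measurable M"
  using pn_sq_integrable by (rule borel_measurable_integrable)

lemma energy_smult:
  assumes a: "a \<in> carrier V"
  shows "energy (c \<odot>\<^bsub>V\<^esub> a) = (cmod c)\<^sup>2 * energy a"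
proof -
  have "energy (c \<odot>\<^bsub>V\<^esub> a) = (\<integral>x. (cmod c)\<^sup>2 * (pn a x)\<^sup>2 \<partial>M)"
    unfolding energy_def
    by (intro integral_cong_AE pn_smult[OF a] borel_measurable_times borel_measurable_const
        pn_sq_measurable a smult_in)
  then show ?thesis by (simp add: energy_def)
qed

lemma signed_sums_in: "set as \<subseteq> carrier V \<Longrightarrow> set (signed_sums V as) \<subseteq> carrier V"
  by (intro signed_sums_closed zero_in add_in smult_in)

text \<open>The pointwise second moment identity, integrated over \<open>M\<close>.\<close>

lemma sign_mean_energy:
  assumes as: "set as \<subseteq> carrier V"
  shows "sign_mean V energy as = (\<Sum>a\<leftarrow>as. energy a)"
proof -
  have int: "integrable M (\<lambda>x. (pn a x)\<^sup>2)" if "a \<in> set (signed_sums V as)" for a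
    using that signed_sums_in[OF as] pn_sq_integrable by auto
  have int': "integrable M (\<lambda>x. (pn a x)\<^sup>2)" if "a \<in> set as" for a
    using that as pn_sq_integrable by auto
  have "sign_mean V energy as = (\<integral>x. sign_mean V (\<lambda>a. (pn a x)\<^sup>2) as \<partial>M)"
    unfolding energy_def by (rule integral_sign_mean[symmetric]) (rule int)
  also have "\<dots> = (\<integral>x. (\<Sum>a\<leftarrow>as. (pn a x)\<^sup>2) \<partial>M)"
    using integrable_sign_mean[of V as M "\<lambda>a x. (pn a x)\<^sup>2", OF int]
      integrable_sum_list[of as M "\<lambda>a x. (pn a x)\<^sup>2", OF int']
    by (intro integral_cong_AE pn_sign_mean[OF as] borel_measurable_integrable)
  also have "\<dots> = (\<Sum>a\<leftarrow>as. energy a)"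
    unfolding energy_def by (rule integral_sum_list) (rule int')
  finally show ?thesis .
qed

end

text \<open>Linearity only; the estimates on \<open>T\<close> are hypotheses of the two
  concentration theorems. The value at zero is listed because no group laws are assumed of the
  records.\<close>

locale field_operator = V: field_norms M V pn + W: field_norms M W qn
  for M :: "'x measure" and V :: "(complex, 'v, 'm) module_scheme" and pn
    and W :: "(complex, 'w, 'n) module_scheme" and qn +
  fixes T :: "'v \<Rightarrow> 'w"
  assumes T_in: "a \<in> carrier V \<Longrightarrow> T a \<in> carrier W"
    and T_zero: "T \<zero>\<^bsub>V\<^esub> = \<zero>\<^bsub>W\<^esub>"
    and T_add: "\<lbrakk>a \<in> carrier V; b \<in> carrier V\<rbrakk> \<Longrightarrow> T (a \<oplus>\<^bsub>V\<^esub> b) = T a \<oplus>\<^bsub>W\<^esub> T b"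
    and T_smult: "a \<in> carrier V \<Longrightarrow> T (c \<odot>\<^bsub>V\<^esub> a) = c \<odot>\<^bsub>W\<^esub> T a"
begin

text \<open>By linearity, averages in the codomain become averages over the domain, where bounds on
  single vectors can be applied.\<close>

lemma signed_sums_map:
  assumes "set as \<subseteq> carrier V"
  shows "signed_sums W (map T as) = map T (signed_sums V as)"
  using assms
proof (induction as)
  case (Cons a as)
  then have "set (signed_sums V as) \<subseteq> carrier V" "a \<in> carrier V"
    by (auto dest: V.signed_sums_in)
  then show ?case
    using Cons by (auto simp: T_add T_smult V.smult_in subset_iff)
qed (simp add: T_zero)

lemma sign_mean_map:
  "set as \<subseteq> carrier V \<Longrightarrow> sign_mean W f (map T as) = sign_mean V (\<lambda>a. f (T a)) as"
  by (simp add: sign_mean_def signed_sums_map o_def)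

lemma T_list_in: "set as \<subseteq> carrier V \<Longrightarrow> set (map T as) \<subseteq> carrier W"
  using T_in by auto

text \<open>
  A maximization version of Maurey's factorization theorem: the sets \<open>{h\<^sub>n \<ge> \<delta>}\<close> for an
  almost maximizing sequence of square functions \<open>h\<^sub>n\<close> carry almost all of the range of the operator.
\<close>

theorem range_concentration:
  assumes \<theta>: "0 < \<theta>" "\<theta> < 1" and "0 \<le> C" "0 \<le> m"
    and int: "\<And>a. a \<in> carrier V \<Longrightarrow> integrable M (\<lambda>x. (qn (T a) x)\<^sup>2 powr \<theta>)"
    and bound: "\<And>a. a \<in> carrier V \<Longrightarrow> (\<integral>x. (qn (T a) x)\<^sup>2 powr \<theta> \<partial>M) \<le> C * (m + V.energy a)"
    and "0 < \<epsilon>"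
  obtains G where "G \<in> sets M" "emeasure M G < \<infinity>"
    "\<And>a. a \<in> carrier V \<Longrightarrow> (\<integral>x. indicator (space M - G) x * (qn (T a) x)\<^sup>2 \<partial>M) \<le> \<epsilon> * V.energy a"
proof -
  define h where "h as x = (\<Sum>a\<leftarrow>as. (qn (T a) x)\<^sup>2)" for as x
  define J where "J as = (\<integral>x. h as x powr \<theta> \<partial>M)" for as
  define E where "E as = (\<Sum>a\<leftarrow>as. V.energy a)" for as
  \<comment> \<open>The part \<open>3 * C\<close> pays for Khintchine's inequality and the
    hypothesis; the extra 1 leaves \<open>- E as\<close> in the bound for \<Psi> and so controls the
    energy along the sequence.\<close>
  define L where "L = 3 * C + 1"
  have h_nonneg: "0 \<le> h as x" for as x
    unfolding h_def by (rule sum_list_nonneg) auto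
  have E_nonneg: "0 \<le> E as" for as
    unfolding E_def by (rule sum_list_nonneg) (auto simp: V.energy_nonneg)
  have h_meas [measurable]: "h as \<in> borel_measurable M" if "set as \<subseteq> carrier V" for as
    unfolding h_def using that T_in by (intro borel_measurable_sum_list W.pn_sq_measurable) auto
  have J: "integrable M (\<lambda>x. h as x powr \<theta>)" "J as \<le> 3 * C * (m + E as)"
    if as: "set as \<subseteq> carrier V" for as
  proof -
    \<comment> \<open>Khintchine's inequality is applied at each point and then integrated, so that
      the hypothesis is used for single vectors, the signed sums. Their mean energy is
      \<open>E as\<close>.\<close>
    let ?g = "\<lambda>x. sign_mean V (\<lambda>a. (qn (T a) x)\<^sup>2 powr \<theta>) as"
    have as': "a \<in> carrier V" if "a \<in> set (signed_sums V as)" for a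
      using that V.signed_sums_in[OF as] by auto
    have g: "integrable M (\<lambda>x. 3 * ?g x)"
      by (intro integrable_mult_right integrable_sign_mean int as')
    have le: "AE x in M. h as x powr \<theta> \<le> 3 * ?g x"
      using W.pn_lower[OF T_list_in[OF as], of \<theta>] \<theta>
      by (simp add: sign_mean_map[OF as] h_def o_def)
    show h: "integrable M (\<lambda>x. h as x powr \<theta>)"
      by (rule Bochner_Integration.integrable_bound[OF g]) (use le h_meas[OF as] in auto)
    have "J as \<le> (\<integral>x. 3 * ?g x \<partial>M)"
      unfolding J_def by (rule integral_mono_AE[OF h g le])
    also have "\<dots> = 3 * sign_mean V (\<lambda>a. \<integral>x. (qn (T a) x)\<^sup>2 powr \<theta> \<partial>M) as"
      by (simp add: integral_sign_mean int as')
    also have "\<dots> \<le> 3 * sign_mean V (\<lambda>a. C * (m + V.energy a)) as"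
      using bound as' by (intro mult_left_mono sign_mean_mono) auto
    also have "\<dots> = 3 * C * (m + E as)"
      by (simp add: sign_mean_cmult sign_mean_add V.sign_mean_energy[OF as] E_def)
    finally show "J as \<le> 3 * C * (m + E as)" .
  qed
  define \<Psi> where "\<Psi> as = J as - L * E as" for as
  have \<Psi>: "\<Psi> as \<le> 3 * C * m - E as" if "set as \<subseteq> carrier V" for as
    using J(2)[OF that] by (simp add: \<Psi>_def L_def algebra_simps)
  then have "\<Psi> as \<le> 3 * C * m" if "set as \<subseteq> carrier V" for as
    using that E_nonneg[of as] by force
  then obtain us where us: "\<And>n. set (us n) \<subseteq> carrier V" and us0: "\<And>n. \<Psi> [] \<le> \<Psi> (us n)"
    and us_Suc: "\<And>n. \<exists>ys. us (Suc n) = us n @ ys"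
    and us_max: "\<And>n v. v \<in> carrier V \<Longrightarrow> \<Psi> (us n @ [v]) \<le> \<Psi> (us n) + 1 / Suc n"
    using almost_maximal_sequence[of "carrier V" \<Psi> "3 * C * m"] by blast
  \<comment> \<open>Since \<Psi> [] = 0, the lists satisfy E \<le> 3 C m; inserting this into the
    bound for \<open>J\<close> gives \<open>B\<close>.\<close>
  define B where "B = 3 * C * (m + 3 * C * m)"
  have J_us: "J (us n) \<le> B" for n
  proof -
    have "0 \<le> \<Psi> (us n)" using us0[of n] by (simp add: \<Psi>_def J_def E_def h_def)
    then have "E (us n) \<le> 3 * C * m" using \<Psi>[OF us, of n] by simp
    then have "3 * C * (m + E (us n)) \<le> B"
      using \<open>0 \<le> C\<close> unfolding B_def by (intro mult_left_mono) auto
    then show ?thesis using J(2)[OF us, of n] by simp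
  qed
  have h_mono: "h (us n) x \<le> h (us (Suc n)) x" for n x
  proof -
    obtain ys where "us (Suc n) = us n @ ys" using us_Suc by blast
    then have "h (us (Suc n)) x = h (us n) x + h ys x" by (simp add: h_def)
    then show ?thesis using h_nonneg[of ys x] by simp
  qed
  have "L > 0" using \<open>0 \<le> C\<close> by (simp add: L_def)
  \<comment> \<open>Chosen so that the slope at 2 \<delta>, called \<open>K\<close> below, satisfies
    L \<le> K \<epsilon>.\<close>
  obtain \<delta> where \<delta>: "0 < \<delta>" "(2 * \<delta>) powr (1 - \<theta>) \<le> \<epsilon> * \<theta> / L"
    using powr_small[of "1 - \<theta>" "\<epsilon> * \<theta> / L"] \<theta> \<open>0 < \<epsilon>\<close> \<open>L > 0\<close> by auto
  \<comment> \<open>The union of the sets where a square function reaches \<delta>, stated with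
    powers because it is the power whose integral is bounded.\<close>
  define G where "G = (\<Union>n. {x \<in> space M. \<delta> powr \<theta> \<le> h (us n) x powr \<theta>})"
  have G_off: "h (us n) x < \<delta>" if "x \<in> space M" "x \<notin> G" for n x
    using that powr_mono2[of \<theta> \<delta> "h (us n) x"] \<delta> \<theta> unfolding G_def by force
  have hm [measurable]: "h (us n) \<in> borel_measurable M" for n using h_meas us by blast
  have G_sets: "G \<in> sets M"
    unfolding G_def by measurable
  have G_fin: "emeasure M G < \<infinity>"
    unfolding G_def
  proof (rule emeasure_UN_incseq_le)
    show "integrable M (\<lambda>x. h (us n) x powr \<theta>)" for n by (rule J(1)[OF us])
    show "(\<integral>x. h (us n) x powr \<theta> \<partial>M) \<le> B" for n using J_us by (simp add: J_def)
    show "h (us n) x powr \<theta> \<le> h (us (Suc n)) x powr \<theta>" for n x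
      using \<theta> h_nonneg h_mono by (intro powr_mono2) auto
  qed (use \<delta> in auto)
  have "(\<integral>x. indicator (space M - G) x * (qn (T a) x)\<^sup>2 \<partial>M) \<le> \<epsilon> * V.energy a" if a: "a \<in> carrier V" for a
  proof -
    define f where "f x = (qn (T a) x)\<^sup>2" for x
    have f: "integrable M f" unfolding f_def by (rule W.pn_sq_integrable[OF T_in[OF a]])
    then have [measurable]: "f \<in> borel_measurable M" by simp
    note [measurable] = G_sets
    let ?I = "\<lambda>k. \<integral>x. indicator (space M - G) x * (if f x / Suc k \<le> \<delta> then f x else 0) \<partial>M"
    have "?I k \<le> \<epsilon> * V.energy a" for k
    proof -
      define t where "t = 1 / real (Suc k)"
      have t: "t > 0" by (simp add: t_def)
      define K where "K = \<theta> * (2 * \<delta>) powr (\<theta> - 1)"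
      have K: "K > 0" using \<theta> \<delta> by (simp add: K_def)
      \<comment> \<open>The square root makes the squared norm of \<open>T w\<close> equal to
        \<open>t * f\<close> almost everywhere, a first order perturbation of the square
        function.\<close>
      define w where "w = of_real (sqrt t) \<odot>\<^bsub>V\<^esub> a"
      have w: "w \<in> carrier V" unfolding w_def by (rule V.smult_in[OF a])
      have "(cmod (of_real (sqrt t)))\<^sup>2 = t" using t by simp
      then have Ew: "V.energy w = t * V.energy a"
        unfolding w_def V.energy_smult[OF a] by simp
      have "AE x in M. (qn (T w) x)\<^sup>2 = t * f x"
        using W.pn_smult[OF T_in[OF a], of "of_real (sqrt t)"] t
        unfolding w_def T_smult[OF a] f_def by simp
      then have AE: "AE x in M. indicator (space M - G) x * (if f x / Suc k \<le> \<delta> then f x else 0) * (K * t)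
          \<le> h (us n @ [w]) x powr \<theta> - h (us n) x powr \<theta>" for n
        using AE_space
      proof eventually_elim
        case (elim x)
        have hw: "h (us n @ [w]) x = h (us n) x + t * f x"
          using elim by (simp add: h_def)
        have tf: "0 \<le> t * f x" using t by (simp add: f_def)
        show ?case
        proof (cases "x \<notin> G \<and> f x / Suc k \<le> \<delta>")
          case True
          then have "h (us n) x < \<delta>" using G_off[of x] elim by blast
          moreover have "t * f x \<le> \<delta>" using True by (simp add: t_def)
          ultimately have "K * (t * f x) \<le> (h (us n) x + t * f x) powr \<theta> - h (us n) x powr \<theta>"
            unfolding K_def using h_nonneg tf \<theta> by (intro powr_diff_ge) auto
          then show ?thesis using True elim by (simp add: hw mult_ac)
        next
          case False
          \<comment> \<open>On \<open>G\<close>, or where the perturbation is large, it is enough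
            that the square function does not decrease.\<close>
          have "h (us n) x powr \<theta> \<le> h (us n @ [w]) x powr \<theta>"
            using hw tf h_nonneg \<theta> by (intro powr_mono2) auto
          then show ?thesis using False by (auto simp: indicator_def)
        qed
      qed
      \<comment> \<open>Almost maximality bounds the gain in \<open>J\<close> by the cost of
        \<open>w\<close> plus the slack. With \<open>t\<close> fixed, the slack is removed by
        letting \<open>n\<close> grow; only then is \<open>t\<close> divided out.\<close>
      have "?I k * (K * t) \<le> L * (t * V.energy a) + 1 / Suc n" for n
      proof -
        have uw: "set (us n @ [w]) \<subseteq> carrier V" using us w by auto
        have "?I k * (K * t) = (\<integral>x. indicator (space M - G) x * (if f x / Suc k \<le> \<delta> then f x else 0) * (K * t) \<partial>M)"
          by simp
        also have "\<dots> \<le> (\<integral>x. h (us n @ [w]) x powr \<theta> - h (us n) x powr \<theta> \<partial>M)"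
        proof (rule integral_mono_AE[OF _ _ AE])
          have "integrable M (\<lambda>x. indicator (space M - G) x * (if f x / Suc k \<le> \<delta> then f x else 0))"
            using G_sets by (intro integrable_truncation f) simp
          then show "integrable M (\<lambda>x. indicator (space M - G) x * (if f x / Suc k \<le> \<delta> then f x else 0) * (K * t))"
            by (rule integrable_mult_left)
          show "integrable M (\<lambda>x. h (us n @ [w]) x powr \<theta> - h (us n) x powr \<theta>)"
            using J(1)[OF uw] J(1)[OF us] by simp
        qed
        also have "\<dots> = J (us n @ [w]) - J (us n)"
          unfolding J_def using J(1)[OF uw] J(1)[OF us] by simp
        also have "\<dots> \<le> L * V.energy w + 1 / Suc n"
          using us_max[OF w, of n] by (simp add: \<Psi>_def E_def algebra_simps)
        finally show ?thesis unfolding Ew .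
      qed
      then have "?I k * (K * t) \<le> L * (t * V.energy a)"
        by (rule le_of_le_add_inverse)
      then have "?I k * K \<le> L * V.energy a"
        using t by (simp add: mult.assoc[symmetric] mult.commute[of _ t] mult_le_cancel_left_pos)
      \<comment> \<open>This is the choice of \<delta>: the powers with exponents 1 - \<theta> and
        \<theta> - 1 cancel.\<close>
      moreover have "L * V.energy a \<le> K * (\<epsilon> * V.energy a)"
      proof -
        have "L * (2 * \<delta>) powr (1 - \<theta>) \<le> \<epsilon> * \<theta>"
          using \<delta>(2) \<open>L > 0\<close> by (simp add: field_simps)
        then have "L * (2 * \<delta>) powr (1 - \<theta>) * (2 * \<delta>) powr (\<theta> - 1) \<le> \<epsilon> * \<theta> * (2 * \<delta>) powr (\<theta> - 1)"
          by (rule mult_right_mono) simp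
        moreover have "(2 * \<delta>) powr (1 - \<theta>) * (2 * \<delta>) powr (\<theta> - 1) = 1"
          using \<delta> by (simp add: powr_add[symmetric])
        ultimately have "L \<le> K * \<epsilon>" by (simp add: K_def mult_ac)
        then show ?thesis using V.energy_nonneg[of a] by (simp add: mult_right_mono mult.assoc[symmetric])
      qed
      ultimately have "K * ?I k \<le> K * (\<epsilon> * V.energy a)" by (simp add: mult.commute)
      then show ?thesis using K by (simp add: mult_le_cancel_left_pos)
    qed
    \<comment> \<open>Letting \<open>k\<close> tend to infinity, that is \<open>t\<close> to 0,
      removes the truncation.\<close>
    then show ?thesis
      unfolding f_def[symmetric]
      using integral_truncation_tendsto[OF f, of "space M - G" \<delta>] G_sets \<delta>(1)
      by (intro LIMSEQ_le_const2) auto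
  qed
  then show ?thesis using that G_sets G_fin by blast
qed

text \<open>The roles are exchanged: the square functions live on the domain and are the cost. Where
  they are all below \<delta> the cost has slope at most \<open>K\<close>, so a vector supported
  there is cheap to append, and almost maximality forces its image to be small.\<close>

theorem domain_concentration:
  assumes \<theta>: "1 < \<theta>" "\<theta> \<le> 2" and "0 \<le> C" "0 \<le> m"
    and bound: "\<And>a. a \<in> carrier V \<Longrightarrow>
      W.energy (T a) \<le> C * (m + (\<integral>x. min ((pn a x)\<^sup>2) ((pn a x)\<^sup>2 powr \<theta>) \<partial>M))"
    and "0 < \<epsilon>"
  obtains G where "G \<in> sets M" "emeasure M G < \<infinity>"
    "\<And>a. \<lbrakk>a \<in> carrier V; AE x in M. x \<in> G \<longrightarrow> pn a x = 0\<rbrakk> \<Longrightarrow> W.energy (T a) \<le> \<epsilon> * V.energy a"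
proof -
  \<comment> \<open>Linear growth at infinity keeps the cost integrable for every square integrable
    field, while the power near 0 makes its slope small there.\<close>
  define \<phi> where "\<phi> z = min z (z powr \<theta>)" for z :: real
  have \<phi>_nonneg: "0 \<le> \<phi> z" if "0 \<le> z" for z using that by (simp add: \<phi>_def)
  have \<phi>_le: "\<phi> z \<le> z" for z by (simp add: \<phi>_def)
  have \<phi>_mono: "\<phi> y \<le> \<phi> z" if "0 \<le> y" "y \<le> z" for y z
    using that \<theta> powr_mono2[of \<theta> y z] unfolding \<phi>_def by (intro min.mono) auto
  have \<phi>_meas [measurable]: "\<phi> \<in> borel_measurable borel" unfolding \<phi>_def by measurable
  define h where "h as x = (\<Sum>a\<leftarrow>as. (pn a x)\<^sup>2)" for as x
  define J where "J as = (\<integral>x. \<phi> (h as x) \<partial>M)" for as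
  define E where "E as = (\<Sum>a\<leftarrow>as. W.energy (T a))" for as
  \<comment> \<open>The 4 is Khintchine's constant; the extra 1 leaves \<open>- J as\<close> in the
    bound for \<Psi>.\<close>
  define L where "L = 4 * C + 1"
  have h_nonneg: "0 \<le> h as x" for as x
    unfolding h_def by (rule sum_list_nonneg) auto
  have h_int: "integrable M (h as)" if "set as \<subseteq> carrier V" for as
    unfolding h_def using that by (intro integrable_sum_list V.pn_sq_integrable) auto
  have \<phi>_int: "integrable M (\<lambda>x. \<phi> (g x))" if "integrable M g" "\<And>x. 0 \<le> g x" for g
  proof (rule Bochner_Integration.integrable_bound[OF that(1)])
    have [measurable]: "g \<in> borel_measurable M" using that by simp
    show "(\<lambda>x. \<phi> (g x)) \<in> borel_measurable M" by measurable
    show "AE x in M. norm (\<phi> (g x)) \<le> norm (g x)"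
      using that(2) \<phi>_nonneg \<phi>_le by (intro AE_I2) (simp add: abs_of_nonneg)
  qed
  have J_int: "integrable M (\<lambda>x. \<phi> (h as x))" if "set as \<subseteq> carrier V" for as
    using h_int[OF that] h_nonneg by (rule \<phi>_int)
  have E_le: "E as \<le> C * (m + 4 * J as)" if as: "set as \<subseteq> carrier V" for as
  proof -
    have as': "a \<in> carrier V" if "a \<in> set (signed_sums V as)" for a
      using that V.signed_sums_in[OF as] by auto
    have int: "integrable M (\<lambda>x. \<phi> ((pn a x)\<^sup>2))" if "a \<in> set (signed_sums V as)" for a
      using V.pn_sq_integrable[OF as'[OF that]] by (rule \<phi>_int) simp
    \<comment> \<open>Orthogonality of the signs in the codomain turns the sum of energies into one
      average, to which the hypothesis on single vectors applies.\<close>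
    have "E as = sign_mean V (\<lambda>a. W.energy (T a)) as"
      using W.sign_mean_energy[OF T_list_in[OF as]] by (simp add: sign_mean_map[OF as] E_def o_def)
    also have "\<dots> \<le> sign_mean V (\<lambda>a. C * (m + (\<integral>x. \<phi> ((pn a x)\<^sup>2) \<partial>M))) as"
      using bound as' by (intro sign_mean_mono) (simp add: \<phi>_def)
    also have "\<dots> = C * (m + (\<integral>x. sign_mean V (\<lambda>a. \<phi> ((pn a x)\<^sup>2)) as \<partial>M))"
      by (simp add: sign_mean_cmult sign_mean_add integral_sign_mean int)
    also have "(\<integral>x. sign_mean V (\<lambda>a. \<phi> ((pn a x)\<^sup>2)) as \<partial>M) \<le> (\<integral>x. 4 * \<phi> (h as x) \<partial>M)"
    proof (rule integral_mono_AE)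
      show "integrable M (\<lambda>x. sign_mean V (\<lambda>a. \<phi> ((pn a x)\<^sup>2)) as)"
        by (intro integrable_sign_mean int)
      show "integrable M (\<lambda>x. 4 * \<phi> (h as x))" using J_int[OF as] by simp
      have "AE x in M. sign_mean V (\<lambda>a. (pn a x)\<^sup>2 powr \<theta>) as \<le> 4 * h as x powr \<theta>"
        unfolding h_def using \<theta> by (intro V.pn_upper[OF as]) auto
      moreover have "AE x in M. sign_mean V (\<lambda>a. (pn a x)\<^sup>2) as = h as x"
        unfolding h_def by (rule V.pn_sign_mean[OF as])
      ultimately show "AE x in M. sign_mean V (\<lambda>a. \<phi> ((pn a x)\<^sup>2)) as \<le> 4 * \<phi> (h as x)"
      proof eventually_elim
        case (elim x)
        \<comment> \<open>The mean of a minimum is at most the minimum of the means, here the exact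
          second moment and Khintchine's upper bound.\<close>
        have "sign_mean V (\<lambda>a. \<phi> ((pn a x)\<^sup>2)) as \<le> sign_mean V (\<lambda>a. (pn a x)\<^sup>2) as"
          "sign_mean V (\<lambda>a. \<phi> ((pn a x)\<^sup>2)) as \<le> sign_mean V (\<lambda>a. (pn a x)\<^sup>2 powr \<theta>) as"
          by (auto intro!: sign_mean_mono simp: \<phi>_def)
        then show ?case using elim h_nonneg[of as x] by (auto simp: \<phi>_def min_def)
      qed
    qed
    also have "\<dots> = 4 * J as" by (simp add: J_def)
    finally show ?thesis using \<open>0 \<le> C\<close> by (simp add: mult_left_mono)
  qed
  define \<Psi> where "\<Psi> as = E as - L * J as" for as
  have J_nonneg: "0 \<le> J as" for as
    unfolding J_def by (intro Bochner_Integration.integral_nonneg \<phi>_nonneg h_nonneg)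
  have \<Psi>: "\<Psi> as \<le> C * m - J as" if "set as \<subseteq> carrier V" for as
    using E_le[OF that] by (simp add: \<Psi>_def L_def algebra_simps)
  then have "\<Psi> as \<le> C * m" if "set as \<subseteq> carrier V" for as
    using that J_nonneg[of as] by force
  then obtain us where us: "\<And>n. set (us n) \<subseteq> carrier V" and us0: "\<And>n. \<Psi> [] \<le> \<Psi> (us n)"
    and us_Suc: "\<And>n. \<exists>ys. us (Suc n) = us n @ ys"
    and us_max: "\<And>n v. v \<in> carrier V \<Longrightarrow> \<Psi> (us n @ [v]) \<le> \<Psi> (us n) + 1 / Suc n"
    using almost_maximal_sequence[of "carrier V" \<Psi> "C * m"] by blast
  have J_us: "J (us n) \<le> C * m" for n
  proof -
    have "0 \<le> \<Psi> (us n)" using us0[of n] by (simp add: \<Psi>_def J_def E_def h_def \<phi>_def)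
    then show ?thesis using \<Psi>[OF us, of n] by simp
  qed
  have h_mono: "h (us n) x \<le> h (us (Suc n)) x" for n x
  proof -
    obtain ys where "us (Suc n) = us n @ ys" using us_Suc by blast
    then have "h (us (Suc n)) x = h (us n) x + h ys x" by (simp add: h_def)
    then show ?thesis using h_nonneg[of ys x] by simp
  qed
  have "L > 0" using \<open>0 \<le> C\<close> by (simp add: L_def)
  \<comment> \<open>The last condition is L K \<le> \<epsilon> for the slope \<open>K\<close> at 2
    \<delta>; the second keeps 2 \<delta> in the range where \<phi> is the power.\<close>
  obtain \<delta> where \<delta>: "0 < \<delta>" "2 * \<delta> \<le> 1" "(2 * \<delta>) powr (\<theta> - 1) \<le> \<epsilon> / (L * \<theta>)"
    using powr_small[of "\<theta> - 1" "\<epsilon> / (L * \<theta>)"] \<theta> \<open>0 < \<epsilon>\<close> \<open>L > 0\<close> by auto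
  define G where "G = (\<Union>n. {x \<in> space M. \<phi> \<delta> \<le> \<phi> (h (us n) x)})"
  have G_off: "h (us n) x < \<delta>" if "x \<in> space M" "x \<notin> G" for n x
    using that \<phi>_mono[of \<delta> "h (us n) x"] \<delta> unfolding G_def by force
  have hm [measurable]: "h (us n) \<in> borel_measurable M" for n using h_int[OF us] by simp
  have G_sets: "G \<in> sets M"
    unfolding G_def by measurable
  have G_fin: "emeasure M G < \<infinity>"
    unfolding G_def
  proof (rule emeasure_UN_incseq_le)
    show "integrable M (\<lambda>x. \<phi> (h (us n) x))" for n by (rule J_int[OF us])
    show "(\<integral>x. \<phi> (h (us n) x) \<partial>M) \<le> C * m" for n using J_us by (simp add: J_def)
    show "\<phi> (h (us n) x) \<le> \<phi> (h (us (Suc n)) x)" for n x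
      using h_nonneg h_mono by (intro \<phi>_mono) auto
    show "0 < \<phi> \<delta>" using \<delta> by (simp add: \<phi>_def)
  qed (use h_nonneg \<phi>_nonneg in auto)
  have "W.energy (T a) \<le> \<epsilon> * V.energy a"
    if a: "a \<in> carrier V" and off: "AE x in M. x \<in> G \<longrightarrow> pn a x = 0" for a
  proof -
    define f where "f x = (pn a x)\<^sup>2" for x
    have f: "integrable M f" unfolding f_def by (rule V.pn_sq_integrable[OF a])
    then have [measurable]: "f \<in> borel_measurable M" by simp
    have f_nonneg: "0 \<le> f x" for x by (simp add: f_def)
    have Ef: "V.energy a = (\<integral>x. f x \<partial>M)" by (simp add: V.energy_def f_def)
    define K where "K = \<theta> * (2 * \<delta>) powr (\<theta> - 1)"
    have K: "K \<ge> 0" using \<theta> by (simp add: K_def)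
    let ?I = "\<lambda>k. \<integral>x. indicator (space M) x * (if f x / Suc k \<le> \<delta> then f x else 0) \<partial>M"
    \<comment> \<open>The first term is the slope bound. The second collects the points where the
      perturbation exceeds \<delta>, estimated crudely, and tends to 0 with
      \<open>t\<close>.\<close>
    have "W.energy (T a) \<le> L * (K * V.energy a + 2 * (V.energy a - ?I k))" for k
    proof -
      define t where "t = 1 / real (Suc k)"
      have t: "t > 0" by (simp add: t_def)
      define w where "w = of_real (sqrt t) \<odot>\<^bsub>V\<^esub> a"
      have w: "w \<in> carrier V" unfolding w_def by (rule V.smult_in[OF a])
      have "(cmod (of_real (sqrt t)))\<^sup>2 = t" using t by simp
      then have Ew: "W.energy (T w) = t * W.energy (T a)"
        unfolding w_def T_smult[OF a] W.energy_smult[OF T_in[OF a]] by simp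
      have "AE x in M. (pn w x)\<^sup>2 = t * f x"
        using V.pn_smult[OF a, of "of_real (sqrt t)"] t unfolding w_def f_def by simp
      then have AE: "AE x in M. \<phi> (h (us n @ [w]) x) - \<phi> (h (us n) x) \<le>
          t * (K * f x + 2 * (f x - indicator (space M) x * (if f x / Suc k \<le> \<delta> then f x else 0)))" for n
        using AE_space off
      proof eventually_elim
        case (elim x)
        have hw: "h (us n @ [w]) x = h (us n) x + t * f x"
          using elim by (simp add: h_def)
        have tf: "0 \<le> t * f x" using t f_nonneg by simp
        show ?case
        proof (cases "x \<in> G")
          case True
          \<comment> \<open>On \<open>G\<close> there is no bound for the square functions; there
            the field vanishes and changes nothing.\<close>
          then have "f x = 0" using elim by (simp add: f_def)
          then show ?thesis by (simp add: hw)
        next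
          case False
          have "\<phi> (h (us n) x + t * f x) - \<phi> (h (us n) x) \<le>
              K * (t * f x) + (if \<delta> < t * f x then 2 * (t * f x) else 0)"
            unfolding \<phi>_def K_def using G_off[OF _ False] elim h_nonneg tf \<delta> \<theta>
            by (intro min_powr_diff_le) auto
          also have "\<dots> = t * (K * f x + 2 * (f x - indicator (space M) x * (if f x / Suc k \<le> \<delta> then f x else 0)))"
            using elim by (simp add: t_def algebra_simps)
          finally show ?thesis by (simp add: hw)
        qed
      qed
      have cut: "integrable M (\<lambda>x. indicator (space M) x * (if f x / Suc k \<le> \<delta> then f x else 0))"
        by (intro integrable_truncation f) simp
      have "t * W.energy (T a) \<le> t * (L * (K * V.energy a + 2 * (V.energy a - ?I k))) + 1 / Suc n" for n
      proof -
        have uw: "set (us n @ [w]) \<subseteq> carrier V" using us w by auto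
        have "t * W.energy (T a) \<le> L * (J (us n @ [w]) - J (us n)) + 1 / Suc n"
          using us_max[OF w, of n] Ew by (simp add: \<Psi>_def E_def algebra_simps)
        also have "J (us n @ [w]) - J (us n) = (\<integral>x. \<phi> (h (us n @ [w]) x) - \<phi> (h (us n) x) \<partial>M)"
          unfolding J_def using J_int[OF uw] J_int[OF us] by simp
        also have "\<dots> \<le> (\<integral>x. t * (K * f x + 2 * (f x - indicator (space M) x *
            (if f x / Suc k \<le> \<delta> then f x else 0))) \<partial>M)"
          using J_int[OF uw] J_int[OF us] f cut by (intro integral_mono_AE[OF _ _ AE]) auto
        also have "\<dots> = t * (K * V.energy a + 2 * (V.energy a - ?I k))"
          unfolding Ef using f cut by simp
        finally show ?thesis using \<open>L > 0\<close> by (simp add: mult_left_mono mult.left_commute)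
      qed
      then have "t * W.energy (T a) \<le> t * (L * (K * V.energy a + 2 * (V.energy a - ?I k)))"
        by (rule le_of_le_add_inverse)
      then show ?thesis using t by (simp add: mult_le_cancel_left_pos)
    qed
    moreover have "?I \<longlonglongrightarrow> V.energy a"
    proof -
      have "(\<integral>x. indicator (space M) x * f x \<partial>M) = V.energy a"
        unfolding V.energy_def f_def[symmetric] by (intro Bochner_Integration.integral_cong) auto
      then show ?thesis using integral_truncation_tendsto[OF f, of "space M" \<delta>] \<delta>(1) by simp
    qed
    \<comment> \<open>In the limit the truncated integral exhausts the energy, and only the slope
      term remains.\<close>
    then have "(\<lambda>k. L * (K * V.energy a + 2 * (V.energy a - ?I k))) \<longlonglongrightarrow>
        L * (K * V.energy a + 2 * (V.energy a - V.energy a))"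
      by (intro tendsto_intros)
    ultimately have "W.energy (T a) \<le> L * (K * V.energy a + 2 * (V.energy a - V.energy a))"
      by (intro LIMSEQ_le_const) auto
    also have "\<dots> = (L * K) * V.energy a" by simp
    also have "\<dots> \<le> \<epsilon> * V.energy a"
    proof (rule mult_right_mono[OF _ V.energy_nonneg])
      show "L * K \<le> \<epsilon>" using \<delta>(3) \<open>L > 0\<close> \<theta> by (simp add: K_def field_simps)
    qed
    finally show ?thesis .
  qed
  then show ?thesis using that G_sets G_fin by blast
qed

end

section \<open>Classes of measurable vector fields\<close>

text \<open>The same choice as in the norm of \<open>Lp_fields\<close>, so that norms of classes
  unfold to norms of \<open>rep\<close>.\<close>

definition rep :: "('x \<Rightarrow> 'a) set \<Rightarrow> 'x \<Rightarrow> 'a" where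
  "rep A = (SOME u. u \<in> A)"

definition field_norm :: "('x \<Rightarrow> 'a chilbert) \<Rightarrow> ('x \<Rightarrow> 'a) set \<Rightarrow> 'x \<Rightarrow> real" where
  "field_norm H A x = vnorm (H x) (rep A x)"

context hilbert_space
begin

lemma add_neg: "a \<in> carrier H \<Longrightarrow> a \<oplus> (-1) \<odot> a = \<zero>"
  using smult_l_distr[of 1 "-1" a] smult_one[of a] smult_l_null[of a] by simp

lemma eq_neg_if_add_eq_zero:
  assumes "a \<in> carrier H" "b \<in> carrier H" "a \<oplus> b = \<zero>"
  shows "b = (-1) \<odot> a"
proof -
  have "a \<oplus> b = a \<oplus> (-1) \<odot> a" using assms by (simp add: add_neg)
  then show ?thesis using assms by (subst (asm) add.l_cancel) simp_all
qed

lemma smult_distrib: "\<lbrakk>a \<in> carrier H; b \<in> carrier H\<rbrakk> \<Longrightarrow> c \<odot> (a \<oplus> b) = c \<odot> a \<oplus> c \<odot> b"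
  by (rule smult_r_distr) auto

lemma add_smult: "a \<in> carrier H \<Longrightarrow> (c + d) \<odot> a = c \<odot> a \<oplus> d \<odot> a"
  using smult_l_distr[of c d a] by simp

lemma smult_smult: "a \<in> carrier H \<Longrightarrow> c \<odot> (d \<odot> a) = (c * d) \<odot> a"
  using smult_assoc1[of c d a] by simp

lemma one_smult: "a \<in> carrier H \<Longrightarrow> 1 \<odot> a = a"
  using smult_one[of a] by simp

end

context measurable_family
begin

section \<open>Measurable fields as a module over the measurable functions\<close>

lemma field_in: "\<lbrakk>u \<in> \<Gamma>; x \<in> space M\<rbrakk> \<Longrightarrow> u x \<in> carrier (H x)"
  using subgroup.subset[OF submodule.axioms(1)[OF fields_subspace]]
  by (auto simp: vector_fields_def PiE_iff)

lemma vector_fields_apply: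
  assumes "x \<in> space M"
  shows "(u \<oplus>\<^bsub>vector_fields M H\<^esub> v) x = u x \<oplus>\<^bsub>H x\<^esub> v x"
    "(c \<odot>\<^bsub>vector_fields M H\<^esub> u) x = c \<odot>\<^bsub>H x\<^esub> u x"
    "\<zero>\<^bsub>vector_fields M H\<^esub> x = \<zero>\<^bsub>H x\<^esub>"
  using assms by (simp_all add: vector_fields_def)

lemma fields_add: "\<lbrakk>u \<in> \<Gamma>; v \<in> \<Gamma>\<rbrakk> \<Longrightarrow> u \<oplus>\<^bsub>vector_fields M H\<^esub> v \<in> \<Gamma>"
  using subgroup.m_closed[OF submodule.axioms(1)[OF fields_subspace]] by simp

lemma fields_zero: "\<zero>\<^bsub>vector_fields M H\<^esub> \<in> \<Gamma>"
  using subgroup.one_closed[OF submodule.axioms(1)[OF fields_subspace]] by simp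

lemma fields_smult: "u \<in> \<Gamma> \<Longrightarrow> c \<odot>\<^bsub>vector_fields M H\<^esub> u \<in> \<Gamma>"
  using submodule.smult_closed[OF fields_subspace] by simp

text \<open>Polarization: the real part is a combination of the norms of u, v and u + v.\<close>

lemma Re_ip_measurable:
  assumes u: "u \<in> \<Gamma>" and v: "v \<in> \<Gamma>"
  shows "(\<lambda>x. Re (ip (H x) (u x) (v x))) \<in> borel_measurable M"
proof -
  note [measurable] = vnorm_measurable[OF u] vnorm_measurable[OF v] vnorm_measurable[OF fields_add[OF u v]]
  have "(\<lambda>x. ((vnorm (H x) ((u \<oplus>\<^bsub>vector_fields M H\<^esub> v) x))\<^sup>2 - (vnorm (H x) (u x))\<^sup>2
      - (vnorm (H x) (v x))\<^sup>2) / 2) \<in> borel_measurable M"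
    by measurable
  then show ?thesis
    by (rule subst[OF measurable_cong, rotated -1])
      (simp add: vector_fields_apply hilbert_space.vnorm_add_sq[OF fibre] field_in u v)
qed

text \<open>The imaginary part is the real part of the inner product with \<open>\<i>\<close> times
  \<open>v\<close>, since the second argument is conjugate linear.\<close>

lemma ip_measurable:
  assumes u: "u \<in> \<Gamma>" and v: "v \<in> \<Gamma>"
  shows "(\<lambda>x. ip (H x) (u x) (v x)) \<in> borel_measurable M"
proof -
  have "(\<lambda>x. Re (ip (H x) (u x) ((\<i> \<odot>\<^bsub>vector_fields M H\<^esub> v) x))) \<in> borel_measurable M"
    by (intro Re_ip_measurable u fields_smult v)
  then have "(\<lambda>x. Im (ip (H x) (u x) (v x))) \<in> borel_measurable M"
    by (rule subst[OF measurable_cong, rotated -1])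
      (simp add: vector_fields_apply hilbert_space.ip_smult_right[OF fibre] field_in u v)
  then show ?thesis
    using Re_ip_measurable[OF u v] borel_measurable_complex_iff by blast
qed

definition fmult :: "('x \<Rightarrow> complex) \<Rightarrow> ('x \<Rightarrow> 'a) \<Rightarrow> 'x \<Rightarrow> 'a" where
  "fmult \<phi> u = (\<lambda>x\<in>space M. \<phi> x \<odot>\<^bsub>H x\<^esub> u x)"

text \<open>Saturation of \<Gamma> reduces this to inner products with measurable fields, which are
  only multiplied by the measurable function cnj \<phi>.\<close>

lemma fmult_in:
  assumes [measurable]: "\<phi> \<in> borel_measurable M" and u: "u \<in> \<Gamma>"
  shows "fmult \<phi> u \<in> \<Gamma>"
proof (rule fields_saturated)
  show "fmult \<phi> u \<in> carrier (vector_fields M H)"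
    using u by (auto simp: fmult_def vector_fields_def field_in hilbert_space.smult_complex_closed[OF fibre])
  fix v assume v: "v \<in> \<Gamma>"
  note [measurable] = ip_measurable[OF v u]
  have [measurable]: "cnj \<in> borel_measurable borel"
    by (intro borel_measurable_continuous_onI continuous_intros)
  have "(\<lambda>x. cnj (\<phi> x) * ip (H x) (v x) (u x)) \<in> borel_measurable M"
    by measurable
  then show "(\<lambda>x. ip (H x) (v x) (fmult \<phi> u x)) \<in> borel_measurable M"
    by (rule subst[OF measurable_cong, rotated -1])
      (simp add: fmult_def hilbert_space.ip_smult_right[OF fibre] field_in u v)
qed

section \<open>Classes modulo null sets and their representatives\<close>

lemma mem_class_iff: "w \<in> field_class M \<Gamma> u \<longleftrightarrow> w \<in> \<Gamma> \<and> (AE x in M. w x = u x)"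
  by (simp add: field_class_def)

lemma class_eq:
  assumes "AE x in M. u x = v x"
  shows "field_class M \<Gamma> u = field_class M \<Gamma> v"
proof -
  have "(AE x in M. w x = u x) \<longleftrightarrow> (AE x in M. w x = v x)" for w
    by (rule eventually_subst) (use assms in eventually_elim, simp)
  then show ?thesis by (simp add: field_class_def)
qed

lemma rep_class:
  assumes "u \<in> \<Gamma>"
  shows "rep (field_class M \<Gamma> u) \<in> \<Gamma>" "AE x in M. rep (field_class M \<Gamma> u) x = u x"
proof -
  have "u \<in> field_class M \<Gamma> u" using assms by (simp add: mem_class_iff)
  then have "rep (field_class M \<Gamma> u) \<in> field_class M \<Gamma> u"
    unfolding rep_def by (rule someI[where P = "\<lambda>w. w \<in> field_class M \<Gamma> u"])
  then show "rep (field_class M \<Gamma> u) \<in> \<Gamma>" "AE x in M. rep (field_class M \<Gamma> u) x = u x"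
    by (auto simp: mem_class_iff)
qed

lemma class_in_Lp:
  "\<lbrakk>u \<in> \<Gamma>; integrable M (\<lambda>x. vnorm (H x) (u x) powr p)\<rbrakk> \<Longrightarrow>
    field_class M \<Gamma> u \<in> carrier (Lp_fields M H \<Gamma> p)"
  by (auto simp: Lp_fields_def)

lemma vnorm_rep_measurable:
  "rep A \<in> \<Gamma> \<Longrightarrow> field_norm H A \<in> borel_measurable M"
  unfolding field_norm_def by (rule vnorm_measurable)

lemma field_norm_nonneg:
  "\<lbrakk>rep A \<in> \<Gamma>; x \<in> space M\<rbrakk> \<Longrightarrow> 0 \<le> field_norm H A x"
  by (simp add: field_norm_def hilbert_space.vnorm_nonneg[OF fibre] field_in)

text \<open>Integrability is given for some field of the class and is moved to the chosen one, which
  agrees with it almost everywhere.\<close>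

lemma Lp_carrierD:
  assumes "A \<in> carrier (Lp_fields M H \<Gamma> p)"
  shows "rep A \<in> \<Gamma>" "field_class M \<Gamma> (rep A) = A"
    "integrable M (\<lambda>x. field_norm H A x powr p)"
proof -
  obtain u where u: "u \<in> \<Gamma>" "integrable M (\<lambda>x. vnorm (H x) (u x) powr p)" and A: "A = field_class M \<Gamma> u"
    using assms by (auto simp: Lp_fields_def)
  show r: "rep A \<in> \<Gamma>" using rep_class(1)[OF u(1)] by (simp add: A)
  have ae: "AE x in M. rep A x = u x" using rep_class(2)[OF u(1)] by (simp add: A)
  then show "field_class M \<Gamma> (rep A) = A" unfolding A[symmetric] using class_eq[of "rep A" u] A by simp
  have "integrable M (\<lambda>x. field_norm H A x powr p) \<longleftrightarrow> integrable M (\<lambda>x. vnorm (H x) (u x) powr p)"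
  proof (rule integrable_cong_AE)
    show "(\<lambda>x. field_norm H A x powr p) \<in> borel_measurable M"
      using vnorm_rep_measurable[OF r] by measurable
    show "(\<lambda>x. vnorm (H x) (u x) powr p) \<in> borel_measurable M"
      using vnorm_measurable[OF u(1)] by measurable
    show "AE x in M. field_norm H A x powr p = vnorm (H x) (u x) powr p"
      using ae by eventually_elim (simp add: field_norm_def)
  qed
  then show "integrable M (\<lambda>x. field_norm H A x powr p)" using u(2) by simp
qed

text \<open>One representative decides membership for every exponent, which allows a class of the
  direct integral to be placed in another \<open>L^p\<close> space.\<close>

lemma in_Lp_iff:
  "rep A \<in> \<Gamma> \<Longrightarrow> field_class M \<Gamma> (rep A) = A \<Longrightarrow>
    A \<in> carrier (Lp_fields M H \<Gamma> p) \<longleftrightarrow> integrable M (\<lambda>x. field_norm H A x powr p)"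
  using Lp_carrierD(3)[of A p] class_in_Lp[of "rep A" p] by (auto simp: field_norm_def)

lemma vnorm_Lp: "vnorm (Lp_fields M H \<Gamma> p) A = (\<integral>x. field_norm H A x powr p \<partial>M) powr (1 / p)"
  by (simp add: Lp_fields_def field_norm_def rep_def Let_def)

abbreviation (input) L2 :: "('x \<Rightarrow> 'a) set cnormed" where
  "L2 \<equiv> direct_integral M H \<Gamma>"

lemma L2_eqI:
  assumes "A \<in> carrier L2" "B \<in> carrier L2" "AE x in M. rep A x = rep B x"
  shows "A = B"
  using class_eq[OF assms(3)] Lp_carrierD(2)[OF assms(1)] Lp_carrierD(2)[OF assms(2)] by simp

lemma powr_two_eq: "rep A \<in> \<Gamma> \<Longrightarrow> x \<in> space M \<Longrightarrow> field_norm H A x powr 2 = (field_norm H A x)\<^sup>2"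
  using field_norm_nonneg[of A x] by simp

lemma L2_sq_integrable:
  assumes A: "A \<in> carrier L2"
  shows "integrable M (\<lambda>x. (field_norm H A x)\<^sup>2)"
proof -
  have "integrable M (\<lambda>x. field_norm H A x powr 2) \<longleftrightarrow> integrable M (\<lambda>x. (field_norm H A x)\<^sup>2)"
    by (intro Bochner_Integration.integrable_cong refl powr_two_eq Lp_carrierD(1)[OF A])
  then show ?thesis using Lp_carrierD(3)[OF A] by simp
qed

lemma class_in_L2:
  assumes u: "u \<in> \<Gamma>" and g: "integrable M g"
    and le: "AE x in M. (vnorm (H x) (u x))\<^sup>2 \<le> g x"
  shows "field_class M \<Gamma> u \<in> carrier L2"
proof (rule class_in_Lp[OF u])
  show "integrable M (\<lambda>x. vnorm (H x) (u x) powr 2)"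
  proof (rule Bochner_Integration.integrable_bound[OF g])
    show "(\<lambda>x. vnorm (H x) (u x) powr 2) \<in> borel_measurable M"
      using vnorm_measurable[OF u] by measurable
    show "AE x in M. norm (vnorm (H x) (u x) powr 2) \<le> norm (g x)"
      using le AE_space
    proof eventually_elim
      case (elim x)
      then show ?case using hilbert_space.vnorm_nonneg[OF fibre field_in[OF u]] by simp
    qed
  qed
qed

section \<open>Operations on the direct integral through representatives\<close>

lemma L2_zero_eq: "\<zero>\<^bsub>L2\<^esub> = field_class M \<Gamma> \<zero>\<^bsub>vector_fields M H\<^esub>"
  by (simp add: Lp_fields_def vector_fields_def)

lemma L2_add_eq:
  assumes A: "A \<in> carrier L2" and B: "B \<in> carrier L2"
  shows "A \<oplus>\<^bsub>L2\<^esub> B = field_class M \<Gamma> (rep A \<oplus>\<^bsub>vector_fields M H\<^esub> rep B)"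
proof -
  note reps = Lp_carrierD(1)[OF A] Lp_carrierD(1)[OF B]
  have mem: "u \<in> A \<longleftrightarrow> u \<in> \<Gamma> \<and> (AE x in M. u x = rep A x)" "u \<in> B \<longleftrightarrow> u \<in> \<Gamma> \<and> (AE x in M. u x = rep B x)" for u
    using mem_class_iff[of u "rep A"] mem_class_iff[of u "rep B"] Lp_carrierD(2)[OF A] Lp_carrierD(2)[OF B] by auto
  have "(\<exists>u\<in>A. \<exists>v\<in>B. AE x in M. w x = u x \<oplus>\<^bsub>H x\<^esub> v x) \<longleftrightarrow>
      (AE x in M. w x = (rep A \<oplus>\<^bsub>vector_fields M H\<^esub> rep B) x)" for w
  proof
    assume "\<exists>u\<in>A. \<exists>v\<in>B. AE x in M. w x = u x \<oplus>\<^bsub>H x\<^esub> v x"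
    then obtain u v where "AE x in M. u x = rep A x" "AE x in M. v x = rep B x"
      "AE x in M. w x = u x \<oplus>\<^bsub>H x\<^esub> v x"
      using mem by blast
    then show "AE x in M. w x = (rep A \<oplus>\<^bsub>vector_fields M H\<^esub> rep B) x"
      using AE_space by eventually_elim (simp add: vector_fields_apply)
  next
    assume "AE x in M. w x = (rep A \<oplus>\<^bsub>vector_fields M H\<^esub> rep B) x"
    then have "AE x in M. w x = rep A x \<oplus>\<^bsub>H x\<^esub> rep B x"
      using AE_space by eventually_elim (simp add: vector_fields_apply)
    moreover have "rep A \<in> A" "rep B \<in> B" using mem reps by auto
    ultimately show "\<exists>u\<in>A. \<exists>v\<in>B. AE x in M. w x = u x \<oplus>\<^bsub>H x\<^esub> v x" by blast
  qed
  then show ?thesis by (simp add: Lp_fields_def field_class_def)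
qed

text \<open>Stated for a function \<phi> so that it covers both scalar multiples and multiplication
  operators.\<close>

lemma class_mult_eq:
  assumes A: "A \<in> carrier L2"
  shows "{w \<in> \<Gamma>. \<exists>u\<in>A. AE x in M. w x = \<phi> x \<odot>\<^bsub>H x\<^esub> u x} = field_class M \<Gamma> (fmult \<phi> (rep A))"
proof -
  have mem: "u \<in> A \<longleftrightarrow> u \<in> \<Gamma> \<and> (AE x in M. u x = rep A x)" for u
    using mem_class_iff[of u "rep A"] Lp_carrierD(2)[OF A] by auto
  have "(\<exists>u\<in>A. AE x in M. w x = \<phi> x \<odot>\<^bsub>H x\<^esub> u x) \<longleftrightarrow> (AE x in M. w x = fmult \<phi> (rep A) x)" for w
  proof
    assume "\<exists>u\<in>A. AE x in M. w x = \<phi> x \<odot>\<^bsub>H x\<^esub> u x"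
    then obtain u where "AE x in M. u x = rep A x" "AE x in M. w x = \<phi> x \<odot>\<^bsub>H x\<^esub> u x"
      using mem by blast
    then show "AE x in M. w x = fmult \<phi> (rep A) x"
      using AE_space by eventually_elim (simp add: fmult_def)
  next
    assume "AE x in M. w x = fmult \<phi> (rep A) x"
    then have "AE x in M. w x = \<phi> x \<odot>\<^bsub>H x\<^esub> rep A x"
      using AE_space by eventually_elim (simp add: fmult_def)
    moreover have "rep A \<in> A" using mem Lp_carrierD(1)[OF A] by auto
    ultimately show "\<exists>u\<in>A. AE x in M. w x = \<phi> x \<odot>\<^bsub>H x\<^esub> u x" by blast
  qed
  then show ?thesis by (simp add: field_class_def)
qed

lemma L2_smult_eq: "A \<in> carrier L2 \<Longrightarrow> c \<odot>\<^bsub>L2\<^esub> A = field_class M \<Gamma> (fmult (\<lambda>_. c) (rep A))"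
  using class_mult_eq[of A "\<lambda>_. c"] by (simp add: Lp_fields_def)

lemma mult_op_eq: "A \<in> carrier L2 \<Longrightarrow> mult_op M H \<Gamma> \<phi> A = field_class M \<Gamma> (fmult \<phi> (rep A))"
  using class_mult_eq[of A \<phi>] by (simp add: mult_op_def)

lemma rep_zero: "AE x in M. rep \<zero>\<^bsub>L2\<^esub> x = \<zero>\<^bsub>H x\<^esub>"
  using rep_class(2)[OF fields_zero] AE_space unfolding L2_zero_eq
  by eventually_elim (simp add: vector_fields_apply)

lemma rep_add:
  assumes A: "A \<in> carrier L2" and B: "B \<in> carrier L2"
  shows "AE x in M. rep (A \<oplus>\<^bsub>L2\<^esub> B) x = rep A x \<oplus>\<^bsub>H x\<^esub> rep B x"
  using rep_class(2)[OF fields_add[OF Lp_carrierD(1)[OF A] Lp_carrierD(1)[OF B]]] AE_space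
  unfolding L2_add_eq[OF A B] by eventually_elim (simp add: vector_fields_apply)

lemma rep_mult_op:
  assumes \<phi>: "\<phi> \<in> borel_measurable M" and A: "A \<in> carrier L2"
  shows "AE x in M. rep (mult_op M H \<Gamma> \<phi> A) x = \<phi> x \<odot>\<^bsub>H x\<^esub> rep A x"
  using rep_class(2)[OF fmult_in[OF \<phi> Lp_carrierD(1)[OF A]]] AE_space
  unfolding mult_op_eq[OF A] by eventually_elim (simp add: fmult_def)

lemma L2_smult_mult_op: "A \<in> carrier L2 \<Longrightarrow> c \<odot>\<^bsub>L2\<^esub> A = mult_op M H \<Gamma> (\<lambda>_. c) A"
  by (simp add: L2_smult_eq mult_op_eq)

lemma rep_smult:
  assumes A: "A \<in> carrier L2"
  shows "AE x in M. rep (c \<odot>\<^bsub>L2\<^esub> A) x = c \<odot>\<^bsub>H x\<^esub> rep A x"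
  unfolding L2_smult_mult_op[OF A] by (rule rep_mult_op[OF _ A]) simp

lemma L2_zero: "\<zero>\<^bsub>L2\<^esub> \<in> carrier L2"
  unfolding L2_zero_eq
proof (rule class_in_L2[OF fields_zero])
  show "AE x in M. (vnorm (H x) (\<zero>\<^bsub>vector_fields M H\<^esub> x))\<^sup>2 \<le> 0"
    by (rule AE_I2) (simp add: vector_fields_apply hilbert_space.vnorm_zero[OF fibre])
qed simp

lemma L2_add:
  assumes A: "A \<in> carrier L2" and B: "B \<in> carrier L2"
  shows "A \<oplus>\<^bsub>L2\<^esub> B \<in> carrier L2"
  unfolding L2_add_eq[OF A B]
proof (rule class_in_L2[OF fields_add[OF Lp_carrierD(1)[OF A] Lp_carrierD(1)[OF B]]])
  show "integrable M (\<lambda>x. 2 * (field_norm H A x)\<^sup>2 + 2 * (field_norm H B x)\<^sup>2)"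
    using L2_sq_integrable[OF A] L2_sq_integrable[OF B] by simp
  show "AE x in M. (vnorm (H x) ((rep A \<oplus>\<^bsub>vector_fields M H\<^esub> rep B) x))\<^sup>2 \<le>
      2 * (field_norm H A x)\<^sup>2 + 2 * (field_norm H B x)\<^sup>2"
    using hilbert_space.vnorm_add_sq_le[OF fibre field_in field_in]
      Lp_carrierD(1)[OF A] Lp_carrierD(1)[OF B]
    by (intro AE_I2) (simp add: vector_fields_apply field_norm_def)
qed

lemma field_norm_mult_op:
  assumes \<phi>: "\<phi> \<in> borel_measurable M" and A: "A \<in> carrier L2"
  shows "AE x in M. field_norm H (mult_op M H \<Gamma> \<phi> A) x = cmod (\<phi> x) * field_norm H A x"
  using rep_mult_op[OF \<phi> A] AE_space unfolding field_norm_def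
  by eventually_elim (simp add: hilbert_space.vnorm_smult[OF fibre] field_in Lp_carrierD(1)[OF A])

lemma L2_mult_op:
  assumes \<phi>: "\<phi> \<in> borel_measurable M" and bd: "AE x in M. cmod (\<phi> x) \<le> C" and A: "A \<in> carrier L2"
  shows "mult_op M H \<Gamma> \<phi> A \<in> carrier L2"
  unfolding mult_op_eq[OF A]
proof (rule class_in_L2[OF fmult_in[OF \<phi> Lp_carrierD(1)[OF A]]])
  show "integrable M (\<lambda>x. C\<^sup>2 * (field_norm H A x)\<^sup>2)"
    using L2_sq_integrable[OF A] by simp
  show "AE x in M. (vnorm (H x) (fmult \<phi> (rep A) x))\<^sup>2 \<le> C\<^sup>2 * (field_norm H A x)\<^sup>2"
    using bd AE_space
  proof eventually_elim
    case (elim x)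
    then show ?case
      by (simp add: fmult_def hilbert_space.vnorm_smult[OF fibre] field_in Lp_carrierD(1)[OF A]
          power_mult_distrib field_norm_def mult_right_mono power_mono)
  qed
qed

lemma L2_smult: "A \<in> carrier L2 \<Longrightarrow> c \<odot>\<^bsub>L2\<^esub> A \<in> carrier L2"
  using L2_mult_op[of "\<lambda>_. c" "cmod c" A] by (simp add: L2_smult_mult_op)

text \<open>Representatives respect the operations only off null sets; finitely many sums occur, so
  the exceptional sets can be united.\<close>

lemma rep_signed_sums:
  assumes "set As \<subseteq> carrier L2"
  shows "AE x in M. map (\<lambda>A. rep A x) (signed_sums L2 As) = signed_sums (H x) (map (\<lambda>A. rep A x) As)"
  using assms
proof (induction As)
  case Nil
  then show ?case using rep_zero by simp
next
  case (Cons A As)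
  then have A: "A \<in> carrier L2" and As: "set As \<subseteq> carrier L2" by auto
  have sums: "B \<in> carrier L2" if "B \<in> set (signed_sums L2 As)" for B
    using that signed_sums_closed[of L2 "carrier L2" As] L2_zero L2_add L2_smult As by blast
  have "AE x in M. \<forall>B\<in>set (signed_sums L2 As). rep (B \<oplus>\<^bsub>L2\<^esub> A) x = rep B x \<oplus>\<^bsub>H x\<^esub> rep A x"
    by (rule AE_finite_allI) (auto intro: rep_add sums A)
  moreover have "AE x in M. \<forall>B\<in>set (signed_sums L2 As).
      rep (B \<oplus>\<^bsub>L2\<^esub> (-1) \<odot>\<^bsub>L2\<^esub> A) x = rep B x \<oplus>\<^bsub>H x\<^esub> rep ((-1) \<odot>\<^bsub>L2\<^esub> A) x"
    by (rule AE_finite_allI) (auto intro: rep_add sums L2_smult A)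
  ultimately show ?case
    using Cons.IH[OF As] rep_smult[OF A, of "-1"]
  proof eventually_elim
    case (elim x)
    then show ?case by (simp add: elim(3)[symmetric] o_def)
  qed
qed

text \<open>The null set is fixed before \<open>f\<close> is chosen, so one statement serves the
  square and all powers.\<close>

lemma sign_mean_rep:
  assumes "set As \<subseteq> carrier L2"
  shows "AE x in M. \<forall>f. sign_mean L2 (\<lambda>A. f (field_norm H A x)) As =
      sign_mean (H x) (\<lambda>a. f (vnorm (H x) a)) (map (\<lambda>A. rep A x) As)"
  using rep_signed_sums[OF assms]
proof eventually_elim
  case (elim x)
  show ?case by (simp add: sign_mean_def elim[symmetric] field_norm_def o_def)
qed

text \<open>The moment conditions are the fibrewise Hilbert space inequalities, read off the
  representatives at almost every point.\<close>

lemma field_norms: "field_norms M L2 (field_norm H)"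
proof
  show "\<zero>\<^bsub>L2\<^esub> \<in> carrier L2" by (rule L2_zero)
  show "A \<oplus>\<^bsub>L2\<^esub> B \<in> carrier L2" if "A \<in> carrier L2" "B \<in> carrier L2" for A B
    using that by (rule L2_add)
  show "c \<odot>\<^bsub>L2\<^esub> A \<in> carrier L2" if "A \<in> carrier L2" for c A
    using that by (rule L2_smult)
  show "integrable M (\<lambda>x. (field_norm H A x)\<^sup>2)" if "A \<in> carrier L2" for A
    using that by (rule L2_sq_integrable)
  show "AE x in M. (field_norm H (c \<odot>\<^bsub>L2\<^esub> A) x)\<^sup>2 = (cmod c)\<^sup>2 * (field_norm H A x)\<^sup>2"
    if A: "A \<in> carrier L2" for c A
    using field_norm_mult_op[OF _ A, of "\<lambda>_. c", simplified] unfolding L2_smult_mult_op[OF A]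
    by eventually_elim (simp add: power_mult_distrib)
  fix As assume As: "set As \<subseteq> carrier L2"
  have reps: "set (map (\<lambda>A. rep A x) As) \<subseteq> carrier (H x)" if "x \<in> space M" for x
    using As that Lp_carrierD(1) field_in by fastforce
  show "AE x in M. sign_mean L2 (\<lambda>A. (field_norm H A x)\<^sup>2) As = (\<Sum>A\<leftarrow>As. (field_norm H A x)\<^sup>2)"
    using sign_mean_rep[OF As] AE_space
  proof eventually_elim
    case (elim x)
    show ?case
      using hilbert_space.sign_mean_second_moment[OF fibre reps] spec[OF elim(1), of "\<lambda>z. z\<^sup>2"] elim(2)
      by (simp add: field_norm_def o_def)
  qed
  fix \<theta> :: real
  show "AE x in M. (\<Sum>A\<leftarrow>As. (field_norm H A x)\<^sup>2) powr \<theta> \<le>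
      3 * sign_mean L2 (\<lambda>A. (field_norm H A x)\<^sup>2 powr \<theta>) As" if "0 < \<theta>" "\<theta> \<le> 1"
    using sign_mean_rep[OF As] AE_space
  proof eventually_elim
    case (elim x)
    show ?case
      using hilbert_space.khintchine_lower[OF fibre reps that] spec[OF elim(1), of "\<lambda>z. z\<^sup>2 powr \<theta>"] elim(2)
      by (simp add: field_norm_def o_def)
  qed
  show "AE x in M. sign_mean L2 (\<lambda>A. (field_norm H A x)\<^sup>2 powr \<theta>) As \<le>
      4 * (\<Sum>A\<leftarrow>As. (field_norm H A x)\<^sup>2) powr \<theta>" if "1 \<le> \<theta>" "\<theta> \<le> 2"
    using sign_mean_rep[OF As] AE_space
  proof eventually_elim
    case (elim x)
    show ?case
      using hilbert_space.khintchine_upper[OF fibre reps that] spec[OF elim(1), of "\<lambda>z. z\<^sup>2 powr \<theta>"] elim(2)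
      by (simp add: field_norm_def o_def)
  qed
qed

end

sublocale measurable_family \<subseteq> field_norms M "direct_integral M H \<Gamma>" "field_norm H"
  by (rule field_norms)

context measurable_family
begin

section \<open>Group laws and the algebra of multiplication operators\<close>

lemma vnorm_L2:
  assumes "A \<in> carrier L2"
  shows "vnorm L2 A = sqrt (energy A)"
proof -
  have "(\<integral>x. field_norm H A x powr 2 \<partial>M) = energy A"
    unfolding energy_def
    by (intro Bochner_Integration.integral_cong refl powr_two_eq Lp_carrierD(1)[OF assms])
  then show ?thesis by (simp add: vnorm_Lp powr_half_sqrt energy_nonneg)
qed

lemma L2_add_neg:
  assumes A: "A \<in> carrier L2"
  shows "A \<oplus>\<^bsub>L2\<^esub> (-1) \<odot>\<^bsub>L2\<^esub> A = \<zero>\<^bsub>L2\<^esub>"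
proof (rule L2_eqI)
  show "AE x in M. rep (A \<oplus>\<^bsub>L2\<^esub> (-1) \<odot>\<^bsub>L2\<^esub> A) x = rep \<zero>\<^bsub>L2\<^esub> x"
    using rep_add[OF A L2_smult[OF A, of "-1"]] rep_smult[OF A, of "-1"] rep_zero AE_space
    by eventually_elim (simp add: hilbert_space.add_neg[OF fibre field_in] Lp_carrierD(1)[OF A])
qed (intro L2_add L2_smult L2_zero A)+

text \<open>Uniqueness of the negative is what later identifies subtraction of operators, which is a
  definite description.\<close>

lemma L2_neg_unique:
  assumes A: "A \<in> carrier L2" and B: "B \<in> carrier L2" and eq: "A \<oplus>\<^bsub>L2\<^esub> B = \<zero>\<^bsub>L2\<^esub>"
  shows "B = (-1) \<odot>\<^bsub>L2\<^esub> A"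
proof (rule L2_eqI)
  have "AE x in M. rep \<zero>\<^bsub>L2\<^esub> x = rep A x \<oplus>\<^bsub>H x\<^esub> rep B x"
    using rep_add[OF A B] by (simp add: eq)
  then show "AE x in M. rep B x = rep ((-1) \<odot>\<^bsub>L2\<^esub> A) x"
    using rep_smult[OF A, of "-1"] rep_zero AE_space
  proof eventually_elim
    case (elim x)
    then show ?case
      using hilbert_space.eq_neg_if_add_eq_zero[OF fibre[of x], of "rep A x" "rep B x"]
      by (simp add: field_in Lp_carrierD(1)[OF A] Lp_carrierD(1)[OF B])
  qed
qed (intro L2_smult A B)+

lemma L2_add_commute:
  assumes A: "A \<in> carrier L2" and B: "B \<in> carrier L2"
  shows "A \<oplus>\<^bsub>L2\<^esub> B = B \<oplus>\<^bsub>L2\<^esub> A"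
proof (rule L2_eqI)
  show "AE x in M. rep (A \<oplus>\<^bsub>L2\<^esub> B) x = rep (B \<oplus>\<^bsub>L2\<^esub> A) x"
    using rep_add[OF A B] rep_add[OF B A] AE_space
  proof eventually_elim
    case (elim x)
    interpret hilbert_space "H x" by (rule fibre[OF elim(3)])
    show ?case using elim field_in[OF Lp_carrierD(1)[OF A]] field_in[OF Lp_carrierD(1)[OF B]]
      by (simp add: a_comm)
  qed
qed (intro L2_add A B)+

lemma mult_op_add:
  assumes \<phi>: "\<phi> \<in> borel_measurable M" "AE x in M. cmod (\<phi> x) \<le> C"
    and A: "A \<in> carrier L2" and B: "B \<in> carrier L2"
  shows "mult_op M H \<Gamma> \<phi> (A \<oplus>\<^bsub>L2\<^esub> B) = mult_op M H \<Gamma> \<phi> A \<oplus>\<^bsub>L2\<^esub> mult_op M H \<Gamma> \<phi> B"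
proof (rule L2_eqI)
  note in_L2 = L2_mult_op[OF \<phi>]
  show "AE x in M. rep (mult_op M H \<Gamma> \<phi> (A \<oplus>\<^bsub>L2\<^esub> B)) x =
      rep (mult_op M H \<Gamma> \<phi> A \<oplus>\<^bsub>L2\<^esub> mult_op M H \<Gamma> \<phi> B) x"
    using rep_mult_op[OF \<phi>(1) A] rep_mult_op[OF \<phi>(1) B] rep_mult_op[OF \<phi>(1) L2_add[OF A B]]
      rep_add[OF A B] rep_add[OF in_L2[OF A] in_L2[OF B]] AE_space
    by eventually_elim
      (simp add: hilbert_space.smult_distrib[OF fibre] field_in Lp_carrierD(1)[OF A] Lp_carrierD(1)[OF B])
qed (intro L2_add L2_mult_op[OF \<phi>] A B)+

text \<open>Scalars commute in every fibre. Taking \<psi> constant yields homogeneity of the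
  multiplication operators.\<close>

lemma mult_op_mult_op:
  assumes \<phi>: "\<phi> \<in> borel_measurable M" "AE x in M. cmod (\<phi> x) \<le> C"
    and \<psi>: "\<psi> \<in> borel_measurable M" "AE x in M. cmod (\<psi> x) \<le> D"
    and A: "A \<in> carrier L2"
  shows "mult_op M H \<Gamma> \<phi> (mult_op M H \<Gamma> \<psi> A) = mult_op M H \<Gamma> \<psi> (mult_op M H \<Gamma> \<phi> A)"
proof (rule L2_eqI)
  note in_L2 = L2_mult_op[OF \<phi>] L2_mult_op[OF \<psi>]
  show "AE x in M. rep (mult_op M H \<Gamma> \<phi> (mult_op M H \<Gamma> \<psi> A)) x =
      rep (mult_op M H \<Gamma> \<psi> (mult_op M H \<Gamma> \<phi> A)) x"
    using rep_mult_op[OF \<phi>(1) A] rep_mult_op[OF \<psi>(1) A] rep_mult_op[OF \<phi>(1) in_L2(2)[OF A]]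
      rep_mult_op[OF \<psi>(1) in_L2(1)[OF A]] AE_space
    by eventually_elim
      (simp add: hilbert_space.smult_smult[OF fibre] field_in Lp_carrierD(1)[OF A] mult.commute)
qed (intro L2_mult_op[OF \<phi>] L2_mult_op[OF \<psi>] A)+

lemma mult_op_smult:
  assumes \<phi>: "\<phi> \<in> borel_measurable M" "AE x in M. cmod (\<phi> x) \<le> C" and A: "A \<in> carrier L2"
  shows "mult_op M H \<Gamma> \<phi> (c \<odot>\<^bsub>L2\<^esub> A) = c \<odot>\<^bsub>L2\<^esub> mult_op M H \<Gamma> \<phi> A"
  using mult_op_mult_op[OF \<phi>, of "\<lambda>_. c" "cmod c" A] A L2_mult_op[OF \<phi> A]
  by (simp add: L2_smult_mult_op)

lemma L2_split:
  assumes D: "D \<in> sets M" and A: "A \<in> carrier L2"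
  shows "A = mult_op M H \<Gamma> (indicator D) A \<oplus>\<^bsub>L2\<^esub> mult_op M H \<Gamma> (indicator (space M - D)) A"
proof (rule L2_eqI)
  have m: "indicator D \<in> borel_measurable M" "indicator (space M - D) \<in> borel_measurable M"
    using D by auto
  have bd: "AE x in M. cmod (indicator D' x) \<le> 1" for D' by (simp add: indicator_def)
  note in_L2 = L2_mult_op[OF m(1) bd A] L2_mult_op[OF m(2) bd A]
  show "A \<in> carrier L2" by (rule A)
  show "mult_op M H \<Gamma> (indicator D) A \<oplus>\<^bsub>L2\<^esub> mult_op M H \<Gamma> (indicator (space M - D)) A \<in> carrier L2"
    by (intro L2_add in_L2)
  show "AE x in M. rep A x =
      rep (mult_op M H \<Gamma> (indicator D) A \<oplus>\<^bsub>L2\<^esub> mult_op M H \<Gamma> (indicator (space M - D)) A) x"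
    using rep_mult_op[OF m(1) A] rep_mult_op[OF m(2) A] rep_add[OF in_L2] AE_space
  proof eventually_elim
    case (elim x)
    interpret hilbert_space "H x" by (rule fibre[OF elim(4)])
    have x: "rep A x \<in> carrier (H x)" using elim field_in Lp_carrierD(1)[OF A] by blast
    then show ?case using elim add_smult[OF x, of 1 0] add_smult[OF x, of 0 1] one_smult[OF x]
      by (cases "x \<in> D") simp_all
  qed
qed

text \<open>Rewrites the error of a cut-off as the complementary cut-off, the form in which it is
  estimated.\<close>

lemma L2_minus_indicator:
  assumes D: "D \<in> sets M" and A: "A \<in> carrier L2"
  shows "A \<oplus>\<^bsub>L2\<^esub> (-1) \<odot>\<^bsub>L2\<^esub> mult_op M H \<Gamma> (indicator D) A = mult_op M H \<Gamma> (indicator (space M - D)) A"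
proof (rule L2_eqI)
  have m: "indicator D \<in> borel_measurable M" "indicator (space M - D) \<in> borel_measurable M"
    using D by auto
  have bd: "AE x in M. cmod (indicator D' x) \<le> 1" for D' by (simp add: indicator_def)
  note in_L2 = L2_mult_op[OF m(1) bd A] L2_mult_op[OF m(2) bd A]
  show "mult_op M H \<Gamma> (indicator (space M - D)) A \<in> carrier L2" by (rule in_L2)
  show "A \<oplus>\<^bsub>L2\<^esub> (-1) \<odot>\<^bsub>L2\<^esub> mult_op M H \<Gamma> (indicator D) A \<in> carrier L2"
    by (intro L2_add L2_smult in_L2 A)
  show "AE x in M. rep (A \<oplus>\<^bsub>L2\<^esub> (-1) \<odot>\<^bsub>L2\<^esub> mult_op M H \<Gamma> (indicator D) A) x =
      rep (mult_op M H \<Gamma> (indicator (space M - D)) A) x"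
    using rep_mult_op[OF m(1) A] rep_mult_op[OF m(2) A] rep_add[OF A L2_smult[OF in_L2(1)], of "-1"]
      rep_smult[OF in_L2(1), of "-1"] AE_space
  proof eventually_elim
    case (elim x)
    interpret hilbert_space "H x" by (rule fibre[OF elim(5)])
    have x: "rep A x \<in> carrier (H x)" using elim field_in Lp_carrierD(1)[OF A] by blast
    then show ?case using elim add_neg[OF x] one_smult[OF x] smult_smult[OF x, of "-1" 0]
        smult_l_null[OF x] by (cases "x \<in> D") simp_all
  qed
qed

end

section \<open>Bounded operators between direct integrals\<close>

lemma bounded_ops_carrier_iff:
  "T \<in> carrier (bounded_ops V W) \<longleftrightarrow> T \<in> carrier V \<rightarrow>\<^sub>E carrier W \<and>
     (\<forall>u\<in>carrier V. \<forall>v\<in>carrier V. T (u \<oplus>\<^bsub>V\<^esub> v) = T u \<oplus>\<^bsub>W\<^esub> T v) \<and>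
     (\<forall>c. \<forall>u\<in>carrier V. T (c \<odot>\<^bsub>V\<^esub> u) = c \<odot>\<^bsub>W\<^esub> T u) \<and>
     (\<exists>C. \<forall>u\<in>carrier V. vnorm W (T u) \<le> C * vnorm V u)"
  by (simp add: bounded_ops_def)

lemma bounded_ops_in: "\<lbrakk>T \<in> carrier (bounded_ops V W); u \<in> carrier V\<rbrakk> \<Longrightarrow> T u \<in> carrier W"
  by (auto simp: bounded_ops_carrier_iff)

lemma bounded_ops_add:
  "\<lbrakk>T \<in> carrier (bounded_ops V W); u \<in> carrier V; v \<in> carrier V\<rbrakk> \<Longrightarrow>
    T (u \<oplus>\<^bsub>V\<^esub> v) = T u \<oplus>\<^bsub>W\<^esub> T v"
  by (auto simp: bounded_ops_carrier_iff)

lemma bounded_ops_smult: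
  "\<lbrakk>T \<in> carrier (bounded_ops V W); u \<in> carrier V\<rbrakk> \<Longrightarrow> T (c \<odot>\<^bsub>V\<^esub> u) = c \<odot>\<^bsub>W\<^esub> T u"
  by (auto simp: bounded_ops_carrier_iff)

lemma bounded_opsE:
  assumes "T \<in> carrier (bounded_ops V W)"
  obtains C where "\<And>u. u \<in> carrier V \<Longrightarrow> vnorm W (T u) \<le> C * vnorm V u"
proof -
  have "\<exists>C. \<forall>u\<in>carrier V. vnorm W (T u) \<le> C * vnorm V u"
    using assms unfolding bounded_ops_carrier_iff by (elim conjE)
  then show ?thesis using that by blast
qed

lemma subset_lin_span: "G \<subseteq> lin_span V G"
  by (auto simp: lin_span_def)

context measurable_family
begin

text \<open>Two terms on the right suffice for sums, for multiplication operators (with c = 0) and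
  for a multiplier estimated separately on a set and off it.\<close>

lemma energy_le:
  assumes A: "A \<in> carrier L2" and B: "B \<in> carrier L2" and C: "C \<in> carrier L2"
    and le: "AE x in M. (field_norm H A x)\<^sup>2 \<le> b * (field_norm H B x)\<^sup>2 + c * (field_norm H C x)\<^sup>2"
  shows "energy A \<le> b * energy B + c * energy C"
proof -
  have "energy A \<le> (\<integral>x. b * (field_norm H B x)\<^sup>2 + c * (field_norm H C x)\<^sup>2 \<partial>M)"
    unfolding energy_def
    using pn_sq_integrable[OF A] pn_sq_integrable[OF B] pn_sq_integrable[OF C] le
    by (intro integral_mono_AE) auto
  also have "\<dots> = b * energy B + c * energy C"
    using pn_sq_integrable[OF B] pn_sq_integrable[OF C] by (simp add: energy_def)
  finally show ?thesis .
qed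

lemma energy_zero: "energy \<zero>\<^bsub>L2\<^esub> = 0"
proof -
  have "AE x in M. (field_norm H \<zero>\<^bsub>L2\<^esub> x)\<^sup>2 \<le> 0 * (field_norm H \<zero>\<^bsub>L2\<^esub> x)\<^sup>2 + 0 * (field_norm H \<zero>\<^bsub>L2\<^esub> x)\<^sup>2"
    using rep_zero AE_space
    by eventually_elim (simp add: field_norm_def hilbert_space.vnorm_zero[OF fibre])
  from energy_le[OF L2_zero L2_zero L2_zero this] show ?thesis
    using energy_nonneg[of "\<zero>\<^bsub>L2\<^esub>"] by simp
qed

lemma energy_add_le:
  assumes A: "A \<in> carrier L2" and B: "B \<in> carrier L2"
  shows "energy (A \<oplus>\<^bsub>L2\<^esub> B) \<le> 2 * energy A + 2 * energy B"
proof (rule energy_le[OF L2_add[OF A B] A B])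
  show "AE x in M. (field_norm H (A \<oplus>\<^bsub>L2\<^esub> B) x)\<^sup>2 \<le> 2 * (field_norm H A x)\<^sup>2 + 2 * (field_norm H B x)\<^sup>2"
    using rep_add[OF A B] AE_space
  proof eventually_elim
    case (elim x)
    then show ?case
      using hilbert_space.vnorm_add_sq_le[OF fibre, of x "rep A x" "rep B x"]
      by (simp add: field_norm_def field_in Lp_carrierD(1)[OF A] Lp_carrierD(1)[OF B])
  qed
qed

lemma energy_mult_op_le:
  assumes \<phi>: "\<phi> \<in> borel_measurable M" "AE x in M. cmod (\<phi> x) \<le> C" and A: "A \<in> carrier L2"
  shows "energy (mult_op M H \<Gamma> \<phi> A) \<le> C\<^sup>2 * energy A"
proof -
  have "AE x in M. (field_norm H (mult_op M H \<Gamma> \<phi> A) x)\<^sup>2 \<le>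
      C\<^sup>2 * (field_norm H A x)\<^sup>2 + 0 * (field_norm H A x)\<^sup>2"
    using field_norm_mult_op[OF \<phi>(1) A] \<phi>(2)
    by eventually_elim (simp add: power_mult_distrib mult_right_mono power_mono)
  from energy_le[OF L2_mult_op[OF \<phi> A] A A this] show ?thesis by simp
qed

lemma mult_op_bounded:
  assumes \<phi>: "\<phi> \<in> borel_measurable M" "AE x in M. cmod (\<phi> x) \<le> C"
  shows "mult_op M H \<Gamma> \<phi> \<in> carrier (bounded_ops L2 L2)"
  unfolding bounded_ops_carrier_iff
proof (intro conjI ballI allI exI)
  show "mult_op M H \<Gamma> \<phi> \<in> carrier L2 \<rightarrow>\<^sub>E carrier L2"
    using L2_mult_op[OF \<phi>] by (auto simp: mult_op_def)
  fix A assume A: "A \<in> carrier L2"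
  show "mult_op M H \<Gamma> \<phi> (A \<oplus>\<^bsub>L2\<^esub> B) = mult_op M H \<Gamma> \<phi> A \<oplus>\<^bsub>L2\<^esub> mult_op M H \<Gamma> \<phi> B"
    if "B \<in> carrier L2" for B
    using mult_op_add[OF \<phi> A that] .
  show "mult_op M H \<Gamma> \<phi> (c \<odot>\<^bsub>L2\<^esub> A) = c \<odot>\<^bsub>L2\<^esub> mult_op M H \<Gamma> \<phi> A" for c
    using mult_op_smult[OF \<phi> A] .
  show "vnorm L2 (mult_op M H \<Gamma> \<phi> A) \<le> \<bar>C\<bar> * vnorm L2 A"
    using real_sqrt_le_mono[OF energy_mult_op_le[OF \<phi> A]]
    by (simp add: vnorm_L2 A L2_mult_op[OF \<phi> A] real_sqrt_mult)
qed

lemma indicator_bounded: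
  assumes "D \<in> sets M"
  shows "indicator D \<in> borel_measurable M" "AE x in M. cmod (indicator D x) \<le> 1"
  using assms by (auto simp: indicator_def)

lemma energy_indicator:
  assumes D: "D \<in> sets M" and A: "A \<in> carrier L2"
  shows "energy (mult_op M H \<Gamma> (indicator D) A) = (\<integral>x. indicator D x * (field_norm H A x)\<^sup>2 \<partial>M)"
  unfolding energy_def
proof (rule integral_cong_AE)
  note D' = indicator_bounded[OF D]
  show "(\<lambda>x. (field_norm H (mult_op M H \<Gamma> (indicator D) A) x)\<^sup>2) \<in> borel_measurable M"
    by (intro pn_sq_measurable L2_mult_op[OF D' A])
  show "(\<lambda>x. indicator D x * (field_norm H A x)\<^sup>2) \<in> borel_measurable M"
    using D A by measurable
  show "AE x in M. (field_norm H (mult_op M H \<Gamma> (indicator D) A) x)\<^sup>2 = indicator D x * (field_norm H A x)\<^sup>2"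
    using field_norm_mult_op[OF D'(1) A] by eventually_elim (simp add: indicator_def)
qed

lemma energy_indicator_le:
  "\<lbrakk>D \<in> sets M; A \<in> carrier L2\<rbrakk> \<Longrightarrow> energy (mult_op M H \<Gamma> (indicator D) A) \<le> energy A"
  using energy_mult_op_le[OF indicator_bounded] by fastforce

text \<open>Links the exponent p/2, applied to squared norms in the concentration theorems, with the
  exponent p of the spaces.\<close>

lemma sq_powr_half:
  "rep A \<in> \<Gamma> \<Longrightarrow> x \<in> space M \<Longrightarrow> (field_norm H A x)\<^sup>2 powr (p / 2) = field_norm H A x powr p"
  using powr_two_eq[of A x] by (simp add: powr_powr flip: powr_two_eq)

end

lemma compose_bounded_ops:
  assumes T: "T \<in> carrier (bounded_ops V W)" and R: "R \<in> carrier (bounded_ops W Z)"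
    and nonneg: "\<And>w. w \<in> carrier W \<Longrightarrow> 0 \<le> vnorm W w"
    and closed: "\<And>u v. \<lbrakk>u \<in> carrier V; v \<in> carrier V\<rbrakk> \<Longrightarrow> u \<oplus>\<^bsub>V\<^esub> v \<in> carrier V"
      "\<And>c u. u \<in> carrier V \<Longrightarrow> c \<odot>\<^bsub>V\<^esub> u \<in> carrier V"
  shows "compose (carrier V) R T \<in> carrier (bounded_ops V Z)"
proof -
  obtain c where c: "\<And>u. u \<in> carrier V \<Longrightarrow> vnorm W (T u) \<le> c * vnorm V u"
    using bounded_opsE[OF T] by blast
  obtain d where d: "\<And>w. w \<in> carrier W \<Longrightarrow> vnorm Z (R w) \<le> d * vnorm W w"
    using bounded_opsE[OF R] by blast
  \<comment> \<open>A bound \<open>d\<close> may be negative, for instance on a trivial space, so it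
    is replaced by \<open>max d 0\<close> before multiplying inequalities.\<close>
  have "vnorm Z (R (T u)) \<le> (max d 0 * c) * vnorm V u" if u: "u \<in> carrier V" for u
  proof -
    have "vnorm Z (R (T u)) \<le> d * vnorm W (T u)" by (rule d[OF bounded_ops_in[OF T u]])
    also have "\<dots> \<le> max d 0 * vnorm W (T u)"
      using nonneg[OF bounded_ops_in[OF T u]] by (intro mult_right_mono) auto
    also have "\<dots> \<le> max d 0 * (c * vnorm V u)" by (intro mult_left_mono c u) auto
    finally show ?thesis by (simp add: mult.assoc)
  qed
  then show ?thesis
    using closed bounded_ops_in[OF T] bounded_ops_in[OF R]
    by (auto simp: bounded_ops_carrier_iff[of _ V Z] compose_def bounded_ops_add[OF T] bounded_ops_add[OF R]
        bounded_ops_smult[OF T] bounded_ops_smult[OF R])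
qed

section \<open>Operators between two direct integrals\<close>

locale measurable_family_pair =
  dom: measurable_family M H \<Gamma> + cod: measurable_family M K \<Delta>
  for M :: "'x measure" and H :: "'x \<Rightarrow> 'a chilbert" and \<Gamma> and K :: "'x \<Rightarrow> 'b chilbert" and \<Delta>
begin

abbreviation (input) V :: "('x \<Rightarrow> 'a) set cnormed" where "V \<equiv> direct_integral M H \<Gamma>"
abbreviation (input) W :: "('x \<Rightarrow> 'b) set cnormed" where "W \<equiv> direct_integral M K \<Delta>"

lemma bounded_op_energy:
  assumes "T \<in> carrier (bounded_ops V W)"
  obtains C where "0 \<le> C" "\<And>A. A \<in> carrier V \<Longrightarrow> cod.energy (T A) \<le> C * dom.energy A"
proof -
  obtain c where c: "\<And>A. A \<in> carrier V \<Longrightarrow> vnorm W (T A) \<le> c * vnorm V A"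
    using bounded_opsE[OF assms] by blast
  have "cod.energy (T A) \<le> c\<^sup>2 * dom.energy A" if A: "A \<in> carrier V" for A
  proof -
    have "sqrt (cod.energy (T A)) \<le> c * sqrt (dom.energy A)"
      using c[OF A] by (simp add: dom.vnorm_L2[OF A] cod.vnorm_L2[OF bounded_ops_in[OF assms A]])
    then have "(sqrt (cod.energy (T A)))\<^sup>2 \<le> (c * sqrt (dom.energy A))\<^sup>2"
      by (rule power_mono) (simp add: cod.energy_nonneg)
    then show ?thesis by (simp add: power_mult_distrib cod.energy_nonneg dom.energy_nonneg)
  qed
  then show ?thesis using that[of "c\<^sup>2"] by simp
qed

lemma compose_mult_op_left:
  assumes "T \<in> carrier (bounded_ops V W)" "\<phi> \<in> borel_measurable M" "AE x in M. cmod (\<phi> x) \<le> C"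
  shows "compose (carrier V) (mult_op M K \<Delta> \<phi>) T \<in> carrier (bounded_ops V W)"
  by (rule compose_bounded_ops[OF assms(1) cod.mult_op_bounded[OF assms(2,3)]])
    (simp_all add: cod.vnorm_L2 cod.energy_nonneg dom.L2_add dom.L2_smult)

lemma compose_mult_op_right:
  assumes "T \<in> carrier (bounded_ops V W)" "\<phi> \<in> borel_measurable M" "AE x in M. cmod (\<phi> x) \<le> C"
  shows "compose (carrier V) T (mult_op M H \<Gamma> \<phi>) \<in> carrier (bounded_ops V W)"
  by (rule compose_bounded_ops[OF dom.mult_op_bounded[OF assms(2,3)] assms(1)])
    (simp_all add: dom.vnorm_L2 dom.energy_nonneg dom.L2_add dom.L2_smult)

lemma field_operator:
  assumes T: "T \<in> carrier (bounded_ops V W)"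
  shows "field_operator M V (field_norm H) W (field_norm K) T"
proof
  show "T A \<in> carrier W" if "A \<in> carrier V" for A using bounded_ops_in[OF T that] .
  show "T (A \<oplus>\<^bsub>V\<^esub> B) = T A \<oplus>\<^bsub>W\<^esub> T B" if "A \<in> carrier V" "B \<in> carrier V" for A B
    using bounded_ops_add[OF T that] .
  show smult: "T (c \<odot>\<^bsub>V\<^esub> A) = c \<odot>\<^bsub>W\<^esub> T A" if "A \<in> carrier V" for c A
    using bounded_ops_smult[OF T that] .
  \<comment> \<open>Zero is written as 0 + (-1) 0, so that additivity and homogeneity give T 0 = 0
    without cancelling in the records.\<close>
  have "T (\<zero>\<^bsub>V\<^esub> \<oplus>\<^bsub>V\<^esub> (-1) \<odot>\<^bsub>V\<^esub> \<zero>\<^bsub>V\<^esub>) = T \<zero>\<^bsub>V\<^esub> \<oplus>\<^bsub>W\<^esub> (-1) \<odot>\<^bsub>W\<^esub> T \<zero>\<^bsub>V\<^esub>"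
    by (simp add: bounded_ops_add[OF T] bounded_ops_smult[OF T] dom.L2_zero dom.L2_smult)
  then show "T \<zero>\<^bsub>V\<^esub> = \<zero>\<^bsub>W\<^esub>"
    by (simp add: dom.L2_add_neg[OF dom.L2_zero] cod.L2_add_neg[OF bounded_ops_in[OF T dom.L2_zero]])
qed

text \<open>\<open>bounded_ops V W\<close> is a bare record, so its subtraction has to be identified by hand.\<close>

lemma bounded_ops_neg:
  assumes T: "T \<in> carrier (bounded_ops V W)"
  shows "\<ominus>\<^bsub>bounded_ops V W\<^esub> T = (\<lambda>A\<in>carrier V. (-1) \<odot>\<^bsub>W\<^esub> T A)"
proof -
  let ?B = "bounded_ops V W"
  define N where "N = (\<lambda>A\<in>carrier V. (-1) \<odot>\<^bsub>W\<^esub> T A)"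
  \<comment> \<open>As a composition with multiplication by the constant -1, the candidate is a
    bounded operator.\<close>
  have N_eq: "N = compose (carrier V) (mult_op M K \<Delta> (\<lambda>_. -1)) T"
    unfolding N_def compose_def using cod.L2_smult_mult_op[OF bounded_ops_in[OF T]]
    by (intro restrict_ext) simp
  have N: "N \<in> carrier ?B"
    unfolding N_eq by (rule compose_mult_op_left[OF T, of _ 1]) auto
  have N_apply: "N A = (-1) \<odot>\<^bsub>W\<^esub> T A" if "A \<in> carrier V" for A
    using that by (simp add: N_def)
  have add: "R \<oplus>\<^bsub>?B\<^esub> Q = (\<lambda>A\<in>carrier V. R A \<oplus>\<^bsub>W\<^esub> Q A)" for R Q
    by (simp add: bounded_ops_def)
  have zero: "\<zero>\<^bsub>?B\<^esub> = (\<lambda>A\<in>carrier V. \<zero>\<^bsub>W\<^esub>)"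
    by (simp add: bounded_ops_def)
  have inv: "T \<oplus>\<^bsub>?B\<^esub> N = \<zero>\<^bsub>?B\<^esub>"
    unfolding add zero using cod.L2_add_neg[OF bounded_ops_in[OF T]]
    by (intro restrict_ext) (simp add: N_apply)
  have comm: "N \<oplus>\<^bsub>?B\<^esub> T = T \<oplus>\<^bsub>?B\<^esub> N"
    unfolding add using cod.L2_add_commute[OF bounded_ops_in[OF N] bounded_ops_in[OF T]]
    by (intro restrict_ext) blast
  \<comment> \<open>The inverse is a definite description, so uniqueness among bounded operators is
    required; it is checked on each class.\<close>
  have unique: "R = N" if R: "R \<in> carrier ?B" and eq: "T \<oplus>\<^bsub>?B\<^esub> R = \<zero>\<^bsub>?B\<^esub>" for R
  proof (rule extensionalityI)
    show "R \<in> extensional (carrier V)" using R by (auto simp: bounded_ops_carrier_iff PiE_def)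
    show "N \<in> extensional (carrier V)" by (simp add: N_def)
    fix A assume A: "A \<in> carrier V"
    have "T A \<oplus>\<^bsub>W\<^esub> R A = \<zero>\<^bsub>W\<^esub>"
      using fun_cong[OF eq, of A] A unfolding add zero by simp
    then show "R A = N A"
      using cod.L2_neg_unique[OF bounded_ops_in[OF T A] bounded_ops_in[OF R A]] A by (simp add: N_apply)
  qed
  have "m_inv (add_monoid ?B) T = N"
    unfolding m_inv_def
  proof (rule the_equality)
    show "N \<in> carrier (add_monoid ?B) \<and> T \<otimes>\<^bsub>add_monoid ?B\<^esub> N = \<one>\<^bsub>add_monoid ?B\<^esub> \<and>
        N \<otimes>\<^bsub>add_monoid ?B\<^esub> T = \<one>\<^bsub>add_monoid ?B\<^esub>"
      using N inv comm by simp
    show "R = N" if "R \<in> carrier (add_monoid ?B) \<and> T \<otimes>\<^bsub>add_monoid ?B\<^esub> R = \<one>\<^bsub>add_monoid ?B\<^esub> \<and>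
        R \<otimes>\<^bsub>add_monoid ?B\<^esub> T = \<one>\<^bsub>add_monoid ?B\<^esub>" for R
      using that by (intro unique) simp_all
  qed
  then show ?thesis unfolding a_inv_def N_def .
qed

text \<open>The operator norm is a supremum over the unit ball, to which a square root of the energy
  bound applies; the zero class shows that the ball is nonempty.\<close>

lemma vnorm_bounded_ops_diff_le:
  assumes R: "R \<in> carrier (bounded_ops V W)" and T: "T \<in> carrier (bounded_ops V W)" and "0 \<le> e"
    and le: "\<And>A. A \<in> carrier V \<Longrightarrow> cod.energy (R A \<oplus>\<^bsub>W\<^esub> (-1) \<odot>\<^bsub>W\<^esub> T A) \<le> e\<^sup>2 * dom.energy A"
  shows "vnorm (bounded_ops V W) (R \<ominus>\<^bsub>bounded_ops V W\<^esub> T) \<le> e"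
proof -
  let ?D = "R \<ominus>\<^bsub>bounded_ops V W\<^esub> T"
  have D: "?D A = R A \<oplus>\<^bsub>W\<^esub> (-1) \<odot>\<^bsub>W\<^esub> T A" if "A \<in> carrier V" for A
    using that unfolding a_minus_def bounded_ops_neg[OF T] by (simp add: bounded_ops_def)
  have "Sup {vnorm W (?D A) |A. A \<in> carrier V \<and> vnorm V A \<le> 1} \<le> e"
  proof (rule cSup_least)
    have "vnorm V \<zero>\<^bsub>V\<^esub> \<le> 1"
      using dom.energy_zero by (simp add: dom.vnorm_L2 dom.L2_zero)
    then show "{vnorm W (?D A) |A. A \<in> carrier V \<and> vnorm V A \<le> 1} \<noteq> {}"
      using dom.L2_zero by blast
    fix r assume "r \<in> {vnorm W (?D A) |A. A \<in> carrier V \<and> vnorm V A \<le> 1}"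
    then obtain A where A: "A \<in> carrier V" "vnorm V A \<le> 1" and r: "r = vnorm W (?D A)" by blast
    have "R A \<oplus>\<^bsub>W\<^esub> (-1) \<odot>\<^bsub>W\<^esub> T A \<in> carrier W"
      by (rule cod.L2_add[OF bounded_ops_in[OF R A(1)] cod.L2_smult[OF bounded_ops_in[OF T A(1)]]])
    then have "r = sqrt (cod.energy (R A \<oplus>\<^bsub>W\<^esub> (-1) \<odot>\<^bsub>W\<^esub> T A))"
      unfolding r D[OF A(1)] by (rule cod.vnorm_L2)
    also have "\<dots> \<le> sqrt (e\<^sup>2 * dom.energy A)" by (intro real_sqrt_le_mono le A)
    also have "\<dots> = e * vnorm V A" using A \<open>0 \<le> e\<close> by (simp add: real_sqrt_mult dom.vnorm_L2)
    also have "\<dots> \<le> e" using A(2) \<open>0 \<le> e\<close> by (simp add: mult_left_le)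
    finally show "r \<le> e" .
  qed
  then show ?thesis by (simp add: bounded_ops_def)
qed

text \<open>Approximation by single generators is enough, as they lie in their span.\<close>

lemma closed_span_bounded_opsI:
  assumes R: "R \<in> carrier (bounded_ops V W)"
    and ex: "\<And>e. 0 < e \<Longrightarrow> \<exists>T\<in>G \<inter> carrier (bounded_ops V W). \<forall>A\<in>carrier V.
      cod.energy (R A \<oplus>\<^bsub>W\<^esub> (-1) \<odot>\<^bsub>W\<^esub> T A) \<le> e\<^sup>2 * dom.energy A"
  shows "R \<in> closed_span (bounded_ops V W) G"
  unfolding closed_span_def
proof (intro CollectI conjI allI impI R)
  fix \<epsilon> :: real assume "0 < \<epsilon>"
  then obtain T where T: "T \<in> G" "T \<in> carrier (bounded_ops V W)"
    "\<And>A. A \<in> carrier V \<Longrightarrow> cod.energy (R A \<oplus>\<^bsub>W\<^esub> (-1) \<odot>\<^bsub>W\<^esub> T A) \<le> (\<epsilon> / 2)\<^sup>2 * dom.energy A"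
    \<comment> \<open>Half of \<epsilon> turns the weak inequality for the norm into the strict one
      in \<open>closed_span\<close>.\<close>
    using ex[of "\<epsilon> / 2"] by auto
  have "vnorm (bounded_ops V W) (R \<ominus>\<^bsub>bounded_ops V W\<^esub> T) \<le> \<epsilon> / 2"
    using T \<open>0 < \<epsilon>\<close> by (intro vnorm_bounded_ops_diff_le R) auto
  then show "\<exists>T\<in>lin_span (bounded_ops V W) G. vnorm (bounded_ops V W) (R \<ominus>\<^bsub>bounded_ops V W\<^esub> T) < \<epsilon>"
    using T(1) subset_lin_span[of G "bounded_ops V W"] \<open>0 < \<epsilon>\<close> by (intro bexI[of _ T]) auto
qed

text \<open>Raising the norm inequality to the power p removes the roots. The absolute value guards
  against a negative bound.\<close>

lemma induced_Lp_bound: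
  assumes ind: "induces_bounded_Lp M H \<Gamma> K \<Delta> p S" and "0 < p"
  obtains C where "0 \<le> C"
    "\<And>A. \<lbrakk>A \<in> carrier V; A \<in> carrier (Lp_fields M H \<Gamma> p)\<rbrakk> \<Longrightarrow> S A \<in> carrier (Lp_fields M K \<Delta> p) \<and>
      (\<integral>x. field_norm K (S A) x powr p \<partial>M) \<le> C * (\<integral>x. field_norm H A x powr p \<partial>M)"
proof -
  obtain T where T: "T \<in> carrier (bounded_ops (Lp_fields M H \<Gamma> p) (Lp_fields M K \<Delta> p))"
    and TS: "\<And>A. \<lbrakk>A \<in> carrier V; A \<in> carrier (Lp_fields M H \<Gamma> p)\<rbrakk> \<Longrightarrow> T A = S A"
    using ind by (auto simp: induces_bounded_Lp_def)
  obtain c where c: "\<And>A. A \<in> carrier (Lp_fields M H \<Gamma> p) \<Longrightarrow>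
      vnorm (Lp_fields M K \<Delta> p) (T A) \<le> c * vnorm (Lp_fields M H \<Gamma> p) A"
    using bounded_opsE[OF T] by blast
  have "S A \<in> carrier (Lp_fields M K \<Delta> p) \<and>
      (\<integral>x. field_norm K (S A) x powr p \<partial>M) \<le> \<bar>c\<bar> powr p * (\<integral>x. field_norm H A x powr p \<partial>M)"
    if A: "A \<in> carrier V" "A \<in> carrier (Lp_fields M H \<Gamma> p)" for A
  proof
    show "S A \<in> carrier (Lp_fields M K \<Delta> p)" using bounded_ops_in[OF T A(2)] TS[OF A] by simp
    define I where "I = (\<integral>x. field_norm K (S A) x powr p \<partial>M)"
    define J where "J = (\<integral>x. field_norm H A x powr p \<partial>M)"
    have IJ: "0 \<le> I" "0 \<le> J" by (auto simp: I_def J_def)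
    have "I powr (1 / p) \<le> c * J powr (1 / p)"
      using c[OF A(2)] TS[OF A] by (simp add: dom.vnorm_Lp cod.vnorm_Lp I_def J_def)
    also have "\<dots> \<le> \<bar>c\<bar> * J powr (1 / p)" by (intro mult_right_mono) auto
    finally have "(I powr (1 / p)) powr p \<le> (\<bar>c\<bar> * J powr (1 / p)) powr p"
      using \<open>0 < p\<close> by (intro powr_mono2) auto
    then show "I \<le> \<bar>c\<bar> powr p * J"
      using \<open>0 < p\<close> IJ by (simp add: powr_powr powr_mult)
  qed
  then show ?thesis using that[of "\<bar>c\<bar> powr p"] by simp
qed

end

section \<open>Decay preservation\<close>

lemma B_muD:
  assumes "\<phi> \<in> B_mu M"
  shows "\<phi> \<in> borel_measurable M" "\<exists>C. AE x in M. cmod (\<phi> x) \<le> C"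
    "0 < e \<Longrightarrow> emeasure M {x \<in> space M. e \<le> cmod (\<phi> x)} < \<infinity>"
  using assms by (simp_all add: B_mu_def)

text \<open>Admits cut-offs to sets of finite measure as the multipliers \<psi> of the
  generators.\<close>

lemma indicator_in_B_mu:
  assumes G: "G \<in> sets M" and fin: "emeasure M G < \<infinity>"
  shows "indicator G \<in> B_mu M"
proof -
  have "emeasure M {x \<in> space M. e \<le> cmod (indicator G x)} < \<infinity>" if "0 < e" for e :: real
  proof -
    have "{x \<in> space M. e \<le> cmod (indicator G x)} \<subseteq> G"
      using that by (auto simp: indicator_def split: if_splits)
    then show ?thesis using emeasure_mono[OF _ G] fin le_less_trans by blast
  qed
  moreover have "AE x in M. cmod (indicator G x) \<le> 1" by (simp add: indicator_def)
  ultimately show ?thesis unfolding B_mu_def using G by (auto intro!: exI[of _ 1])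
qed

section \<open>Concentration for operators bounded on two exponents\<close>

context measurable_family_pair
begin

text \<open>For p \<le> 2 the bound z^p \<le> 1 + z^2 is integrable on a set of finite
  measure.\<close>

lemma Lp_truncation:
  assumes A: "A \<in> carrier V" and F: "F \<in> sets M" "emeasure M F < \<infinity>" and p: "0 < p" "p \<le> 2"
  shows "mult_op M H \<Gamma> (indicator F) A \<in> carrier (Lp_fields M H \<Gamma> p)"
    "(\<integral>x. field_norm H (mult_op M H \<Gamma> (indicator F) A) x powr p \<partial>M) \<le> measure M F + dom.energy A"
proof -
  let ?B = "mult_op M H \<Gamma> (indicator F) A"
  note F' = dom.indicator_bounded[OF F(1)]
  have B: "?B \<in> carrier V" by (rule dom.L2_mult_op[OF F' A])
  have g: "integrable M (\<lambda>x. indicator F x + (field_norm H A x)\<^sup>2)"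
    using F dom.L2_sq_integrable[OF A] by simp
  have le: "AE x in M. field_norm H ?B x powr p \<le> indicator F x + (field_norm H A x)\<^sup>2"
    using dom.field_norm_mult_op[OF F'(1) A] AE_space
  proof eventually_elim
    case (elim x)
    have z: "0 \<le> field_norm H A x" using dom.field_norm_nonneg[OF dom.Lp_carrierD(1)[OF A]] elim by blast
    have "field_norm H A x powr p \<le> 1 + (field_norm H A x)\<^sup>2"
    proof (cases "field_norm H A x \<le> 1")
      case True
      then have "field_norm H A x powr p \<le> 1" using z p by (simp add: powr_le1)
      then show ?thesis by (simp add: add_increasing2)
    next
      case False
      then have "field_norm H A x powr p \<le> field_norm H A x powr 2" using p by (intro powr_mono) auto
      then show ?thesis using z by simp
    qed
    then show ?case using elim by (cases "x \<in> F") auto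
  qed
  have m: "(\<lambda>x. field_norm H ?B x powr p) \<in> borel_measurable M"
    using dom.vnorm_rep_measurable[OF dom.Lp_carrierD(1)[OF B]] by measurable
  have int: "integrable M (\<lambda>x. field_norm H ?B x powr p)"
    by (rule Bochner_Integration.integrable_bound[OF g m]) (use le in auto)
  then show "?B \<in> carrier (Lp_fields M H \<Gamma> p)"
    using dom.in_Lp_iff[OF dom.Lp_carrierD(1,2)[OF B]] by simp
  have "(\<integral>x. field_norm H ?B x powr p \<partial>M) \<le> (\<integral>x. indicator F x + (field_norm H A x)\<^sup>2 \<partial>M)"
    by (rule integral_mono_AE[OF int g le])
  also have "\<dots> = measure M F + dom.energy A"
    using F dom.L2_sq_integrable[OF A] by (simp add: dom.energy_def)
  finally show "(\<integral>x. field_norm H ?B x powr p \<partial>M) \<le> measure M F + dom.energy A" .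
qed

text \<open>Range concentration for S followed after the cut-off to F, with exponent p/2 < 1 and m
  the measure of F. The induced operator supplies the required integral bound.\<close>

lemma left_concentration:
  assumes S: "S \<in> carrier (bounded_ops V W)" and ind: "induces_bounded_Lp M H \<Gamma> K \<Delta> p S"
    and p: "1 \<le> p" "p < 2" and F: "F \<in> sets M" "emeasure M F < \<infinity>" and "0 < \<epsilon>"
  obtains G where "G \<in> sets M" "emeasure M G < \<infinity>"
    "\<And>A. A \<in> carrier V \<Longrightarrow>
      cod.energy (mult_op M K \<Delta> (indicator (space M - G)) (S (mult_op M H \<Gamma> (indicator F) A))) \<le> \<epsilon> * dom.energy A"
proof -
  define R where "R = compose (carrier V) S (mult_op M H \<Gamma> (indicator F))"
  note F' = dom.indicator_bounded[OF F(1)]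
  have R: "R \<in> carrier (bounded_ops V W)"
    unfolding R_def by (rule compose_mult_op_right[OF S F'])
  have R_apply: "R A = S (mult_op M H \<Gamma> (indicator F) A)" if "A \<in> carrier V" for A
    using that by (simp add: R_def compose_def)
  interpret R: field_operator M V "field_norm H" W "field_norm K" R
    by (rule field_operator[OF R])
  have p0: "0 < p" using p by simp
  obtain C where C: "0 \<le> C"
    "\<And>A. \<lbrakk>A \<in> carrier V; A \<in> carrier (Lp_fields M H \<Gamma> p)\<rbrakk> \<Longrightarrow> S A \<in> carrier (Lp_fields M K \<Delta> p) \<and>
      (\<integral>x. field_norm K (S A) x powr p \<partial>M) \<le> C * (\<integral>x. field_norm H A x powr p \<partial>M)"
    using induced_Lp_bound[OF ind p0] by blast
  have powr_eq: "(field_norm K (R A) x)\<^sup>2 powr (p / 2) = field_norm K (R A) x powr p"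
    if "A \<in> carrier V" "x \<in> space M" for A x
    using cod.sq_powr_half[OF cod.Lp_carrierD(1)[OF R.T_in[OF that(1)]] that(2)] .
  have bound: "R A \<in> carrier (Lp_fields M K \<Delta> p) \<and>
      (\<integral>x. field_norm K (R A) x powr p \<partial>M) \<le> C * (measure M F + dom.energy A)" if A: "A \<in> carrier V" for A
  proof -
    note B = Lp_truncation[OF A F, of p]
    have "R A \<in> carrier (Lp_fields M K \<Delta> p) \<and> (\<integral>x. field_norm K (R A) x powr p \<partial>M) \<le>
        C * (\<integral>x. field_norm H (mult_op M H \<Gamma> (indicator F) A) x powr p \<partial>M)"
      unfolding R_apply[OF A] using B p by (intro C dom.L2_mult_op[OF F' A]) auto
    moreover have "C * (\<integral>x. field_norm H (mult_op M H \<Gamma> (indicator F) A) x powr p \<partial>M) \<le>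
        C * (measure M F + dom.energy A)"
      using B(2) p C(1) by (intro mult_left_mono) auto
    ultimately show ?thesis by linarith
  qed
  obtain G where G: "G \<in> sets M" "emeasure M G < \<infinity>"
    "\<And>A. A \<in> carrier V \<Longrightarrow> (\<integral>x. indicator (space M - G) x * (field_norm K (R A) x)\<^sup>2 \<partial>M) \<le> \<epsilon> * dom.energy A"
  proof (rule R.range_concentration[of "p / 2" C "measure M F" \<epsilon>])
    show "integrable M (\<lambda>x. (field_norm K (R A) x)\<^sup>2 powr (p / 2))" if A: "A \<in> carrier V" for A
      using cod.Lp_carrierD(3)[OF conjunct1[OF bound[OF A]]]
      by (subst Bochner_Integration.integrable_cong[OF refl powr_eq[OF A]])
    show "(\<integral>x. (field_norm K (R A) x)\<^sup>2 powr (p / 2) \<partial>M) \<le> C * (measure M F + dom.energy A)"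
      if A: "A \<in> carrier V" for A
      using bound[OF A] by (subst Bochner_Integration.integral_cong[OF refl powr_eq[OF A]]) auto
  qed (use p C \<open>0 < \<epsilon>\<close> in auto)
  show ?thesis
  proof (rule that[OF G(1,2)])
    fix A assume A: "A \<in> carrier V"
    show "cod.energy (mult_op M K \<Delta> (indicator (space M - G)) (S (mult_op M H \<Gamma> (indicator F) A))) \<le> \<epsilon> * dom.energy A"
      using cod.energy_indicator[of "space M - G" "R A"] G(1) G(3)[OF A] R.T_in[OF A] R_apply[OF A] by auto
  qed
qed

text \<open>Domain concentration for the cut-off to F applied after S. Its hypothesis is obtained
  from both bounds on S by splitting each field according to its size.\<close>

lemma right_concentration:
  assumes S: "S \<in> carrier (bounded_ops V W)" and ind: "induces_bounded_Lp M H \<Gamma> K \<Delta> p S"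
    and p: "2 < p" and F: "F \<in> sets M" "emeasure M F < \<infinity>" and "0 < \<epsilon>"
  obtains G where "G \<in> sets M" "emeasure M G < \<infinity>"
    "\<And>A. A \<in> carrier V \<Longrightarrow>
      cod.energy (mult_op M K \<Delta> (indicator F) (S (mult_op M H \<Gamma> (indicator (space M - G)) A))) \<le> \<epsilon> * dom.energy A"
proof -
  define R where "R = compose (carrier V) (mult_op M K \<Delta> (indicator F)) S"
  note F' = cod.indicator_bounded[OF F(1)]
  have R: "R \<in> carrier (bounded_ops V W)"
    unfolding R_def by (rule compose_mult_op_left[OF S F'])
  have R_apply: "R A = mult_op M K \<Delta> (indicator F) (S A)" if "A \<in> carrier V" for A
    using that by (simp add: R_def compose_def)
  interpret R: field_operator M V "field_norm H" W "field_norm K" R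
    by (rule field_operator[OF R])
  have p0: "0 < p" using p by simp
  obtain C where C: "0 \<le> C"
    "\<And>A. \<lbrakk>A \<in> carrier V; A \<in> carrier (Lp_fields M H \<Gamma> p)\<rbrakk> \<Longrightarrow> S A \<in> carrier (Lp_fields M K \<Delta> p) \<and>
      (\<integral>x. field_norm K (S A) x powr p \<partial>M) \<le> C * (\<integral>x. field_norm H A x powr p \<partial>M)"
    using induced_Lp_bound[OF ind p0] by blast
  obtain D where D: "0 \<le> D" "\<And>A. A \<in> carrier V \<Longrightarrow> cod.energy (S A) \<le> D * dom.energy A"
    using bounded_op_energy[OF S] by blast
  \<comment> \<open>The fourth moment demands \<theta> \<le> 2, and the comparison z^p \<le> z^(2
    \<theta>) for z \<le> 1 demands \<theta> \<le> p/2.\<close>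
  define \<theta> where "\<theta> = min (p / 2) 2"
  have \<theta>: "1 < \<theta>" "\<theta> \<le> 2" "\<theta> \<le> p / 2" using p by (auto simp: \<theta>_def)
  define \<phi> where "\<phi> z = min z (z powr \<theta>)" for z :: real
  \<comment> \<open>With I the integral of \<phi>, the two parts of the split contribute 2 (|F| + C
    I) and 2 D I, where |F| is the measure of F; the constant dominates all coefficients.\<close>
  have bound: "cod.energy (R A) \<le> (2 * D + 2 * C + 2) * (measure M F + (\<integral>x. \<phi> ((field_norm H A x)\<^sup>2) \<partial>M))"
    if A: "A \<in> carrier V" for A
  proof -
    have rA: "rep A \<in> \<Gamma>" by (rule dom.Lp_carrierD(1)[OF A])
    have [measurable]: "field_norm H A \<in> borel_measurable M" by (rule dom.vnorm_rep_measurable[OF rA])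
    \<comment> \<open>At height z = 1 the function \<phi> (z^2) changes form. Below it dominates
      z^p, so the small part is controlled in \<open>L^p\<close>; above it equals z^2, so the large
      part is controlled in \<open>L^2\<close>.\<close>
    define E where "E = {x \<in> space M. field_norm H A x \<le> 1}"
    have E: "E \<in> sets M" unfolding E_def by measurable
    have E': "space M - E \<in> sets M" using E by auto
    define I where "I = (\<integral>x. \<phi> ((field_norm H A x)\<^sup>2) \<partial>M)"
    have \<phi>_int: "integrable M (\<lambda>x. \<phi> ((field_norm H A x)\<^sup>2))"
    proof (rule Bochner_Integration.integrable_bound[OF dom.L2_sq_integrable[OF A]])
      show "(\<lambda>x. \<phi> ((field_norm H A x)\<^sup>2)) \<in> borel_measurable M" unfolding \<phi>_def by measurable
    qed (auto simp: \<phi>_def)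
    have I: "0 \<le> I" unfolding I_def \<phi>_def by (intro Bochner_Integration.integral_nonneg) auto
    define A1 where "A1 = mult_op M H \<Gamma> (indicator E) A"
    define A2 where "A2 = mult_op M H \<Gamma> (indicator (space M - E)) A"
    have A1: "A1 \<in> carrier V" unfolding A1_def by (rule dom.L2_mult_op[OF dom.indicator_bounded[OF E] A])
    have A2: "A2 \<in> carrier V" unfolding A2_def by (rule dom.L2_mult_op[OF dom.indicator_bounded[OF E'] A])
    have le1: "AE x in M. field_norm H A1 x powr p \<le> \<phi> ((field_norm H A x)\<^sup>2)"
      using dom.field_norm_mult_op[OF dom.indicator_bounded(1)[OF E] A] AE_space
    proof eventually_elim
      case (elim x)
      have z: "0 \<le> field_norm H A x" using dom.field_norm_nonneg[OF rA] elim by blast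
      show ?case
      proof (cases "x \<in> E")
        case True
        have le: "(field_norm H A x)\<^sup>2 \<le> 1" using True z by (simp add: E_def power_le_one)
        have "field_norm H A1 x powr p = (field_norm H A x)\<^sup>2 powr (p / 2)"
          using elim True dom.sq_powr_half[OF rA, of x p] by (simp add: A1_def)
        moreover have "(field_norm H A x)\<^sup>2 powr (p / 2) \<le> (field_norm H A x)\<^sup>2"
          using le p by (intro powr_le_self) auto
        moreover have "(field_norm H A x)\<^sup>2 powr (p / 2) \<le> (field_norm H A x)\<^sup>2 powr \<theta>"
          using le \<theta> by (cases "field_norm H A x = 0") (auto intro: powr_mono')
        ultimately show ?thesis by (simp add: \<phi>_def)
      next
        case False
        then show ?thesis using elim by (simp add: A1_def \<phi>_def)
      qed
    qed
    have m1: "(\<lambda>x. field_norm H A1 x powr p) \<in> borel_measurable M"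
      using dom.vnorm_rep_measurable[OF dom.Lp_carrierD(1)[OF A1]] by measurable
    have int1: "integrable M (\<lambda>x. field_norm H A1 x powr p)"
      by (rule Bochner_Integration.integrable_bound[OF \<phi>_int m1]) (use le1 in eventually_elim, simp)
    then have A1p: "A1 \<in> carrier (Lp_fields M H \<Gamma> p)"
      using dom.in_Lp_iff[OF dom.Lp_carrierD(1,2)[OF A1]] by simp
    have norm1: "(\<integral>x. field_norm H A1 x powr p \<partial>M) \<le> I"
      unfolding I_def by (rule integral_mono_AE[OF int1 \<phi>_int le1])
    have norm2: "dom.energy A2 \<le> I"
      unfolding I_def dom.energy_def
    proof (rule integral_mono_AE[OF dom.L2_sq_integrable[OF A2] \<phi>_int])
      show "AE x in M. (field_norm H A2 x)\<^sup>2 \<le> \<phi> ((field_norm H A x)\<^sup>2)"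
        using dom.field_norm_mult_op[OF dom.indicator_bounded(1)[OF E'] A] AE_space
      proof eventually_elim
        case (elim x)
        show ?case
        proof (cases "x \<in> E")
          case True
          then show ?thesis using elim by (simp add: A2_def \<phi>_def)
        next
          case False
          then have "1 \<le> (field_norm H A x)\<^sup>2" using elim by (simp add: E_def one_le_power)
          then have "(field_norm H A x)\<^sup>2 powr 1 \<le> (field_norm H A x)\<^sup>2 powr \<theta>"
            using \<theta> by (intro powr_mono) auto
          then show ?thesis using elim False by (simp add: A2_def \<phi>_def)
        qed
      qed
    qed
    have S1: "S A1 \<in> carrier W" and S2: "S A2 \<in> carrier W"
      using bounded_ops_in[OF S] A1 A2 by auto
    have "R A = mult_op M K \<Delta> (indicator F) (S A1) \<oplus>\<^bsub>W\<^esub> mult_op M K \<Delta> (indicator F) (S A2)"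
      using dom.L2_split[OF E A] R_apply[OF A] bounded_ops_add[OF S A1 A2] cod.mult_op_add[OF F' S1 S2]
      unfolding A1_def A2_def by simp
    then have "cod.energy (R A) \<le> 2 * cod.energy (mult_op M K \<Delta> (indicator F) (S A1)) +
        2 * cod.energy (mult_op M K \<Delta> (indicator F) (S A2))"
      using cod.energy_add_le[OF cod.L2_mult_op[OF F' S1] cod.L2_mult_op[OF F' S2]] by simp
    \<comment> \<open>On a set of finite measure an \<open>L^p\<close> bound with p > 2 gives an
      \<open>L^2\<close> bound, by z^2 \<le> 1 + z^p.\<close>
    moreover have "cod.energy (mult_op M K \<Delta> (indicator F) (S A1)) \<le> measure M F + C * I"
    proof -
      have SA1: "S A1 \<in> carrier (Lp_fields M K \<Delta> p)"
        "(\<integral>x. field_norm K (S A1) x powr p \<partial>M) \<le> C * (\<integral>x. field_norm H A1 x powr p \<partial>M)"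
        using C(2)[OF A1 A1p] by auto
      have "cod.energy (mult_op M K \<Delta> (indicator F) (S A1)) = (\<integral>x. indicator F x * (field_norm K (S A1) x)\<^sup>2 \<partial>M)"
        by (rule cod.energy_indicator[OF F(1) S1])
      also have "\<dots> \<le> (\<integral>x. indicator F x + field_norm K (S A1) x powr p \<partial>M)"
      proof (rule integral_mono_AE)
        show "integrable M (\<lambda>x. indicator F x * (field_norm K (S A1) x)\<^sup>2)"
          using integrable_mult_indicator[OF F(1) cod.L2_sq_integrable[OF S1]] by simp
        show "integrable M (\<lambda>x. indicator F x + field_norm K (S A1) x powr p)"
          using F cod.Lp_carrierD(3)[OF SA1(1)] by simp
        show "AE x in M. indicator F x * (field_norm K (S A1) x)\<^sup>2 \<le> indicator F x + field_norm K (S A1) x powr p"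
          using AE_space
        proof eventually_elim
          case (elim x)
          have z: "0 \<le> field_norm K (S A1) x" using cod.field_norm_nonneg[OF cod.Lp_carrierD(1)[OF S1] elim] .
          have "(field_norm K (S A1) x)\<^sup>2 \<le> 1 + field_norm K (S A1) x powr p"
          proof (cases "field_norm K (S A1) x \<le> 1")
            case True
            then have "(field_norm K (S A1) x)\<^sup>2 \<le> 1" using z by (simp add: power_le_one)
            then show ?thesis by (simp add: add_increasing2)
          next
            case False
            then have "field_norm K (S A1) x powr 2 \<le> field_norm K (S A1) x powr p"
              using p by (intro powr_mono) auto
            then show ?thesis using z by simp
          qed
          then show ?case by (cases "x \<in> F") auto
        qed
      qed
      also have "\<dots> = measure M F + (\<integral>x. field_norm K (S A1) x powr p \<partial>M)"
        using F cod.Lp_carrierD(3)[OF SA1(1)] by simp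
      also have "\<dots> \<le> measure M F + C * I"
        using SA1(2) mult_left_mono[OF norm1 C(1)] by simp
      finally show ?thesis .
    qed
    moreover have "cod.energy (mult_op M K \<Delta> (indicator F) (S A2)) \<le> D * I"
      using cod.energy_indicator_le[OF F(1) S2] D(2)[OF A2] mult_left_mono[OF norm2 D(1)] by linarith
    ultimately have "cod.energy (R A) \<le> 2 * measure M F + 2 * (C * I) + 2 * (D * I)" by linarith
    also have "\<dots> \<le> (2 * D + 2 * C + 2) * (measure M F + I)"
      using C(1) D(1) I by (simp add: algebra_simps)
    finally show ?thesis by (simp add: I_def)
  qed
  obtain G where G: "G \<in> sets M" "emeasure M G < \<infinity>"
    "\<And>A. \<lbrakk>A \<in> carrier V; AE x in M. x \<in> G \<longrightarrow> field_norm H A x = 0\<rbrakk> \<Longrightarrow> cod.energy (R A) \<le> \<epsilon> * dom.energy A"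
  proof (rule R.domain_concentration[of \<theta> "2 * D + 2 * C + 2" "measure M F" \<epsilon>])
    show "cod.energy (R A) \<le> (2 * D + 2 * C + 2) *
        (measure M F + (\<integral>x. min ((field_norm H A x)\<^sup>2) ((field_norm H A x)\<^sup>2 powr \<theta>) \<partial>M))"
      if "A \<in> carrier V" for A
      using bound[OF that] by (simp add: \<phi>_def)
  qed (use \<theta> C D \<open>0 < \<epsilon>\<close> in auto)
  show ?thesis
  proof (rule that[OF G(1,2)])
    fix A assume A: "A \<in> carrier V"
    have G': "space M - G \<in> sets M" using G(1) by auto
    let ?B = "mult_op M H \<Gamma> (indicator (space M - G)) A"
    have B: "?B \<in> carrier V" by (rule dom.L2_mult_op[OF dom.indicator_bounded[OF G'] A])
    have "AE x in M. x \<in> G \<longrightarrow> field_norm H ?B x = 0"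
      using dom.field_norm_mult_op[OF dom.indicator_bounded(1)[OF G'] A] by eventually_elim auto
    then have "cod.energy (R ?B) \<le> \<epsilon> * dom.energy ?B" by (rule G(3)[OF B])
    also have "\<dots> \<le> \<epsilon> * dom.energy A"
      using dom.energy_indicator_le[OF G' A] \<open>0 < \<epsilon>\<close> by (intro mult_left_mono) auto
    finally show "cod.energy (mult_op M K \<Delta> (indicator F) (S ?B)) \<le> \<epsilon> * dom.energy A"
      by (simp add: R_apply[OF B])
  qed
qed

section \<open>Norm approximation by cut-offs\<close>

theorem left_decay:
  assumes S: "S \<in> carrier (bounded_ops V W)" and ind: "induces_bounded_Lp M H \<Gamma> K \<Delta> p S"
    and p: "1 \<le> p" "p < 2"
  shows "left_decay_preserving M H \<Gamma> K \<Delta> S"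
  unfolding left_decay_preserving_def Let_def
proof (intro ballI closed_span_bounded_opsI)
  fix \<phi> assume "\<phi> \<in> B_mu M"
  note \<phi> = B_muD[OF this]
  then obtain c where c: "AE x in M. cmod (\<phi> x) \<le> c" by blast
  note \<phi>' = \<phi>(1) c
  let ?x = "compose (carrier V) S (mult_op M H \<Gamma> \<phi>)"
  show x: "?x \<in> carrier (bounded_ops V W)" by (rule compose_mult_op_right[OF S \<phi>'])
  have x_apply: "?x A = S (mult_op M H \<Gamma> \<phi> A)" if "A \<in> carrier V" for A
    using that by (simp add: compose_def)
  obtain D where D: "0 \<le> D" "\<And>A. A \<in> carrier V \<Longrightarrow> cod.energy (S A) \<le> D * dom.energy A"
    using bounded_op_energy[OF S] by blast
  fix e :: real assume e: "0 < e"
  define \<eta> where "\<eta> = e / (2 * sqrt (D + 1))"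
  define \<epsilon> where "\<epsilon> = e\<^sup>2 / (4 * (c\<^sup>2 + 1))"
  have \<eta>: "0 < \<eta>" "2 * (D * \<eta>\<^sup>2) \<le> e\<^sup>2 / 2"
    using e D(1) by (auto simp: \<eta>_def power_divide power_mult_distrib field_simps)
  have c1: "0 < c\<^sup>2 + 1" by (simp add: add_nonneg_pos)
  have \<epsilon>: "0 < \<epsilon>" "2 * (\<epsilon> * c\<^sup>2) \<le> e\<^sup>2 / 2"
    using e c1 by (auto simp: \<epsilon>_def field_simps)
  define F where "F = {x \<in> space M. \<eta> \<le> cmod (\<phi> x)}"
  have F: "F \<in> sets M" "emeasure M F < \<infinity>"
    using \<phi>(1) \<phi>(3)[OF \<eta>(1)] by (auto simp: F_def)
  have F'': "space M - F \<in> sets M" using F by auto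
  obtain G where G: "G \<in> sets M" "emeasure M G < \<infinity>"
    "\<And>A. A \<in> carrier V \<Longrightarrow> cod.energy (mult_op M K \<Delta> (indicator (space M - G)) (S (mult_op M H \<Gamma> (indicator F) A)))
      \<le> \<epsilon> * dom.energy A"
    using left_concentration[OF S ind p F \<epsilon>(1)] by blast
  have G': "space M - G \<in> sets M" using G(1) by auto
  \<comment> \<open>A single generator, with \<psi> the indicator of \<open>G\<close> and T the
    operator to be approximated.\<close>
  let ?y = "compose (carrier V) (mult_op M K \<Delta> (indicator G)) ?x"
  let ?gens = "{compose (carrier V) (mult_op M K \<Delta> \<psi>) T |\<psi> T. \<psi> \<in> B_mu M \<and> T \<in> carrier (bounded_ops V W)}"
  have "?y \<in> ?gens" using indicator_in_B_mu[OF G(1,2)] x by blast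
  moreover have "?y \<in> carrier (bounded_ops V W)"
    by (rule compose_mult_op_left[OF x cod.indicator_bounded[OF G(1)]])
  moreover have "cod.energy (?x A \<oplus>\<^bsub>W\<^esub> (-1) \<odot>\<^bsub>W\<^esub> ?y A) \<le> e\<^sup>2 * dom.energy A" if A: "A \<in> carrier V" for A
  proof -
    \<comment> \<open>The field \<phi> A is split along F: concentration handles the part on F, and
      off F the multiplier is smaller than \<eta>.\<close>
    define A' where "A' = mult_op M H \<Gamma> \<phi> A"
    define B where "B = mult_op M H \<Gamma> (indicator F) A'"
    define B' where "B' = mult_op M H \<Gamma> (indicator (space M - F)) A'"
    have A': "A' \<in> carrier V" unfolding A'_def by (rule dom.L2_mult_op[OF \<phi>' A])
    have B: "B \<in> carrier V" unfolding B_def by (rule dom.L2_mult_op[OF dom.indicator_bounded[OF F(1)] A'])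
    have B': "B' \<in> carrier V" unfolding B'_def by (rule dom.L2_mult_op[OF dom.indicator_bounded[OF F''] A'])
    note SB = bounded_ops_in[OF S B] bounded_ops_in[OF S B']
    have SA': "S A' = S B \<oplus>\<^bsub>W\<^esub> S B'"
      using dom.L2_split[OF F(1) A'] bounded_ops_add[OF S B B'] unfolding B_def B'_def by simp
    have "?x A \<oplus>\<^bsub>W\<^esub> (-1) \<odot>\<^bsub>W\<^esub> ?y A = mult_op M K \<Delta> (indicator (space M - G)) (S A')"
      using cod.L2_minus_indicator[OF G(1) bounded_ops_in[OF S A']] A by (simp add: compose_def A'_def)
    also have "\<dots> = mult_op M K \<Delta> (indicator (space M - G)) (S B) \<oplus>\<^bsub>W\<^esub>
        mult_op M K \<Delta> (indicator (space M - G)) (S B')"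
      unfolding SA' by (rule cod.mult_op_add[OF cod.indicator_bounded[OF G'] SB])
    finally have "cod.energy (?x A \<oplus>\<^bsub>W\<^esub> (-1) \<odot>\<^bsub>W\<^esub> ?y A) \<le>
        2 * cod.energy (mult_op M K \<Delta> (indicator (space M - G)) (S B)) +
        2 * cod.energy (mult_op M K \<Delta> (indicator (space M - G)) (S B'))"
      using cod.energy_add_le[OF cod.L2_mult_op[OF cod.indicator_bounded[OF G'] SB(1)]
          cod.L2_mult_op[OF cod.indicator_bounded[OF G'] SB(2)]] by simp
    also have "\<dots> \<le> 2 * (\<epsilon> * (c\<^sup>2 * dom.energy A)) + 2 * (D * (\<eta>\<^sup>2 * dom.energy A))"
    proof (intro add_mono mult_left_mono)
      have "dom.energy A' \<le> c\<^sup>2 * dom.energy A"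
        unfolding A'_def by (rule dom.energy_mult_op_le[OF \<phi>' A])
      then have "\<epsilon> * dom.energy A' \<le> \<epsilon> * (c\<^sup>2 * dom.energy A)" using \<epsilon>(1) by (intro mult_left_mono) auto
      then show "cod.energy (mult_op M K \<Delta> (indicator (space M - G)) (S B)) \<le> \<epsilon> * (c\<^sup>2 * dom.energy A)"
        using G(3)[OF A'] unfolding B_def by linarith
      have "AE x in M. (field_norm H B' x)\<^sup>2 \<le> \<eta>\<^sup>2 * (field_norm H A x)\<^sup>2 + 0 * (field_norm H A x)\<^sup>2"
        using dom.field_norm_mult_op[OF dom.indicator_bounded(1)[OF F''] A']
          dom.field_norm_mult_op[OF \<phi>(1) A] AE_space
      proof eventually_elim
        case (elim x)
        show ?case
        proof (cases "x \<in> F")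
          case True
          then show ?thesis using elim by (simp add: B'_def)
        next
          case False
          then have "(cmod (\<phi> x))\<^sup>2 \<le> \<eta>\<^sup>2" using elim by (intro power_mono) (auto simp: F_def)
          then show ?thesis using elim False by (simp add: B'_def A'_def power_mult_distrib mult_right_mono)
        qed
      qed
      from dom.energy_le[OF B' A A this] have "dom.energy B' \<le> \<eta>\<^sup>2 * dom.energy A" by simp
      then have "D * dom.energy B' \<le> D * (\<eta>\<^sup>2 * dom.energy A)" using D(1) by (rule mult_left_mono)
      then show "cod.energy (mult_op M K \<Delta> (indicator (space M - G)) (S B')) \<le> D * (\<eta>\<^sup>2 * dom.energy A)"
        using cod.energy_indicator_le[OF G' SB(2)] D(2)[OF B'] by linarith
    qed auto
    also have "\<dots> = (2 * (\<epsilon> * c\<^sup>2) + 2 * (D * \<eta>\<^sup>2)) * dom.energy A" by (simp add: algebra_simps)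
    also have "\<dots> \<le> e\<^sup>2 * dom.energy A"
      using \<eta>(2) \<epsilon>(2) by (intro mult_right_mono dom.energy_nonneg) auto
    finally show ?thesis .
  qed
  ultimately show "\<exists>T\<in>?gens \<inter> carrier (bounded_ops V W). \<forall>A\<in>carrier V.
      cod.energy (?x A \<oplus>\<^bsub>W\<^esub> (-1) \<odot>\<^bsub>W\<^esub> T A) \<le> e\<^sup>2 * dom.energy A"
    by blast
qed

theorem right_decay:
  assumes S: "S \<in> carrier (bounded_ops V W)" and ind: "induces_bounded_Lp M H \<Gamma> K \<Delta> p S"
    and p: "2 < p"
  shows "right_decay_preserving M H \<Gamma> K \<Delta> S"
  unfolding right_decay_preserving_def Let_def
proof (intro ballI closed_span_bounded_opsI)
  fix \<phi> assume "\<phi> \<in> B_mu M"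
  note \<phi> = B_muD[OF this]
  then obtain c where c: "AE x in M. cmod (\<phi> x) \<le> c" by blast
  note \<phi>' = \<phi>(1) c
  let ?x = "compose (carrier V) (mult_op M K \<Delta> \<phi>) S"
  show x: "?x \<in> carrier (bounded_ops V W)" by (rule compose_mult_op_left[OF S \<phi>'])
  obtain D where D: "0 \<le> D" "\<And>A. A \<in> carrier V \<Longrightarrow> cod.energy (S A) \<le> D * dom.energy A"
    using bounded_op_energy[OF S] by blast
  fix e :: real assume e: "0 < e"
  define \<eta> where "\<eta> = e / (2 * sqrt (D + 1))"
  define \<epsilon> where "\<epsilon> = e\<^sup>2 / (4 * (c\<^sup>2 + 1))"
  have \<eta>: "0 < \<eta>" "2 * (D * \<eta>\<^sup>2) \<le> e\<^sup>2 / 2"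
    using e D(1) by (auto simp: \<eta>_def power_divide power_mult_distrib field_simps)
  have c1: "0 < c\<^sup>2 + 1" by (simp add: add_nonneg_pos)
  have \<epsilon>: "0 < \<epsilon>" "2 * (\<epsilon> * c\<^sup>2) \<le> e\<^sup>2 / 2"
    using e c1 by (auto simp: \<epsilon>_def field_simps)
  define F where "F = {x \<in> space M. \<eta> \<le> cmod (\<phi> x)}"
  have F: "F \<in> sets M" "emeasure M F < \<infinity>"
    using \<phi>(1) \<phi>(3)[OF \<eta>(1)] by (auto simp: F_def)
  obtain G where G: "G \<in> sets M" "emeasure M G < \<infinity>"
    "\<And>A. A \<in> carrier V \<Longrightarrow> cod.energy (mult_op M K \<Delta> (indicator F) (S (mult_op M H \<Gamma> (indicator (space M - G)) A)))
      \<le> \<epsilon> * dom.energy A"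
    using right_concentration[OF S ind p F \<epsilon>(1)] by blast
  have G': "space M - G \<in> sets M" using G(1) by auto
  \<comment> \<open>Again one generator: the operator itself after the cut-off to \<open>G\<close>
    in the domain.\<close>
  let ?y = "compose (carrier V) ?x (mult_op M H \<Gamma> (indicator G))"
  let ?gens = "{compose (carrier V) T (mult_op M H \<Gamma> \<psi>) |T \<psi>. \<psi> \<in> B_mu M \<and> T \<in> carrier (bounded_ops V W)}"
  have "?y \<in> ?gens" using indicator_in_B_mu[OF G(1,2)] x by blast
  moreover have "?y \<in> carrier (bounded_ops V W)"
    by (rule compose_mult_op_right[OF x dom.indicator_bounded[OF G(1)]])
  moreover have "cod.energy (?x A \<oplus>\<^bsub>W\<^esub> (-1) \<odot>\<^bsub>W\<^esub> ?y A) \<le> e\<^sup>2 * dom.energy A" if A: "A \<in> carrier V" for A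
  proof -
    define Z where "Z = mult_op M H \<Gamma> (indicator G) A"
    define B where "B = mult_op M H \<Gamma> (indicator (space M - G)) A"
    have Z: "Z \<in> carrier V" unfolding Z_def by (rule dom.L2_mult_op[OF dom.indicator_bounded[OF G(1)] A])
    have B: "B \<in> carrier V" unfolding B_def by (rule dom.L2_mult_op[OF dom.indicator_bounded[OF G'] A])
    have SB: "S B \<in> carrier W" by (rule bounded_ops_in[OF S B])
    define Q where "Q = mult_op M K \<Delta> (indicator F) (S B)"
    have Q: "Q \<in> carrier W" unfolding Q_def by (rule cod.L2_mult_op[OF cod.indicator_bounded[OF F(1)] SB])
    define P where "P = mult_op M K \<Delta> \<phi> (S B)"
    have P: "P \<in> carrier W" unfolding P_def by (rule cod.L2_mult_op[OF \<phi>' SB])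
    have yA: "?y A = ?x Z" using A by (simp add: compose_def Z_def)
    have "?x A \<oplus>\<^bsub>W\<^esub> (-1) \<odot>\<^bsub>W\<^esub> ?y A = ?x (A \<oplus>\<^bsub>V\<^esub> (-1) \<odot>\<^bsub>V\<^esub> Z)"
      unfolding yA using bounded_ops_add[OF x A dom.L2_smult[OF Z]] bounded_ops_smult[OF x Z] by simp
    also have "A \<oplus>\<^bsub>V\<^esub> (-1) \<odot>\<^bsub>V\<^esub> Z = B"
      unfolding Z_def B_def by (rule dom.L2_minus_indicator[OF G(1) A])
    also have "?x B = P" using B by (simp add: compose_def P_def)
    finally have eq: "?x A \<oplus>\<^bsub>W\<^esub> (-1) \<odot>\<^bsub>W\<^esub> ?y A = P" .
    \<comment> \<open>On F the multiplier is at most \<open>c\<close> and \<open>Q\<close> agrees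
      with \<open>S B\<close>; off F it is below \<eta>. Since the two parts are disjoint, no factor
      2 arises.\<close>
    have "AE x in M. (field_norm K P x)\<^sup>2 \<le> c\<^sup>2 * (field_norm K Q x)\<^sup>2 + \<eta>\<^sup>2 * (field_norm K (S B) x)\<^sup>2"
      using cod.field_norm_mult_op[OF \<phi>(1) SB] cod.field_norm_mult_op[OF cod.indicator_bounded(1)[OF F(1)] SB]
        c AE_space
    proof eventually_elim
      case (elim x)
      show ?case
      proof (cases "x \<in> F")
        case True
        have "(cmod (\<phi> x))\<^sup>2 \<le> c\<^sup>2" using elim by (intro power_mono) auto
        then have "(cmod (\<phi> x))\<^sup>2 * (field_norm K (S B) x)\<^sup>2 \<le> c\<^sup>2 * (field_norm K (S B) x)\<^sup>2"
          by (rule mult_right_mono) simp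
        then show ?thesis using elim True
          by (simp add: P_def Q_def power_mult_distrib add_increasing2)
      next
        case False
        then have "(cmod (\<phi> x))\<^sup>2 \<le> \<eta>\<^sup>2" using elim by (intro power_mono) (auto simp: F_def)
        then show ?thesis using elim False
          by (simp add: P_def Q_def power_mult_distrib mult_right_mono)
      qed
    qed
    then have "cod.energy P \<le> c\<^sup>2 * cod.energy Q + \<eta>\<^sup>2 * cod.energy (S B)"
      by (rule cod.energy_le[OF P Q SB])
    also have "\<dots> \<le> c\<^sup>2 * (\<epsilon> * dom.energy A) + \<eta>\<^sup>2 * (D * dom.energy A)"
    proof (intro add_mono mult_left_mono)
      show "cod.energy Q \<le> \<epsilon> * dom.energy A" unfolding Q_def B_def by (rule G(3)[OF A])
      have "dom.energy B \<le> dom.energy A" unfolding B_def by (rule dom.energy_indicator_le[OF G' A])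
      then show "cod.energy (S B) \<le> D * dom.energy A"
        using D(2)[OF B] D(1) mult_left_mono[of "dom.energy B" "dom.energy A" D] by linarith
    qed auto
    also have "\<dots> = (\<epsilon> * c\<^sup>2 + D * \<eta>\<^sup>2) * dom.energy A" by (simp add: algebra_simps)
    also have "\<dots> \<le> e\<^sup>2 * dom.energy A"
    proof (rule mult_right_mono[OF _ dom.energy_nonneg])
      have "0 \<le> e\<^sup>2" by simp
      then show "\<epsilon> * c\<^sup>2 + D * \<eta>\<^sup>2 \<le> e\<^sup>2" using \<eta>(2) \<epsilon>(2) by linarith
    qed
    finally show ?thesis unfolding eq .
  qed
  ultimately show "\<exists>T\<in>?gens \<inter> carrier (bounded_ops V W). \<forall>A\<in>carrier V.
      cod.energy (?x A \<oplus>\<^bsub>W\<^esub> (-1) \<odot>\<^bsub>W\<^esub> T A) \<le> e\<^sup>2 * dom.energy A"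
    by blast
qed

end

theorem theorem6p1:
  fixes M :: "'x measure"
    and H :: "'x \<Rightarrow> 'a chilbert" and \<Gamma> :: "('x \<Rightarrow> 'a) set"
    and K :: "'x \<Rightarrow> 'b chilbert" and \<Delta> :: "('x \<Rightarrow> 'b) set"
    and N :: nat and p :: real
    and S :: "('x \<Rightarrow> 'a) set \<Rightarrow> ('x \<Rightarrow> 'b) set"
  assumes "emeasure M (space M) = \<infinity>"
    and "measurable_family M H \<Gamma>" and "measurable_family M K \<Delta>"
    and "\<And>x. x \<in> space M \<Longrightarrow> dim_at_most (H x) N"
    and "\<And>x. x \<in> space M \<Longrightarrow> dim_at_most (K x) N"
    and "1 \<le> p" and "p \<noteq> 2"
    and "S \<in> carrier (bounded_ops (direct_integral M H \<Gamma>) (direct_integral M K \<Delta>))"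
    and "induces_bounded_Lp M H \<Gamma> K \<Delta> p S"
  shows "(p < 2 \<longrightarrow> left_decay_preserving M H \<Gamma> K \<Delta> S) \<and>
         (p > 2 \<longrightarrow> right_decay_preserving M H \<Gamma> K \<Delta> S)"
proof -
  interpret measurable_family_pair M H \<Gamma> K \<Delta>
    using assms(2,3) by (rule measurable_family_pair.intro)
  show ?thesis
    using left_decay[OF assms(8,9,6)] right_decay[OF assms(8,9)] by blast
qed

end
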